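(* Let $r$ be a realization with extracted error $e=\operatorname{Err}(r)$, magnitude $A(e)\in[0,\infty]$, and a sound upper certificate $U(r)$, i.e. $A(e)\le U(r)$. Suppose either: (i) $e$ is a half-line error: a function $e\in L^1_{\mathrm{loc}}([0,\infty))$ with $\int_0^\infty|e(y)|e^{-\varepsilon y}dy<\infty$ for all $\varepsilon>0$, whose continuous Abel coefficients $a_j=\lim_{\varepsilon\downarrow0}\varepsilon\int_0^\infty e(y)e^{-\varepsilon y}e^{-i\gamma_jy}dy$ exist at distinct real frequencies $\gamma_1,\dots,\gamma_m$, and its tail magnitude satisfies $A_\infty^c(e)\le A(e)$; or (ii) $e=(e_n)_{n\ge0}$ is a sequence error with $\sum|e_n|\varrho^n<\infty$ for $0<\varrho<1$, whose discrete Abel coefficients $a_j=\lim_{\varrho\uparrow1}(1-\varrho)\sum_{n\ge0}e_n\varrho^ne^{-in\theta_j}$ exist at pairwise distinct phases $\theta_1,\dots,\theta_m\in\mathbb R/2\pi\mathbb Z$, and its tail magnitude satisfies $A_\infty^d(e)\le A(e)$. Let $(G,\chi)$ denote the associated orbit group and distinct character family. Then $$q_{G,\chi}(a)\le A(e)\le U(r).$$ Moreover: (1) the lower endpoint has the dual formula $q_{G,\chi}(a)=\sup_{c\ne0}|\langle a,c\rangle|/\lambda_{G,\chi}(c)$; (2) if the coefficients are known only up to compact-convex uncertainty, $a\in b+K$ with $b\in\mathbb C^m$ and $K\subseteq\mathbb C^m$ nonempty compact convex, the corresponding minimax lower endpoint is $\inf_{u\in K}q_{G,\chi}(b+u)=\sup_{\lambda_{G,\chi}(c)\le1}\bigl(\operatorname{Re}\langle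 b,c\rangle-\sigma_K(-c)\bigr)$; (3) for a compatible countable family of distinct characters $(\chi_j)_{j\ge1}$ and coefficients $(a_j)_{j\ge1}$ the simultaneous lower endpoint, i.e. the least norm of $f\in L^\infty(G)$ with $\int_Gf\overline{\chi_j}=a_j$ for all $j\ge 1$, is the supremum of the interpolation norms of the finite truncations; (4) if the orbit group is a full torus (the joint character map $G\to\mathbb T^m$ is an isomorphism), the finite-dimensional endpoint is comparable to $\|a\|_2$, namely $\|a\|_2\le q_{G,\chi}(a)\le\sqrt2\,\|a\|_2$; relations among the characters can make it substantially larger, e.g. for $G=\mathbb T$ and $\chi_j(z)=z^j$, $1\le j\le m$, one has $q_{G,\chi}(1,\dots,1)\ge m/(1+\log m)$.
   Context: A realization–error setting assigns to each realization $r$ an error object $\operatorname{Err}(r)$ and to each error object a magnitude $A\in[0,\infty]$; a sound upper certificate is a number $U(r)\in[0,\infty]$ with $A(\operatorname{Err}(r))\le U(r)$. Tail amplitudes: $A_\infty^c(F)=\lim_{Y\to\infty}\operatorname{ess\,sup}_{y\ge Y}|F(y)|$ and $A_\infty^d(F)=\lim_{N\to\infty}\sup_{n\ge N}|F_n|$. Orbit groups: in case (i), $G$ is the closure in $\mathbb T^m$ ($\mathbb T=\{|z|=1\}$) of $\{(e^{i\gamma_1y},\dots,e^{i\gamma_my}):y\in\mathbb R\}$; in case (ii), $G$ is the closure of $\{(e^{in\theta_1},\dots,e^{in\theta_m}):n\in\mathbb Z\}$; in both cases $\chi_j(z)=z_j$ restricted to $G$. For any compact metrizable abelian group $G$ with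 Haar probability measure $\mu$ and distinct characters $\chi_1,\dots,\chi_m$: $\lambda_{G,\chi}(c)=\int_G|\sum_jc_j\chi_j|\,d\mu$, $\langle a,c\rangle=\sum_ja_j\overline{c_j}$, and $$q_{G,\chi}(a)=\inf\Bigl\{\|f\|_{L^\infty(G)}:\int_Gf\overline{\chi_j}\,d\mu=a_j\ (1\le j\le m)\Bigr\}.$$ The support function is $\sigma_K(c)=\sup_{u\in K}\operatorname{Re}\langle u,c\rangle$. In (3), $G$ is a compact metrizable abelian group, and the least norm is taken to be $\infty$ if no such $f$ exists. *)

theory Defs
  imports "HOL-Probability.Probability" "HOL-Algebra.Group" "HOL-Library.Real_Mod"
begin

section \<open>Compact metrizable abelian groups, Haar measure, characters\<close>

locale compact_metrizable_ab_group = comm_group G for G :: "('g, 'x) monoid_scheme" (structure) +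
  fixes X :: "'g topology"
  assumes topspace_eq_carrier: "topspace X = carrier G"
    and continuous_mult: "continuous_map (prod_topology X X) X (\<lambda>(x, y). x \<otimes> y)"
    and continuous_inv: "continuous_map X X (\<lambda>x. inv x)"
    and compact: "compact_space X"
    and metrizable: "metrizable_space X"

text \<open>
  Regularity need not be required: finite Borel measures on compact metrizable spaces are regular.
\<close>

definition haar_prob :: "('g, 'x) monoid_scheme \<Rightarrow> 'g topology \<Rightarrow> 'g measure \<Rightarrow> bool" where
  "haar_prob G X \<mu> \<longleftrightarrow>
     space \<mu> = topspace X \<and>
     sets \<mu> = sigma_sets (topspace X) {V. openin X V} \<and>
     prob_space \<mu> \<and>
     (\<forall>g\<in>carrier G. \<forall>B\<in>sets \<mu>. emeasure \<mu> ((\<lambda>x. g \<otimes>\<^bsub>G\<^esub> x) ` B) = emeasure \<mu> B)"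

definition mult_group_on :: "'a::monoid_mult set \<Rightarrow> 'a monoid" where
  "mult_group_on S = \<lparr>carrier = S, mult = (*), one = 1\<rparr>"

definition circle :: "complex set" where
  "circle = {z. cmod z = 1}"

text \<open>Multiplication on \<^typ>\<open>complex ^ 'n\<close> is componentwise.\<close>

definition torus :: "(complex ^ 'n) set" where
  "torus = {z. \<forall>j. z $ j \<in> circle}"

definition character :: "('g, 'x) monoid_scheme \<Rightarrow> 'g topology \<Rightarrow> ('g \<Rightarrow> complex) \<Rightarrow> bool" where
  "character G X f \<longleftrightarrow>
     f \<in> hom G (mult_group_on circle) \<and> continuous_map X (top_of_set circle) f"

definition distinct_characters ::
    "('g, 'x) monoid_scheme \<Rightarrow> 'g topology \<Rightarrow> 'i set \<Rightarrow> ('i \<Rightarrow> 'g \<Rightarrow> complex) \<Rightarrow> bool" where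
  "distinct_characters G X J chi \<longleftrightarrow>
     (\<forall>j\<in>J. character G X (chi j)) \<and>
     (\<forall>i\<in>J. \<forall>j\<in>J. i \<noteq> j \<longrightarrow> (\<exists>x\<in>carrier G. chi i x \<noteq> chi j x))"

definition joint_map :: "('n \<Rightarrow> 'g \<Rightarrow> complex) \<Rightarrow> 'g \<Rightarrow> complex ^ 'n" where
  "joint_map chi x = (\<chi> j. chi j x)"

section \<open>Interpolation norm and its dual data\<close>

definition linf_norm :: "'g measure \<Rightarrow> ('g \<Rightarrow> complex) \<Rightarrow> ennreal" where
  "linf_norm \<mu> f = esssup \<mu> (\<lambda>x. ennreal (cmod (f x)))"

definition interpolants ::
    "'g measure \<Rightarrow> 'i set \<Rightarrow> ('i \<Rightarrow> 'g \<Rightarrow> complex) \<Rightarrow> ('i \<Rightarrow> complex) \<Rightarrow> ('g \<Rightarrow> complex) set" where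
  "interpolants \<mu> J chi a =
     {f. f \<in> borel_measurable \<mu> \<and> linf_norm \<mu> f < \<infinity> \<and>
         (\<forall>j\<in>J. (LINT x|\<mu>. f x * cnj (chi j x)) = a j)}"

text \<open>The value is \<open>\<infinity>\<close> if there are no interpolants.\<close>

definition interp_norm ::
    "'g measure \<Rightarrow> 'i set \<Rightarrow> ('i \<Rightarrow> 'g \<Rightarrow> complex) \<Rightarrow> ('i \<Rightarrow> complex) \<Rightarrow> ennreal" where
  "interp_norm \<mu> J chi a = (INF f\<in>interpolants \<mu> J chi a. linf_norm \<mu> f)"

definition l1_dual :: "'g measure \<Rightarrow> ('n::finite \<Rightarrow> 'g \<Rightarrow> complex) \<Rightarrow> complex ^ 'n \<Rightarrow> real" where
  "l1_dual \<mu> chi c = (LINT x|\<mu>. cmod (\<Sum>j\<in>UNIV. c $ j * chi j x))"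

definition cdot :: "complex ^ 'n \<Rightarrow> complex ^ 'n \<Rightarrow> complex" where
  "cdot a c = (\<Sum>j\<in>UNIV. a $ j * cnj (c $ j))"

text \<open>Only used for nonempty compact sets, where the supremum is over a nonempty bounded set.\<close>

definition support_fun :: "(complex ^ 'n) set \<Rightarrow> complex ^ 'n \<Rightarrow> real" where
  "support_fun K c = (SUP u\<in>K. Re (cdot u c))"

section \<open>Errors, tail amplitudes, Abel coefficients, orbit groups\<close>

text \<open>A half-line error is a function on \<open>[0,\<infinity>)\<close>; its values at negative arguments are never used.\<close>

datatype error_object = Half_Line "real \<Rightarrow> complex" | Sequence "nat \<Rightarrow> complex"

definition half_line_error :: "(real \<Rightarrow> complex) \<Rightarrow> bool" where
  "half_line_error e \<longleftrightarrow>
     (\<forall>T. set_integrable lebesgue {0..T} e) \<and>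
     (\<forall>\<epsilon>>0. set_integrable lebesgue {0..} (\<lambda>y. cmod (e y) * exp (- \<epsilon> * y)))"

definition sequence_error :: "(nat \<Rightarrow> complex) \<Rightarrow> bool" where
  "sequence_error e \<longleftrightarrow> (\<forall>\<rho>. 0 < \<rho> \<and> \<rho> < 1 \<longrightarrow> summable (\<lambda>n. cmod (e n) * \<rho> ^ n))"

text \<open>Both limits are limits of decreasing functions with values in \<open>[0,\<infinity>]\<close>, so they exist.\<close>

definition cont_tail_amplitude :: "(real \<Rightarrow> complex) \<Rightarrow> ennreal" where
  "cont_tail_amplitude F =
     Lim at_top (\<lambda>Y. esssup (lebesgue_on {Y..}) (\<lambda>y. ennreal (cmod (F y))))"

definition disc_tail_amplitude :: "(nat \<Rightarrow> complex) \<Rightarrow> ennreal" where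
  "disc_tail_amplitude F = lim (\<lambda>N. SUP n\<in>{N..}. ennreal (cmod (F n)))"

definition has_cont_abel_coeff :: "(real \<Rightarrow> complex) \<Rightarrow> real \<Rightarrow> complex \<Rightarrow> bool" where
  "has_cont_abel_coeff e \<gamma> \<alpha> \<longleftrightarrow>
     ((\<lambda>\<epsilon>. of_real \<epsilon> * (LINT y:{0..}|lebesgue. e y * of_real (exp (- \<epsilon> * y)) * cis (- \<gamma> * y)))
        \<longlongrightarrow> \<alpha>) (at_right 0)"

definition has_disc_abel_coeff :: "(nat \<Rightarrow> complex) \<Rightarrow> real \<Rightarrow> complex \<Rightarrow> bool" where
  "has_disc_abel_coeff e \<theta> \<alpha> \<longleftrightarrow>
     ((\<lambda>\<rho>. of_real (1 - \<rho>) * (\<Sum>n. e n * of_real (\<rho> ^ n) * cis (- real n * \<theta>)))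
        \<longlongrightarrow> \<alpha>) (at_left 1)"

text \<open>The torus is closed in \<^typ>\<open>complex ^ 'n\<close>, so the closure may be taken in the ambient space.\<close>

definition cont_orbit :: "('n \<Rightarrow> real) \<Rightarrow> (complex ^ 'n) set" where
  "cont_orbit \<gamma> = closure (range (\<lambda>y::real. \<chi> j. cis (\<gamma> j * y)))"

definition disc_orbit :: "('n \<Rightarrow> real) \<Rightarrow> (complex ^ 'n) set" where
  "disc_orbit \<theta> = closure (range (\<lambda>n::int. \<chi> j. cis (of_int n * \<theta> j)))"

text \<open>
  \<open>orbit_case e Amp a G\<close>: the error \<open>e\<close>, whose magnitude is \<open>Amp\<close>, is a half-line error or a
  sequence error with Abel coefficients \<open>a\<close> and tail magnitude at most \<open>Amp\<close>, and \<open>G\<close> is the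
  orbit group of its frequencies or phases.
\<close>

definition orbit_case ::
    "error_object \<Rightarrow> ennreal \<Rightarrow> complex ^ 'n \<Rightarrow> (complex ^ 'n) set \<Rightarrow> bool" where
  "orbit_case e Amp a G \<longleftrightarrow>
     (\<exists>F \<gamma>. e = Half_Line F \<and> half_line_error F \<and> inj \<gamma> \<and>
        (\<forall>j. has_cont_abel_coeff F (\<gamma> j) (a $ j)) \<and>
        cont_tail_amplitude F \<le> Amp \<and> G = cont_orbit \<gamma>) \<or>
     (\<exists>F \<theta>. e = Sequence F \<and> sequence_error F \<and>
        (\<forall>i j. i \<noteq> j \<longrightarrow> \<not> [\<theta> i = \<theta> j] (rmod 2 * pi)) \<and>
        (\<forall>j. has_disc_abel_coeff F (\<theta> j) (a $ j)) \<and>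
        disc_tail_amplitude F \<le> Amp \<and> G = disc_orbit \<theta>)"

end

theory Submission
  imports Defs
begin

text \<open>
  Everything rests on one finite-dimensional duality. Let \<open>\<chi>\<^sub>j\<close> be finitely many orthonormal
  functions of modulus one on a probability space. The coefficient vectors of the functions of
  essential norm at most \<open>R\<close> form a convex set, and its support function at \<open>c\<close> is \<open>R \<lambda>(c)\<close>, because
  \<open>Re \<integral> f cnj (\<Sum> c\<^sub>j \<chi>\<^sub>j)\<close> is largest at \<open>f = R sgn (\<Sum> c\<^sub>j \<chi>\<^sub>j)\<close>. If \<open>b + K\<close> misses the closure of this
  set, a hyperplane separates the two, and the dual quantity at its normal vector exceeds \<open>R\<close>. If it
  meets the closure, the least norm over \<open>b + K\<close> is at most \<open>R\<close>, because a small defect in the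
  coefficients is repaired by adding a trigonometric polynomial with small coefficients. This is
  \<open>INF_interp_norm_le\<close>: it yields the minimax formula, and the dual formula for \<open>q\<close> as the case \<open>K = {0}\<close>.

  By duality the lower bound for an error \<open>e\<close> of tail magnitude at most \<open>A\<close> says that
  \<open>|\<langle>a, c\<rangle>| \<le> A \<lambda>(c)\<close> for every \<open>c\<close>. An Abel mean is an expectation under an exponential or a geometric
  law. So \<open>\<langle>a, c\<rangle>\<close> is a limit of expectations of \<open>e cnj (\<Sum> c\<^sub>j x\<^sub>j)\<close>, where \<open>x\<close> runs along the orbit, and
  these are at most \<open>A\<close> times the expectation of \<open>|\<Sum> c\<^sub>j x\<^sub>j|\<close>, up to the contribution of a bounded
  initial segment, to which the laws give less and less weight (\<open>norm_cdot_le_of_means\<close>). It remains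
  to see that the orbit is equidistributed for the Abel means, that is, that the last expectation
  tends to \<open>\<lambda>(c)\<close>. The laws are asymptotically invariant under the flow, hence translating the orbit by
  an element of its closure does not change the limit; averaging these translations over Haar measure
  and exchanging the two integrals produces \<open>\<lambda>(c)\<close> (\<open>tendsto_average_of_approx_invariant\<close>).

  For countable families, functions that interpolate ever more coefficients with norms tending to the supremum lie in
  nested convex subsets of \<open>L\<^sup>2\<close>; choosing them with nearly minimal \<open>L\<^sup>2\<close> norm makes them a Cauchy
  sequence by the parallelogram law, and the limit is an interpolant that attains the norm
  (\<open>nested_bounded_interpolants\<close>).

  In the comparison with the Euclidean norm, \<open>\<parallel>a\<parallel> \<le> q(a)\<close> holds since \<open>\<lambda>(c) \<le> \<parallel>c\<parallel>\<close>. On a full torus the products of two coordinates are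
  orthogonal as far as possible, so \<open>\<Sum> c\<^sub>j \<chi>\<^sub>j\<close> has fourth moment at most \<open>2 \<parallel>c\<parallel>\<^sup>4\<close>, and interpolating the
  second moment between the first and the fourth gives \<open>\<parallel>c\<parallel> \<le> \<surd>2 \<lambda>(c)\<close>. The bound for the powers on the
  circle is the duality with \<open>c = (1, \<dots>, 1)\<close> and Lebesgue's estimate \<open>1 + ln m\<close> for the \<open>L\<^sup>1\<close> norm of
  the Dirichlet kernel.
\<close>

section \<open>Essentially bounded interpolants\<close>

lemma borel_measurable_cnj [measurable]: "cnj \<in> borel_measurable borel"
  by (rule borel_measurable_continuous_onI) (rule continuous_intros continuous_on_id)+

lemma linf_norm_le_imp_AE:
  assumes "linf_norm M f \<le> ennreal R" "0 \<le> R"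
  shows "AE x in M. cmod (f x) \<le> R"
  using esssup_AE[of "\<lambda>x. ennreal (cmod (f x))" M]
proof eventually_elim
  case (elim x)
  then have "ennreal (cmod (f x)) \<le> ennreal R"
    using assms(1) unfolding linf_norm_def by (rule order_trans)
  then show ?case using assms(2) by (simp add: ennreal_le_iff)
qed

lemma linf_norm_leI:
  assumes "f \<in> borel_measurable M" "AE x in M. cmod (f x) \<le> R"
  shows "linf_norm M f \<le> ennreal R"
  unfolding linf_norm_def
proof (rule esssup_I)
  show "(\<lambda>x. ennreal (cmod (f x))) \<in> borel_measurable M"
    using assms(1) by measurable
  show "AE x in M. ennreal (cmod (f x)) \<le> ennreal R"
    using assms(2) by eventually_elim (rule ennreal_leI)
qed

lemma interp_norm_leI:
  assumes "f \<in> borel_measurable M" "AE x in M. cmod (f x) \<le> R"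
    and "\<And>j. j \<in> J \<Longrightarrow> (LINT x|M. f x * cnj (chi j x)) = a j"
  shows "f \<in> interpolants M J chi a" "interp_norm M J chi a \<le> ennreal R"
proof -
  have le: "linf_norm M f \<le> ennreal R" by (rule linf_norm_leI[OF assms(1,2)])
  also have "\<dots> < \<infinity>" by simp
  finally show mem: "f \<in> interpolants M J chi a" using assms by (simp add: interpolants_def)
  show "interp_norm M J chi a \<le> ennreal R"
    using INF_lower[OF mem, of "linf_norm M"] le unfolding interp_norm_def by (rule order_trans)
qed

lemma interpolantsE:
  assumes "f \<in> interpolants M J chi a"
  obtains R where "0 \<le> R" "linf_norm M f = ennreal R" "f \<in> borel_measurable M"
    "AE x in M. cmod (f x) \<le> R" "\<And>j. j \<in> J \<Longrightarrow> (LINT x|M. f x * cnj (chi j x)) = a j"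
proof -
  have "linf_norm M f < \<infinity>" using assms by (simp add: interpolants_def)
  then obtain R where R: "0 \<le> R" "linf_norm M f = ennreal R"
    by (cases "linf_norm M f") auto
  with assms show thesis
    by (intro that[of R] linf_norm_le_imp_AE) (auto simp: interpolants_def)
qed

lemma (in prob_space) integrable_of_AE_bounded:
  fixes f :: "'a \<Rightarrow> 'b::{banach, second_countable_topology}"
  assumes "f \<in> borel_measurable M" "AE x in M. norm (f x) \<le> B"
  shows "integrable M f"
  by (rule integrable_const_bound[of _ B]) (use assms in auto)

lemma (in prob_space) norm_integral_mult_cnj_le:
  fixes f g :: "'a \<Rightarrow> complex"
  assumes [measurable]: "f \<in> borel_measurable M" and bd: "AE x in M. cmod (f x) \<le> R"
    and g: "integrable M g"
  shows "cmod (LINT x|M. f x * cnj (g x)) \<le> R * (LINT x|M. cmod (g x))"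
proof -
  have [measurable]: "g \<in> borel_measurable M" using g by auto
  have le: "AE x in M. norm (f x * cnj (g x)) \<le> R * cmod (g x)"
    using bd by eventually_elim (simp add: norm_mult mult_right_mono)
  have int: "integrable M (\<lambda>x. R * cmod (g x))" using g by auto
  have "integrable M (\<lambda>x. f x * cnj (g x))"
    by (rule Bochner_Integration.integrable_bound[OF int]) (use le in auto)
  then have "(LINT x|M. cmod (f x * cnj (g x))) \<le> (LINT x|M. R * cmod (g x))"
    using le int by (intro integral_mono_AE) auto
  with integral_norm_bound have "cmod (LINT x|M. f x * cnj (g x)) \<le> (LINT x|M. R * cmod (g x))"
    by (rule order_trans)
  then show ?thesis by simp
qed

section \<open>Weak duality for families of modulus one\<close>

locale unimodular_family = prob_space M for M :: "'g measure" +
  fixes J :: "'i set" and chi :: "'i \<Rightarrow> 'g \<Rightarrow> complex"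
  assumes chi_measurable: "j \<in> J \<Longrightarrow> chi j \<in> borel_measurable M"
    and chi_norm: "j \<in> J \<Longrightarrow> x \<in> space M \<Longrightarrow> cmod (chi j x) = 1"
begin

lemma poly_measurable:
  "I \<subseteq> J \<Longrightarrow> (\<lambda>x. \<Sum>j\<in>I. c j * chi j x) \<in> borel_measurable M"
  by (intro borel_measurable_sum borel_measurable_times borel_measurable_const chi_measurable) auto

lemma poly_bound:
  assumes "I \<subseteq> J" "x \<in> space M"
  shows "cmod (\<Sum>j\<in>I. c j * chi j x) \<le> (\<Sum>j\<in>I. cmod (c j))"
  by (rule sum_norm_le) (use assms chi_norm in \<open>auto simp: norm_mult\<close>)

lemma integrable_poly: "I \<subseteq> J \<Longrightarrow> integrable M (\<lambda>x. \<Sum>j\<in>I. c j * chi j x)"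
  by (rule integrable_of_AE_bounded[OF poly_measurable, of _ _ "\<Sum>j\<in>I. cmod (c j)"])
     (auto intro: poly_bound AE_I2)

lemma integrable_mult_cnj_chi:
  assumes "f \<in> borel_measurable M" "AE x in M. cmod (f x) \<le> R" "j \<in> J"
  shows "integrable M (\<lambda>x. f x * cnj (chi j x))"
proof (rule integrable_of_AE_bounded)
  show "(\<lambda>x. f x * cnj (chi j x)) \<in> borel_measurable M"
    using assms(1) chi_measurable[OF assms(3)] by measurable
  show "AE x in M. norm (f x * cnj (chi j x)) \<le> R"
    using assms(2) AE_space by eventually_elim (simp add: norm_mult chi_norm assms(3))
qed

lemma integral_mult_cnj_poly:
  assumes "f \<in> borel_measurable M" "AE x in M. cmod (f x) \<le> R" "I \<subseteq> J"
  shows "(LINT x|M. f x * cnj (\<Sum>j\<in>I. c j * chi j x)) =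
           (\<Sum>j\<in>I. (LINT x|M. f x * cnj (chi j x)) * cnj (c j))"
proof -
  have "(LINT x|M. f x * cnj (\<Sum>j\<in>I. c j * chi j x)) =
      (LINT x|M. (\<Sum>j\<in>I. f x * cnj (chi j x) * cnj (c j)))"
    by (simp add: sum_distrib_left mult_ac)
  also have "\<dots> = (\<Sum>j\<in>I. (LINT x|M. f x * cnj (chi j x) * cnj (c j)))"
    by (intro Bochner_Integration.integral_sum integrable_mult_left integrable_mult_cnj_chi[OF assms(1,2)])
       (use assms(3) in auto)
  finally show ?thesis by simp
qed

text \<open>
  Testing an interpolant \<open>f\<close> against \<open>p = \<Sum> c\<^sub>j \<chi>\<^sub>j\<close> gives \<open>|\<langle>a, c\<rangle>| = |\<integral> f cnj p| \<le> \<parallel>f\<parallel>\<^sub>\<infinity> \<parallel>p\<parallel>\<^sub>1\<close>. Any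
  upper bound \<open>l\<close> for \<open>\<parallel>p\<parallel>\<^sub>1\<close> may be used, so that estimates of that norm can be fed in directly.
\<close>

lemma interp_norm_ge:
  assumes l: "0 < l" "(LINT x|M. cmod (\<Sum>j\<in>J. c j * chi j x)) \<le> l"
  shows "ennreal (cmod (\<Sum>j\<in>J. a j * cnj (c j)) / l) \<le> interp_norm M J chi a"
  unfolding interp_norm_def
proof (rule INF_greatest)
  fix f assume "f \<in> interpolants M J chi a"
  then obtain R where R: "0 \<le> R" "linf_norm M f = ennreal R" "f \<in> borel_measurable M"
    "AE x in M. cmod (f x) \<le> R" and co: "\<And>j. j \<in> J \<Longrightarrow> (LINT x|M. f x * cnj (chi j x)) = a j"
    by (rule interpolantsE) blast
  have "cmod (\<Sum>j\<in>J. a j * cnj (c j)) = cmod (LINT x|M. f x * cnj (\<Sum>j\<in>J. c j * chi j x))"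
    using integral_mult_cnj_poly[OF R(3,4) order_refl, of c] co by simp
  also have "\<dots> \<le> R * (LINT x|M. cmod (\<Sum>j\<in>J. c j * chi j x))"
    by (intro norm_integral_mult_cnj_le R integrable_poly order_refl)
  also have "\<dots> \<le> R * l" using l R by (intro mult_left_mono)
  finally show "ennreal (cmod (\<Sum>j\<in>J. a j * cnj (c j)) / l) \<le> linf_norm M f"
    unfolding R(2) using l by (intro ennreal_leI) (simp add: field_simps)
qed

section \<open>Countable families\<close>

definition bounded_interpolants :: "('i \<Rightarrow> complex) \<Rightarrow> 'i set \<Rightarrow> real \<Rightarrow> ('g \<Rightarrow> complex) set" where
  "bounded_interpolants a I R = {f \<in> borel_measurable M. (AE x in M. cmod (f x) \<le> R) \<and>
      (\<forall>j\<in>I. (LINT x|M. f x * cnj (chi j x)) = a j)}"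

lemma bounded_interpolants_midpoint:
  assumes "I \<subseteq> J" "f \<in> bounded_interpolants a I R" "g \<in> bounded_interpolants a I R"
  shows "(\<lambda>x. (f x + g x) / 2) \<in> bounded_interpolants a I R"
proof -
  from assms have [measurable]: "f \<in> borel_measurable M" "g \<in> borel_measurable M"
    and bf: "AE x in M. cmod (f x) \<le> R" and bg: "AE x in M. cmod (g x) \<le> R"
    and co: "\<And>j. j \<in> I \<Longrightarrow> (LINT x|M. f x * cnj (chi j x)) = a j"
       "\<And>j. j \<in> I \<Longrightarrow> (LINT x|M. g x * cnj (chi j x)) = a j"
    by (auto simp: bounded_interpolants_def)
  have "AE x in M. cmod ((f x + g x) / 2) \<le> R"
    using bf bg
  proof eventually_elim
    case (elim x)
    then show ?case using norm_triangle_ineq[of "f x" "g x"] by (simp add: norm_divide)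
  qed
  moreover have "(LINT x|M. (f x + g x) / 2 * cnj (chi j x)) = a j" if "j \<in> I" for j
  proof -
    have "(LINT x|M. (f x + g x) / 2 * cnj (chi j x)) =
       (LINT x|M. (f x * cnj (chi j x) + g x * cnj (chi j x)) / 2)"
      by (simp add: field_simps)
    also have "\<dots> = ((LINT x|M. f x * cnj (chi j x)) + (LINT x|M. g x * cnj (chi j x))) / 2"
      using integrable_mult_cnj_chi[OF _ bf, of j] integrable_mult_cnj_chi[OF _ bg, of j] that assms(1)
      by (simp add: subset_eq)
    finally show ?thesis using co that by simp
  qed
  ultimately show ?thesis by (auto simp: bounded_interpolants_def)
qed

lemma bounded_interpolants_mono:
  assumes "I \<subseteq> I'" "R' \<le> R"
  shows "bounded_interpolants a I' R' \<subseteq> bounded_interpolants a I R"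
proof
  fix f assume "f \<in> bounded_interpolants a I' R'"
  then have f: "f \<in> borel_measurable M" "AE x in M. cmod (f x) \<le> R'"
      "\<forall>j\<in>I'. (LINT x|M. f x * cnj (chi j x)) = a j" by (auto simp: bounded_interpolants_def)
  from f(2) have "AE x in M. cmod (f x) \<le> R" by eventually_elim (use assms in simp)
  with f assms(1) show "f \<in> bounded_interpolants a I R" by (auto simp: bounded_interpolants_def)
qed

text \<open>
  This is weak compactness of balls, reduced to completeness. The sets \<open>D n\<close> are nested, convex and bounded, so their
  infima \<open>d n\<close> of the squared \<open>L\<^sup>2\<close> norm increase to a finite limit. For nearly minimal elements \<open>s i\<close> and
  \<open>s j\<close> of \<open>D N\<close> the midpoint stays in \<open>D N\<close>, and the parallelogram law bounds \<open>\<parallel>s i - s j\<parallel>\<^sub>2\<close> by what is left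
  between \<open>d N\<close> and the limit. A subsequence of \<open>s\<close> then converges almost everywhere, and both the bound
  and, by dominated convergence, the coefficients pass to the limit.
\<close>

lemma nested_bounded_interpolants:
  assumes J: "J = (\<Union>n. I n)" and I: "mono I" and R: "decseq R" "R \<longlonglongrightarrow> L"
    and ne: "\<And>n. bounded_interpolants a (I n) (R n) \<noteq> {}"
  shows "bounded_interpolants a J L \<noteq> {}"
proof -
  define D where "D n = bounded_interpolants a (I n) (R n)" for n
  have sub: "I n \<subseteq> J" for n using J by auto
  have anti: "D n \<subseteq> D m" if "m \<le> n" for m n
    unfolding D_def using I R(1) that by (intro bounded_interpolants_mono) (auto dest: monoD decseqD)
  define E where "E f = (LINT x|M. (cmod (f x))\<^sup>2)" for f :: "'g \<Rightarrow> complex"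
  have meas: "f \<in> borel_measurable M" and bd: "AE x in M. cmod (f x) \<le> R n" if "f \<in> D n" for f n
    using that by (auto simp: D_def bounded_interpolants_def)
  have bd0: "AE x in M. cmod (f x) \<le> R 0" if "f \<in> D n" for f n
    using bd anti[of 0 n] that by auto
  have int2: "integrable M (\<lambda>x. (cmod (f x))\<^sup>2)" if "f \<in> D n" for f n
  proof (rule integrable_of_AE_bounded)
    show "(\<lambda>x. (cmod (f x))\<^sup>2) \<in> borel_measurable M" using meas[OF that] by measurable
    show "AE x in M. norm ((cmod (f x))\<^sup>2) \<le> (R 0)\<^sup>2"
      using bd0[OF that] by eventually_elim (simp add: power_mono)
  qed
  have E_nonneg: "0 \<le> E f" for f by (simp add: E_def)
  have E_le: "E f \<le> (R 0)\<^sup>2" if "f \<in> D n" for f n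
  proof -
    have "AE x in M. (cmod (f x))\<^sup>2 \<le> (R 0)\<^sup>2"
      using bd0[OF that] by eventually_elim (simp add: power_mono)
    then have "E f \<le> (LINT x|M. (R 0)\<^sup>2)"
      unfolding E_def by (intro integral_mono_AE int2[OF that]) auto
    then show ?thesis by (simp add: prob_space)
  qed
  define d where "d n = (INF f\<in>D n. E f)" for n
  have bdd: "bdd_below (E ` D n)" for n by (rule bdd_belowI2[of _ 0]) (rule E_nonneg)
  have d_le: "d n \<le> E f" if "f \<in> D n" for n f
    unfolding d_def by (rule cINF_lower[OF bdd that])
  have neD: "D n \<noteq> {}" for n using ne by (simp add: D_def)
  have "incseq d"
    unfolding d_def by (intro incseq_SucI cINF_superset_mono neD bdd anti) auto
  have "d n \<le> (R 0)\<^sup>2" for n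
    using neD[of n] d_le[of _ n] E_le[of _ n] by (metis all_not_in_conv order_trans)
  then obtain d' where d': "d \<longlonglongrightarrow> d'" "\<And>n. d n \<le> d'"
    using incseq_convergent[OF \<open>incseq d\<close>] by blast
  have "\<exists>f\<in>D n. E f < d n + 1 / Suc n" for n
    using cINF_less_iff[OF neD bdd, of n "d n + 1 / Suc n"] by (simp add: d_def)
  then obtain s where s: "\<And>n. s n \<in> D n" "\<And>n. E (s n) < d n + 1 / Suc n" by metis
  have [measurable]: "s n \<in> borel_measurable M" for n using meas[OF s(1)] .
  have int_s: "integrable M (s n)" for n
    by (rule integrable_of_AE_bounded[OF _ bd0[OF s(1)]]) auto
  have close: "E (\<lambda>x. s i x - s j x) \<le> 4 * (d' - d N + 1 / Suc N)" if "i \<ge> N" "j \<ge> N" for i j N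
  proof -
    have si: "s i \<in> D N" and sj: "s j \<in> D N" using s(1) anti that by blast+
    have mid: "(\<lambda>x. (s i x + s j x) / 2) \<in> D N"
      using si sj sub unfolding D_def by (intro bounded_interpolants_midpoint)
    have par: "(cmod (s i x - s j x))\<^sup>2 =
        2 * (cmod (s i x))\<^sup>2 + 2 * (cmod (s j x))\<^sup>2 - 4 * (cmod ((s i x + s j x) / 2))\<^sup>2" for x
      unfolding cmod_power2 by (simp add: power2_eq_square field_simps)
    have "E (\<lambda>x. s i x - s j x) = 2 * E (s i) + 2 * E (s j) - 4 * E (\<lambda>x. (s i x + s j x) / 2)"
      unfolding E_def par using int2[OF si] int2[OF sj] int2[OF mid] by simp
    also have "\<dots> \<le> 2 * (d' + 1 / Suc N) + 2 * (d' + 1 / Suc N) - 4 * d N"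
    proof -
      have "E (s k) \<le> d' + 1 / Suc N" if "k \<ge> N" for k
      proof -
        have "1 / real (Suc k) \<le> 1 / Suc N" using that by (simp add: frac_le)
        then show ?thesis using s(2)[of k] d'(2)[of k] by linarith
      qed
      then show ?thesis using d_le[OF mid] that by (smt (verit))
    qed
    finally show ?thesis by simp
  qed
  \<comment> \<open>The \<open>L\<^sup>1\<close> norm is controlled by the squared \<open>L\<^sup>2\<close> norm through \<open>u \<le> t + u\<^sup>2 / t\<close>.\<close>
  have L1: "(LINT x|M. norm (s i x - s j x)) \<le> t + E (\<lambda>x. s i x - s j x) / t" if "t > 0" for i j t
  proof -
    have i2: "integrable M (\<lambda>x. (cmod (s i x - s j x))\<^sup>2)"
    proof (rule integrable_of_AE_bounded)
      show "AE x in M. norm ((cmod (s i x - s j x))\<^sup>2) \<le> (2 * R 0)\<^sup>2"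
        using bd0[OF s(1)[of i]] bd0[OF s(1)[of j]]
      proof eventually_elim
        case (elim x)
        then have "cmod (s i x - s j x) \<le> 2 * R 0" using norm_triangle_ineq4[of "s i x" "s j x"] by simp
        then show ?case using power_mono[of "cmod (s i x - s j x)" "2 * R 0" 2] by simp
      qed
    qed measurable
    have "(LINT x|M. norm (s i x - s j x)) \<le> (LINT x|M. t + (cmod (s i x - s j x))\<^sup>2 / t)"
    proof (rule integral_mono)
      show "integrable M (\<lambda>x. norm (s i x - s j x))" using int_s by auto
      show "integrable M (\<lambda>x. t + (cmod (s i x - s j x))\<^sup>2 / t)" using i2 by auto
      fix x
      let ?u = "norm (s i x - s j x)"
      have "0 \<le> ?u * t" using that by simp
      then have "?u * t \<le> t\<^sup>2 + ?u\<^sup>2"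
        using sum_squares_bound[of ?u t] by (simp only: mult.assoc)
      then show "?u \<le> t + ?u\<^sup>2 / t"
        using that by (simp add: field_simps power2_eq_square)
    qed
    also have "\<dots> = t + E (\<lambda>x. s i x - s j x) / t"
      unfolding E_def using i2 by (simp add: prob_space)
    finally show ?thesis .
  qed
  obtain r where r: "strict_mono r" "AE x in M. Cauchy (\<lambda>i. s (r i) x)"
  proof (rule cauchy_L1_AE_cauchy_subseq[OF int_s])
    fix e :: real assume e: "0 < e"
    have "(\<lambda>N. 4 * (d' - d N + 1 / Suc N)) \<longlonglongrightarrow> 4 * (d' - d' + 0)"
      by (intro tendsto_intros d' LIMSEQ_Suc[OF lim_1_over_n])
    then have "(\<lambda>N. 4 * (d' - d N + 1 / Suc N)) \<longlonglongrightarrow> 0" by simp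
    then have "\<forall>\<^sub>F N in sequentially. 4 * (d' - d N + 1 / Suc N) < e\<^sup>2 / 9"
      by (rule order_tendstoD(2)) (use e in simp)
    then obtain N where N: "4 * (d' - d N + 1 / Suc N) < e\<^sup>2 / 9"
      by (auto simp: eventually_sequentially)
    have "(LINT x|M. norm (s i x - s j x)) < e" if "i \<ge> N" "j \<ge> N" for i j
    proof -
      have "E (\<lambda>x. s i x - s j x) < e\<^sup>2 / 9" using close[OF that] N by linarith
      then have "E (\<lambda>x. s i x - s j x) / (e / 3) < e / 3"
        using e by (simp add: field_simps power2_eq_square)
      then show ?thesis using L1[of "e / 3" i j] e by linarith
    qed
    then show "\<exists>N. \<forall>i\<ge>N. \<forall>j\<ge>N. (LINT x|M. norm (s i x - s j x)) < e" by blast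
  qed auto
  define f where "f x = lim (\<lambda>i. s (r i) x)" for x
  have [measurable]: "f \<in> borel_measurable M" unfolding f_def by measurable
  have lim: "AE x in M. (\<lambda>i. s (r i) x) \<longlonglongrightarrow> f x"
    using r(2) by eventually_elim (simp add: f_def Cauchy_convergent_iff convergent_LIMSEQ_iff)
  have all: "AE x in M. \<forall>n. cmod (s n x) \<le> R n"
    unfolding AE_all_countable using bd[OF s(1)] by blast
  have "AE x in M. cmod (f x) \<le> L"
    using lim all
  proof eventually_elim
    case (elim x)
    have "(\<lambda>i. cmod (s (r i) x)) \<longlonglongrightarrow> cmod (f x)" using elim(1) by (rule tendsto_norm)
    moreover have "(\<lambda>i. R (r i)) \<longlonglongrightarrow> L" using LIMSEQ_subseq_LIMSEQ[OF R(2) r(1)] by (simp add: o_def)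
    ultimately show ?case by (rule LIMSEQ_le) (use elim(2) in auto)
  qed
  moreover have "(LINT x|M. f x * cnj (chi j x)) = a j" if "j \<in> J" for j
  proof -
    have [measurable]: "chi j \<in> borel_measurable M" using chi_measurable[OF that] .
    have "(\<lambda>i. LINT x|M. s (r i) x * cnj (chi j x)) \<longlonglongrightarrow> (LINT x|M. f x * cnj (chi j x))"
    proof (rule integral_dominated_convergence[where w = "\<lambda>_. R 0"])
      show "AE x in M. (\<lambda>i. s (r i) x * cnj (chi j x)) \<longlonglongrightarrow> f x * cnj (chi j x)"
        using lim by eventually_elim (intro tendsto_intros)
      show "AE x in M. norm (s (r i) x * cnj (chi j x)) \<le> R 0" for i
        using bd0[OF s(1)[of "r i"]] AE_space
        by eventually_elim (simp add: norm_mult chi_norm that)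
    qed auto
    moreover have "\<forall>\<^sub>F i in sequentially. (LINT x|M. s (r i) x * cnj (chi j x)) = a j"
    proof -
      obtain n where n: "j \<in> I n" using \<open>j \<in> J\<close> J by blast
      have "(LINT x|M. s (r i) x * cnj (chi j x)) = a j" if "i \<ge> n" for i
      proof -
        have "r i \<ge> n" using seq_suble[OF r(1), of i] that by simp
        then have "s (r i) \<in> D n" using s(1)[of "r i"] anti by blast
        then show ?thesis using n by (auto simp: D_def bounded_interpolants_def)
      qed
      then show ?thesis by (auto simp: eventually_sequentially)
    qed
    ultimately show ?thesis by (intro LIMSEQ_unique[OF _ tendsto_eventually])
  qed
  ultimately have "f \<in> bounded_interpolants a J L" by (simp add: bounded_interpolants_def)
  then show ?thesis by blast
qed

end

context unimodular_family begin

text \<open>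
  If the truncated norms have a finite supremum \<open>L\<close>, then the truncation to \<open>I (n + 1)\<close> has
  interpolants of norm at most \<open>L + 1 / (n + 1)\<close>. The sets of these interpolants are nested, and they
  provide an interpolant for \<open>J\<close> of norm at most \<open>L\<close>.
\<close>

lemma interp_norm_eq_SUP_attained:
  fixes I :: "nat \<Rightarrow> 'i set"
  assumes J: "J = (\<Union>n\<in>{1..}. I n)" and I: "mono I"
  shows "interp_norm M J chi a = (SUP n\<in>{1..}. interp_norm M (I n) chi a)"
    and "interpolants M J chi a \<noteq> {} \<Longrightarrow>
      \<exists>f\<in>interpolants M J chi a. linf_norm M f = interp_norm M J chi a"
proof -
  define N :: "nat set" where N: "N = {1..}"
  note J = J[folded N]
  let ?S = "SUP n\<in>N. interp_norm M (I n) chi a"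
  have le: "?S \<le> interp_norm M J chi a"
  proof (rule SUP_least)
    fix n assume "n \<in> N"
    then have "interpolants M J chi a \<subseteq> interpolants M (I n) chi a"
      using J by (auto simp: interpolants_def)
    then show "interp_norm M (I n) chi a \<le> interp_norm M J chi a"
      unfolding interp_norm_def by (rule INF_superset_mono) auto
  qed
  have attained: "\<exists>f\<in>interpolants M J chi a. linf_norm M f \<le> ?S" if fin: "?S < \<infinity>"
  proof -
    obtain L where L: "0 \<le> L" "?S = ennreal L" using fin by (cases ?S) auto
    define R where "R n = L + 1 / real (Suc n)" for n
    have "bounded_interpolants a J L \<noteq> {}"
    proof (rule nested_bounded_interpolants[where I = "\<lambda>n. I (Suc n)" and R = R])
      show "J = (\<Union>n. I (Suc n))"
      proof -
        have "{1..} = range Suc" by (simp add: atLeast_Suc_greaterThan greaterThan_0)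
        then show ?thesis unfolding J N by simp
      qed
      show "mono (\<lambda>n. I (Suc n))" using I by (auto simp: mono_def)
      show "decseq R" unfolding R_def decseq_def by (auto simp: frac_le)
      show "R \<longlonglongrightarrow> L" unfolding R_def
        using tendsto_add[OF tendsto_const[of L] LIMSEQ_Suc[OF lim_1_over_n, where 'a1 = real]] by simp
      fix n
      have "interp_norm M (I (Suc n)) chi a \<le> ennreal L"
        unfolding L(2)[symmetric] by (rule SUP_upper) (simp add: N)
      also have "\<dots> < ennreal (R n)" using L(1) by (auto simp: R_def ennreal_less_iff)
      finally obtain f where f: "f \<in> interpolants M (I (Suc n)) chi a" "linf_norm M f < ennreal (R n)"
        unfolding interp_norm_def by (auto simp: INF_less_iff)
      have "AE x in M. cmod (f x) \<le> R n"
        by (rule linf_norm_le_imp_AE) (use f(2) L(1) in \<open>auto simp: R_def\<close>)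
      then show "bounded_interpolants a (I (Suc n)) (R n) \<noteq> {}"
        using f(1) by (auto simp: bounded_interpolants_def interpolants_def)
    qed
    then obtain f where f: "f \<in> borel_measurable M" "AE x in M. cmod (f x) \<le> L"
      "\<And>j. j \<in> J \<Longrightarrow> (LINT x|M. f x * cnj (chi j x)) = a j"
      by (auto simp: bounded_interpolants_def)
    then show ?thesis
      using interp_norm_leI(1)[where J = J and chi = chi and a = a, OF f] linf_norm_leI[OF f(1,2)] L by auto
  qed
  have eq: "interp_norm M J chi a = ?S"
  proof (cases "?S = \<infinity>")
    case True
    show ?thesis
      using le unfolding True infinity_ennreal_def by (rule antisym[OF top_greatest])
  next
    case False
    then have "?S < \<infinity>" unfolding infinity_ennreal_def by (rule less_top[THEN iffD1])
    then obtain f where "f \<in> interpolants M J chi a" "linf_norm M f \<le> ?S"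
      using attained by blast
    then have "interp_norm M J chi a \<le> ?S"
      unfolding interp_norm_def by (blast intro: INF_lower2)
    with le show ?thesis by simp
  qed
  then show "interp_norm M J chi a = (SUP n\<in>{1..}. interp_norm M (I n) chi a)" unfolding N .
  assume "interpolants M J chi a \<noteq> {}"
  then obtain g where g: "g \<in> interpolants M J chi a" by blast
  then have "interp_norm M J chi a \<le> linf_norm M g" unfolding interp_norm_def by (rule INF_lower)
  also have "\<dots> < \<infinity>" using g by (simp add: interpolants_def)
  finally obtain f where f: "f \<in> interpolants M J chi a" "linf_norm M f \<le> ?S"
    using attained eq by auto
  moreover have "interp_norm M J chi a \<le> linf_norm M f"
    unfolding interp_norm_def using f(1) by (rule INF_lower)
  ultimately show "\<exists>f\<in>interpolants M J chi a. linf_norm M f = interp_norm M J chi a"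
    using eq by (intro bexI[of _ f]) auto
qed

end

section \<open>Duality and minimax for orthonormal families\<close>

lemma Re_cdot: "Re (cdot a c) = inner a c"
  by (simp add: cdot_def inner_vec_def inner_complex_def)

lemma cdot_self: "cdot a a = of_real ((norm a)\<^sup>2)"
proof -
  have "cdot a a = of_real (\<Sum>j\<in>UNIV. (cmod (a $ j))\<^sup>2)"
    by (simp add: cdot_def complex_norm_square[symmetric])
  then show ?thesis by (simp add: norm_vec_def L2_set_def sum_nonneg)
qed

lemma sum_norm_le_card_norm:
  fixes c :: "complex ^ 'n"
  shows "(\<Sum>j\<in>UNIV. cmod (c $ j)) \<le> real CARD('n) * norm c"
  using sum_bounded_above[of UNIV "\<lambda>j. cmod (c $ j)" "norm c"] by (simp add: Finite_Cartesian_Product.norm_nth_le)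

lemma cmod_cdot_le: "cmod (cdot a c) \<le> norm a * norm c"
proof -
  have "cmod (cdot a c) \<le> (\<Sum>j\<in>UNIV. cmod (a $ j) * cmod (c $ j))"
    unfolding cdot_def by (rule sum_norm_le) (simp add: norm_mult)
  also have "\<dots> \<le> L2_set (\<lambda>j. cmod (a $ j)) UNIV * L2_set (\<lambda>j. cmod (c $ j)) UNIV"
    using L2_set_mult_ineq[where A = UNIV and f = "\<lambda>j. cmod (a $ j)" and g = "\<lambda>j. cmod (c $ j)"] by simp
  finally show ?thesis by (simp add: norm_vec_def)
qed

locale orthonormal_family = unimodular_family M UNIV chi
  for M :: "'g measure" and chi :: "'n::finite \<Rightarrow> 'g \<Rightarrow> complex" +
  assumes orthonormal: "(LINT x|M. chi i x * cnj (chi j x)) = (if i = j then 1 else 0)"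
begin

definition trig :: "complex ^ 'n \<Rightarrow> 'g \<Rightarrow> complex" where
  "trig c x = (\<Sum>j\<in>UNIV. c $ j * chi j x)"

lemma l1_dual_trig: "l1_dual M chi c = (LINT x|M. cmod (trig c x))"
  by (simp add: l1_dual_def trig_def)

lemma trig_measurable [measurable]: "trig c \<in> borel_measurable M"
  unfolding trig_def[abs_def] by (rule poly_measurable) simp

lemma trig_bound: "x \<in> space M \<Longrightarrow> cmod (trig c x) \<le> (\<Sum>j\<in>UNIV. cmod (c $ j))"
  unfolding trig_def by (rule poly_bound) simp_all

lemma trig_AE_bound: "AE x in M. cmod (trig c x) \<le> (\<Sum>j\<in>UNIV. cmod (c $ j))"
  by (rule AE_I2) (rule trig_bound)

lemma integrable_trig: "integrable M (trig c)"
  unfolding trig_def[abs_def] by (rule integrable_poly) simp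

definition coeffs :: "('g \<Rightarrow> complex) \<Rightarrow> complex ^ 'n" where
  "coeffs f = (\<chi> j. LINT x|M. f x * cnj (chi j x))"

lemma cdot_coeffs:
  assumes "f \<in> borel_measurable M" "AE x in M. cmod (f x) \<le> R"
  shows "cdot (coeffs f) c = (LINT x|M. f x * cnj (trig c x))"
  using integral_mult_cnj_poly[OF assms subset_UNIV, of "($) c"]
  by (simp add: cdot_def coeffs_def trig_def)

lemma coeffs_trig: "coeffs (trig c) = c"
proof (rule vec_eq_iff[THEN iffD2], rule allI)
  fix j
  have "coeffs (trig c) $ j = (LINT x|M. (\<Sum>i\<in>UNIV. c $ i * (chi i x * cnj (chi j x))))"
    by (simp add: coeffs_def trig_def sum_distrib_right mult.assoc)
  also have "\<dots> = (\<Sum>i\<in>UNIV. LINT x|M. c $ i * (chi i x * cnj (chi j x)))"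
    by (intro Bochner_Integration.integral_sum integrable_mult_right integrable_mult_cnj_chi[where R = 1])
       (auto simp: chi_norm chi_measurable)
  also have "\<dots> = (\<Sum>i\<in>UNIV. if i = j then c $ i else 0)"
    by (intro sum.cong) (auto simp: orthonormal)
  finally show "coeffs (trig c) $ j = c $ j" by simp
qed

lemma coeffs_add:
  assumes "f \<in> borel_measurable M" "AE x in M. cmod (f x) \<le> R"
    and "g \<in> borel_measurable M" "AE x in M. cmod (g x) \<le> S"
  shows "coeffs (\<lambda>x. f x + g x) = coeffs f + coeffs g"
  unfolding vec_eq_iff coeffs_def
  using integrable_mult_cnj_chi[OF assms(1,2)] integrable_mult_cnj_chi[OF assms(3,4)]
  by (simp add: distrib_right)

lemma coeffs_scale: "coeffs (\<lambda>x. of_real r * f x) = r *\<^sub>R coeffs f"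
  unfolding vec_eq_iff coeffs_def by (simp add: mult.assoc scaleR_conv_of_real[of r "_ :: complex"])

lemma l1_dual_nonneg: "0 \<le> l1_dual M chi c"
  by (simp add: l1_dual_def)

lemma l1_dual_scale: "l1_dual M chi (r *\<^sub>R c) = \<bar>r\<bar> * l1_dual M chi c"
proof -
  have "cmod (\<Sum>j\<in>UNIV. (r *\<^sub>R c) $ j * chi j x) = \<bar>r\<bar> * cmod (\<Sum>j\<in>UNIV. c $ j * chi j x)" for x
    by (simp add: sum_distrib_left[symmetric] norm_mult flip: scaleR_conv_of_real scaleR_sum_right)
  then show ?thesis by (simp add: l1_dual_def)
qed

text \<open>
  Orthonormality enters here: \<open>\<parallel>c\<parallel>\<^sup>2 = \<integral> p cnj p\<close> for \<open>p = \<Sum> c\<^sub>j \<chi>\<^sub>j\<close>, and \<open>p\<close> is bounded, so \<open>\<lambda>\<close> is definite.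
\<close>

lemma l1_dual_pos:
  assumes "c \<noteq> 0"
  shows "0 < l1_dual M chi c"
proof -
  have "(norm c)\<^sup>2 = cmod (cdot c c)" by (simp add: cdot_self del: of_real_power)
  also have "\<dots> = cmod (LINT x|M. trig c x * cnj (trig c x))"
    using cdot_coeffs[OF trig_measurable trig_AE_bound, of c c] by (simp add: coeffs_trig)
  also have "\<dots> \<le> (\<Sum>j\<in>UNIV. cmod (c $ j)) * l1_dual M chi c"
    unfolding l1_dual_trig
    by (rule norm_integral_mult_cnj_le[OF trig_measurable trig_AE_bound integrable_trig])
  finally show ?thesis
    using assms l1_dual_nonneg[of c] by (cases "l1_dual M chi c = 0") auto
qed

lemma interp_norm_ge_cdot:
  assumes "0 < l" "l1_dual M chi c \<le> l"
  shows "ennreal (cmod (cdot a c) / l) \<le> interp_norm M UNIV chi (($) a)"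
  using interp_norm_ge[of l "($) c" "($) a"] assms by (simp add: l1_dual_def cdot_def)

definition attainable :: "real \<Rightarrow> (complex ^ 'n) set" where
  "attainable R = coeffs ` {f \<in> borel_measurable M. AE x in M. cmod (f x) \<le> R}"

lemma convex_attainable: "convex (attainable R)"
proof (rule convexI)
  fix u v and s t :: real
  assume uv: "u \<in> attainable R" "v \<in> attainable R" and st: "0 \<le> s" "0 \<le> t" "s + t = 1"
  then obtain f g where [measurable]: "f \<in> borel_measurable M" "g \<in> borel_measurable M"
    and bf: "AE x in M. cmod (f x) \<le> R" and bg: "AE x in M. cmod (g x) \<le> R"
    and u: "u = coeffs f" and v: "v = coeffs g"
    by (auto simp: attainable_def)
  let ?f = "\<lambda>x. of_real s * f x" and ?g = "\<lambda>x. of_real t * g x"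
  have bf': "AE x in M. cmod (?f x) \<le> s * R"
    using bf by eventually_elim (use st in \<open>auto simp: norm_mult intro: mult_left_mono\<close>)
  have bg': "AE x in M. cmod (?g x) \<le> t * R"
    using bg by eventually_elim (use st in \<open>auto simp: norm_mult intro: mult_left_mono\<close>)
  have "AE x in M. cmod (?f x + ?g x) \<le> R"
    using bf' bg'
  proof eventually_elim
    case (elim x)
    have "cmod (?f x + ?g x) \<le> s * R + t * R"
      using norm_triangle_ineq elim by (rule order_trans[OF _ add_mono])
    also have "\<dots> = R" using st by (simp flip: distrib_right)
    finally show ?case .
  qed
  then have "coeffs (\<lambda>x. ?f x + ?g x) \<in> attainable R" unfolding attainable_def by auto
  then show "s *\<^sub>R u + t *\<^sub>R v \<in> attainable R"
    using coeffs_add[OF _ bf' _ bg'] by (simp add: u v coeffs_scale)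
qed

text \<open>
  The coefficient map has a bounded right inverse, namely \<open>c\<close> to \<open>\<Sum> c\<^sub>j \<chi>\<^sub>j\<close>. Therefore a vector that is
  only approximated by coefficients of functions bounded by \<open>R\<close> is attained exactly after an
  arbitrarily small increase of \<open>R\<close>, and no compactness of the attainable set is required.
\<close>

lemma interp_norm_le_of_closure:
  assumes a: "a \<in> closure (attainable R)" and "R < S"
  shows "interp_norm M UNIV chi (($) a) \<le> ennreal S"
proof -
  define d where "d = (S - R) / real CARD('n)"
  have "d > 0" using assms(2) by (simp add: d_def)
  then obtain v where v: "v \<in> attainable R" "dist v a < d"
    using a unfolding closure_approachable by blast
  then obtain f where [measurable]: "f \<in> borel_measurable M"
    and bf: "AE x in M. cmod (f x) \<le> R" and f: "v = coeffs f"
    by (auto simp: attainable_def)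
  let ?g = "\<lambda>x. f x + trig (a - v) x"
  have co: "coeffs ?g = a"
    using coeffs_add[OF _ bf trig_measurable trig_AE_bound, of "a - v"] by (simp add: coeffs_trig f)
  have "real CARD('n) * norm (a - v) \<le> S - R"
    using v(2) by (simp add: d_def dist_norm norm_minus_commute field_simps)
  then have small: "(\<Sum>j\<in>UNIV. cmod ((a - v) $ j)) \<le> S - R"
    using sum_norm_le_card_norm by (rule order_trans[rotated])
  show ?thesis
  proof (rule interp_norm_leI(2)[of ?g])
    show "AE x in M. cmod (?g x) \<le> S"
      using bf trig_AE_bound[of "a - v"]
    proof eventually_elim
      case (elim x)
      then show ?case using norm_triangle_ineq[of "f x" "trig (a - v) x"] small by linarith
    qed
    show "(LINT x|M. ?g x * cnj (chi j x)) = a $ j" for j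
      using arg_cong[OF co, of "\<lambda>w. w $ j"] by (simp add: coeffs_def)
  qed simp
qed

text \<open>
  The support function of the attainable set at \<open>c\<close> is at least \<open>R \<lambda>(c)\<close>, as \<open>f = R sgn (\<Sum> c\<^sub>j \<chi>\<^sub>j)\<close> shows.
\<close>

lemma ex_attainable_inner_eq:
  assumes "0 \<le> R"
  obtains v where "v \<in> attainable R" "inner c v = R * l1_dual M chi c"
proof -
  define f where "f x = of_real R * sgn (trig c x)" for x
  have [measurable]: "f \<in> borel_measurable M" unfolding f_def[abs_def] sgn_div_norm by measurable
  have bf: "AE x in M. cmod (f x) \<le> R" using assms by (auto simp: f_def norm_mult norm_sgn)
  have "f x * cnj (trig c x) = of_real (R * cmod (trig c x))" for x
  proof (cases "trig c x = 0")
    case False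
    then show ?thesis
      by (simp add: f_def sgn_div_norm scaleR_conv_of_real field_simps complex_norm_square[symmetric]
            power2_eq_square flip: of_real_mult)
  qed (simp add: f_def)
  then have "cdot (coeffs f) c = of_real (R * l1_dual M chi c)"
    using cdot_coeffs[OF _ bf, of c] by (simp add: l1_dual_trig)
  then have "inner c (coeffs f) = R * l1_dual M chi c"
    using Re_cdot[of "coeffs f" c] by (simp add: inner_commute)
  moreover have "coeffs f \<in> attainable R" using bf by (auto simp: attainable_def)
  ultimately show thesis using that by blast
qed

text \<open>
  The strong half of the minimax formula. If \<open>b + K\<close> avoided the closed attainable set for a radius
  slightly above \<open>R\<close>, the normal vector of a separating hyperplane, rescaled to \<open>\<lambda>(c) = 1\<close>, would violate
  the dual bound.
\<close>

lemma INF_interp_norm_le: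
  assumes K: "K \<noteq> {}" "compact K" "convex K" and R: "0 \<le> R"
    and dual: "\<And>c. l1_dual M chi c \<le> 1 \<Longrightarrow> Re (cdot b c) - support_fun K (- c) \<le> R"
  shows "(INF u\<in>K. interp_norm M UNIV chi (($) (b + u))) \<le> ennreal R"
proof (rule ennreal_le_epsilon)
  fix e :: real assume e: "e > 0"
  define R' where "R' = R + e / 2"
  let ?S = "closure (attainable R')" and ?T = "(\<lambda>u. b + u) ` K"
  have "?S \<inter> ?T \<noteq> {}"
  proof
    assume disj: "?S \<inter> ?T = {}"
    obtain c \<beta> where c: "\<forall>x\<in>?S. inner c x < \<beta>" "\<forall>x\<in>?T. \<beta> < inner c x"
      using separating_hyperplane_closed_compact[OF convex_closure[OF convex_attainable] closed_closure
          convex_translation[OF K(3)] compact_translation[OF K(2)] _ disj] K(1) by auto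
    obtain v where v: "v \<in> attainable R'" "inner c v = R' * l1_dual M chi c"
      by (rule ex_attainable_inner_eq[of R' c]) (use R e in \<open>auto simp: R'_def\<close>)
    have lt: "R' * l1_dual M chi c < \<beta>"
      using c(1) v closure_subset by (metis subsetD)
    have "0 \<le> R' * l1_dual M chi c"
      using R e l1_dual_nonneg by (intro mult_nonneg_nonneg) (auto simp: R'_def)
    with lt have "\<beta> > 0" by linarith
    have "c \<noteq> 0" using c(2) K(1) \<open>\<beta> > 0\<close> by auto
    then have l: "0 < l1_dual M chi c" by (rule l1_dual_pos)
    define c' where "c' = (1 / l1_dual M chi c) *\<^sub>R c"
    have "l1_dual M chi c' \<le> 1" using l by (simp add: c'_def l1_dual_scale)
    then have le: "Re (cdot b c') - support_fun K (- c') \<le> R" by (rule dual)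
    have "support_fun K (- c') \<le> inner b c' - \<beta> / l1_dual M chi c"
      unfolding support_fun_def
    proof (rule cSUP_least[OF K(1)])
      fix u assume "u \<in> K"
      then have "\<beta> < inner c b + inner c u" using c(2) by (auto simp: inner_add_right)
      then show "Re (cdot u (- c')) \<le> inner b c' - \<beta> / l1_dual M chi c"
        using l unfolding Re_cdot c'_def by (simp add: field_simps inner_commute)
    qed
    then have "\<beta> / l1_dual M chi c \<le> R" using le by (simp add: Re_cdot)
    then have "\<beta> \<le> R * l1_dual M chi c" using l by (simp add: field_simps)
    also have "\<dots> \<le> R' * l1_dual M chi c" using l e by (simp add: R'_def)
    finally show False using lt by simp
  qed
  then obtain u where u: "u \<in> K" "b + u \<in> ?S" by blast
  have "(INF u\<in>K. interp_norm M UNIV chi (($) (b + u))) \<le> ennreal (R + e)"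
    by (rule INF_lower2[OF u(1)], rule interp_norm_le_of_closure[OF u(2)]) (use e in \<open>simp add: R'_def\<close>)
  then show "(INF u\<in>K. interp_norm M UNIV chi (($) (b + u))) \<le> ennreal R + ennreal e"
    using R e by simp
qed

lemma interp_norm_le_dual:
  assumes "0 \<le> R" "\<And>c. cmod (cdot a c) \<le> R * l1_dual M chi c"
  shows "interp_norm M UNIV chi (($) a) \<le> ennreal R"
proof -
  have "(INF u\<in>{0}. interp_norm M UNIV chi (($) (a + u))) \<le> ennreal R"
  proof (rule INF_interp_norm_le)
    fix c assume "l1_dual M chi c \<le> 1"
    then have "R * l1_dual M chi c \<le> R" using assms(1) by (simp add: mult_left_le)
    then show "Re (cdot a c) - support_fun {0} (- c) \<le> R"
      using assms(2)[of c] complex_Re_le_cmod[of "cdot a c"] by (simp add: support_fun_def cdot_def)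
  qed (use assms(1) in auto)
  then show ?thesis by simp
qed

theorem interp_norm_eq_SUP:
  "interp_norm M UNIV chi (($) a) =
     (SUP c\<in>{c. c \<noteq> 0}. ennreal (cmod (cdot a c)) / ennreal (l1_dual M chi c))" (is "?q = ?S")
proof (rule antisym)
  have div: "ennreal (cmod (cdot a c)) / ennreal (l1_dual M chi c) = ennreal (cmod (cdot a c) / l1_dual M chi c)"
    if "c \<noteq> 0" for c using l1_dual_pos[OF that] by (simp add: divide_ennreal)
  show "?S \<le> ?q"
    by (rule SUP_least) (use div l1_dual_pos interp_norm_ge_cdot in auto)
  show "?q \<le> ?S"
  proof (cases ?S)
    case (real R)
    have "?q \<le> ennreal R"
    proof (rule interp_norm_le_dual[OF real(1)])
      fix c
      show "cmod (cdot a c) \<le> R * l1_dual M chi c"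
      proof (cases "c = 0")
        case False
        then have "ennreal (cmod (cdot a c) / l1_dual M chi c) \<le> ennreal R"
          unfolding real(2)[symmetric] by (intro SUP_upper2[of c]) (auto simp: div)
        then show ?thesis using real(1) l1_dual_pos[OF False]
          by (simp add: ennreal_le_iff field_simps)
      qed (simp add: cdot_def l1_dual_def)
    qed
    then show ?thesis unfolding real .
  next
    case top
    show ?thesis unfolding top by (rule top_greatest)
  qed
qed

text \<open>
  The right-hand side is a supremum of possibly negative numbers, hence the extended reals; the vector
  \<open>c = 0\<close> keeps it nonnegative, which is what allows \<open>INF_interp_norm_le\<close> to apply.
\<close>

theorem INF_interp_norm_eq_SUP:
  assumes K: "K \<noteq> {}" "compact K" "convex K"
  shows "enn2ereal (INF u\<in>K. interp_norm M UNIV chi (($) (b + u))) =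
     (SUP c\<in>{c. l1_dual M chi c \<le> 1}. ereal (Re (cdot b c) - support_fun K (- c)))" (is "enn2ereal ?q = ?S")
proof (rule antisym)
  show "?S \<le> enn2ereal ?q"
  proof (rule SUP_least)
    fix c assume "c \<in> {c. l1_dual M chi c \<le> 1}"
    then have c: "l1_dual M chi c \<le> 1" by simp
    let ?t = "Re (cdot b c) - support_fun K (- c)"
    have "bounded ((\<lambda>u. Re (cdot u (- c))) ` K)"
      unfolding Re_cdot by (intro compact_imp_bounded compact_continuous_image continuous_intros K)
    then have bdd: "bdd_above ((\<lambda>u. Re (cdot u (- c))) ` K)"
      by (rule bounded_imp_bdd_above)
    have "ennreal ?t \<le> ?q"
    proof (rule INF_greatest)
      fix u assume u: "u \<in> K"
      have "Re (cdot u (- c)) \<le> support_fun K (- c)"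
        unfolding support_fun_def by (rule cSUP_upper[OF u bdd])
      then have "?t \<le> cmod (cdot (b + u) c) / 1"
        using complex_Re_le_cmod[of "cdot (b + u) c"] by (simp add: Re_cdot inner_add_left)
      then have "ennreal ?t \<le> ennreal (cmod (cdot (b + u) c) / 1)" by (rule ennreal_leI)
      also have "\<dots> \<le> interp_norm M UNIV chi (($) (b + u))"
        by (rule interp_norm_ge_cdot) (use c in auto)
      finally show "ennreal ?t \<le> interp_norm M UNIV chi (($) (b + u))" .
    qed
    then have "enn2ereal (ennreal ?t) \<le> enn2ereal ?q" by (simp add: less_eq_ennreal.rep_eq)
    then show "ereal ?t \<le> enn2ereal ?q"
      by (rule order_trans[rotated]) (simp add: ennreal.rep_eq)
  qed
  have z: "0 \<le> ?S"
    by (rule SUP_upper2[of 0]) (use K(1) in \<open>auto simp: l1_dual_def cdot_def support_fun_def zero_ereal_def\<close>)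
  show "enn2ereal ?q \<le> ?S"
  proof (cases ?S)
    case (real R)
    have R: "0 \<le> R" using z real by simp
    have "?q \<le> ennreal R"
    proof (rule INF_interp_norm_le[OF K R])
      fix c assume "l1_dual M chi c \<le> 1"
      then have "ereal (Re (cdot b c) - support_fun K (- c)) \<le> ?S" by (intro SUP_upper) auto
      then show "Re (cdot b c) - support_fun K (- c) \<le> R" using real by simp
    qed
    then have "enn2ereal ?q \<le> enn2ereal (ennreal R)" by (simp add: less_eq_ennreal.rep_eq)
    then show ?thesis using real R by (simp add: enn2ereal_ennreal)
  qed (use z in auto)
qed

section \<open>Comparison with the Euclidean norm\<close>

lemma integral_trig_norm_sq: "(LINT x|M. (cmod (trig c x))\<^sup>2) = (norm c)\<^sup>2"
proof -
  have "complex_of_real (LINT x|M. (cmod (trig c x))\<^sup>2) = (LINT x|M. trig c x * cnj (trig c x))"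
    by (simp add: complex_norm_square del: of_real_power flip: integral_complex_of_real)
  also have "\<dots> = of_real ((norm c)\<^sup>2)"
    using cdot_coeffs[OF trig_measurable trig_AE_bound, of c c] by (simp add: coeffs_trig cdot_self)
  finally show ?thesis using of_real_eq_iff by blast
qed

lemma integrable_trig_pow: "integrable M (\<lambda>x. cmod (trig c x) ^ k)"
proof (rule integrable_of_AE_bounded)
  show "AE x in M. norm (cmod (trig c x) ^ k) \<le> (\<Sum>j\<in>UNIV. cmod (c $ j)) ^ k"
    using trig_AE_bound[of c] by eventually_elim (simp add: power_mono)
qed measurable

lemma l1_dual_le_norm: "l1_dual M chi c \<le> norm c"
proof (cases "c = 0")
  case False
  let ?n = "norm c"
  have "l1_dual M chi c \<le> (LINT x|M. (?n + (cmod (trig c x))\<^sup>2 / ?n) / 2)"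
    unfolding l1_dual_trig
  proof (rule integral_mono)
    show "integrable M (\<lambda>x. (?n + (cmod (trig c x))\<^sup>2 / ?n) / 2)" using integrable_trig_pow by auto
    show "integrable M (\<lambda>x. cmod (trig c x))" using integrable_trig by auto
    fix x
    show "cmod (trig c x) \<le> (?n + (cmod (trig c x))\<^sup>2 / ?n) / 2"
      using sum_squares_bound[of "cmod (trig c x)" ?n] False by (simp add: field_simps power2_eq_square)
  qed
  also have "\<dots> = ?n"
    using integrable_trig_pow[of c 2] False
    by (simp add: integral_trig_norm_sq prob_space) (simp add: power2_eq_square)
  finally show ?thesis .
qed (simp add: l1_dual_def)

lemma norm_le_interp_norm: "ennreal (norm a) \<le> interp_norm M UNIV chi (($) a)"
proof (cases "a = 0")
  case False
  have "norm a = cmod (cdot a a) / norm a"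
    using False by (simp add: cdot_self power2_eq_square norm_mult)
  then show ?thesis using interp_norm_ge_cdot[of "norm a" a a] l1_dual_le_norm[of a] False by simp
qed simp

text \<open>
  The moments satisfy \<open>\<parallel>p\<parallel>\<^sub>2\<^sup>6 \<le> \<parallel>p\<parallel>\<^sub>1\<^sup>2 \<parallel>p\<parallel>\<^sub>4\<^sup>4\<close> for \<open>p = \<Sum> c\<^sub>j \<chi>\<^sub>j\<close>. In place of Hoelder's inequality a pointwise
  bound is integrated: with \<open>s = \<surd>2 \<parallel>c\<parallel>\<close>, the polynomial \<open>t (t - s)\<^sup>2 (t + 2 s)\<close> is nonnegative for \<open>t \<ge> 0\<close>, and
  its double root \<open>s\<close> is chosen so that the resulting constant is the one Hoelder gives.
\<close>

lemma norm_le_sqrt2_l1_dual: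
  assumes m4: "(LINT x|M. cmod (trig c x) ^ 4) \<le> 2 * norm c ^ 4"
  shows "norm c \<le> sqrt 2 * l1_dual M chi c"
proof (cases "c = 0")
  case False
  let ?n = "norm c" and ?w = "\<lambda>x. cmod (trig c x)"
  have n: "?n > 0" using False by simp
  have pt: "6 * ?n\<^sup>2 * t\<^sup>2 - t ^ 4 \<le> 4 * sqrt 2 * ?n ^ 3 * t" if "0 \<le> t" for t
  proof -
    let ?s = "sqrt 2 * ?n"
    have s2: "?s\<^sup>2 = 2 * ?n\<^sup>2" by (simp add: power_mult_distrib)
    have s3: "?s ^ 3 = 2 * sqrt 2 * ?n ^ 3" by (simp add: power_mult_distrib power3_eq_cube)
    have "t * ((t - s)\<^sup>2 * (t + 2 * s)) = t ^ 4 - 3 * s\<^sup>2 * t\<^sup>2 + 2 * s ^ 3 * t" for s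
      by (simp add: power2_eq_square power3_eq_cube power4_eq_xxxx algebra_simps)
    moreover have "0 \<le> t * ((t - ?s)\<^sup>2 * (t + 2 * ?s))" using that n by simp
    ultimately have "0 \<le> t ^ 4 - 3 * ?s\<^sup>2 * t\<^sup>2 + 2 * ?s ^ 3 * t" by simp
    then show ?thesis unfolding s2 s3 by simp
  qed
  have "(LINT x|M. 6 * ?n\<^sup>2 * (?w x)\<^sup>2 - ?w x ^ 4) \<le> (LINT x|M. 4 * sqrt 2 * ?n ^ 3 * ?w x)"
    by (intro integral_mono pt) (use integrable_trig_pow[of c 2] integrable_trig_pow[of c 4] integrable_trig in auto)
  then have "6 * ?n\<^sup>2 * ?n\<^sup>2 - (LINT x|M. ?w x ^ 4) \<le> 4 * sqrt 2 * ?n ^ 3 * l1_dual M chi c"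
    using integrable_trig_pow[of c 2] integrable_trig_pow[of c 4]
    by (simp add: integral_trig_norm_sq l1_dual_trig)
  then have "4 * ?n ^ 3 * ?n \<le> 4 * ?n ^ 3 * (sqrt 2 * l1_dual M chi c)"
    using m4 by (simp add: power2_eq_square power3_eq_cube power4_eq_xxxx algebra_simps)
  then show ?thesis using n by (simp del: mult.assoc)
qed (simp add: l1_dual_def)

end

text \<open>
  In this family the products \<open>\<chi>\<^sub>i \<chi>\<^sub>k\<close> are orthogonal unless they agree up to the order of the factors.
  Two unordered pairs, possibly with repetition, are equal exactly if their underlying sets are, so the
  condition can be expressed with sets.
\<close>

locale orthonormal_pairs_family = orthonormal_family M chi
  for M :: "'g measure" and chi :: "'n::finite \<Rightarrow> 'g \<Rightarrow> complex" +
  assumes pairs: "{i, k} \<noteq> {j, l} \<Longrightarrow> (LINT x|M. chi i x * chi k x * cnj (chi j x) * cnj (chi l x)) = 0"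
begin

text \<open>
  Expand \<open>|p|\<^sup>4 = p p cnj p cnj p\<close>. A product of four characters integrates to 1 if \<open>{i, k} = {j, l}\<close> and
  to 0 otherwise, so each pair \<open>i \<noteq> k\<close> contributes \<open>2 |c\<^sub>i|\<^sup>2 |c\<^sub>k|\<^sup>2\<close> and each \<open>i = k\<close> only half of that.
\<close>

lemma fourth_moment: "(LINT x|M. cmod (trig c x) ^ 4) \<le> 2 * norm c ^ 4"
proof -
  define e where "e i k j l = (if {i, k} = {j, l} then 1 else 0 :: complex)" for i k j l :: 'n
  let ?X = "\<lambda>i k j l x. chi i x * chi k x * cnj (chi j x) * cnj (chi l x)"
  let ?C = "\<lambda>i k j l. c $ i * c $ k * cnj (c $ j) * cnj (c $ l)"
  have int_X: "integrable M (?X i k j l)" for i k j l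
  proof (rule integrable_of_AE_bounded)
    show "?X i k j l \<in> borel_measurable M"
      using chi_measurable[OF UNIV_I, measurable] by measurable
    show "AE x in M. norm (?X i k j l x) \<le> 1"
      by (rule AE_I2) (simp add: norm_mult chi_norm)
  qed
  have X: "(LINT x|M. ?X i k j l x) = e i k j l" for i k j l
  proof (cases "{i, k} = {j, l}")
    case True
    have one: "chi m x * cnj (chi m x) = 1" if "x \<in> space M" for m x
      using chi_norm[OF UNIV_I that, of m] by (simp flip: complex_norm_square)
    have eq: "?X i k j l x = (chi i x * cnj (chi i x)) * (chi k x * cnj (chi k x))" for x
      using True by (auto simp: doubleton_eq_iff mult_ac)
    have "(LINT x|M. ?X i k j l x) = (LINT x|M. 1)"
      by (intro Bochner_Integration.integral_cong refl) (simp only: eq one mult_1)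
    then show ?thesis using True by (simp add: e_def prob_space)
  qed (simp add: e_def pairs)
  have delta: "(\<Sum>j\<in>UNIV. \<Sum>l\<in>UNIV. F j l * (if j = u then if l = v then 1 else 0 else 0)) = F u v"
    for F :: "'n \<Rightarrow> 'n \<Rightarrow> complex" and u v
  proof -
    have "(\<Sum>l\<in>UNIV. F j l * (if j = u then if l = v then 1 else 0 else 0)) = (if j = u then F u v else 0)" for j
      by (cases "j = u") (simp_all add: if_distrib[of "\<lambda>y. _ * y"] cong: if_cong)
    then show ?thesis by simp
  qed
  \<comment> \<open>The last factor avoids counting the case \<open>i = k\<close>, where the two matchings coincide, twice.\<close>
  have e_split: "e i k j l = (if j = i then if l = k then 1 else 0 else 0)
      + (if j = k then if l = i then 1 else 0 else 0) * (if i = k then 0 else 1)" for i k j l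
    by (auto simp: e_def doubleton_eq_iff)
  have "complex_of_real (cmod (trig c x) ^ 4) = (\<Sum>i\<in>UNIV. \<Sum>k\<in>UNIV. \<Sum>j\<in>UNIV. \<Sum>l\<in>UNIV. ?C i k j l * ?X i k j l x)" for x
  proof -
    have "complex_of_real (cmod (trig c x) ^ 4) = (trig c x * trig c x) * (cnj (trig c x) * cnj (trig c x))"
      using complex_norm_square[of "trig c x"] by (simp add: power4_eq_xxxx power2_eq_square mult_ac)
    also have "\<dots> = (\<Sum>i\<in>UNIV. \<Sum>k\<in>UNIV. \<Sum>j\<in>UNIV. \<Sum>l\<in>UNIV. ?C i k j l * ?X i k j l x)"
    proof -
      have factor: "(\<Sum>i\<in>UNIV. \<Sum>k\<in>UNIV. \<Sum>j\<in>UNIV. \<Sum>l\<in>UNIV. p i * p k * q j * q l) =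
          (sum p UNIV * sum p UNIV) * (sum q UNIV * sum q UNIV)" for p q :: "'n \<Rightarrow> complex"
      proof -
        have "(\<Sum>j\<in>UNIV. \<Sum>l\<in>UNIV. p i * p k * q j * q l) = p i * p k * (sum q UNIV * sum q UNIV)" for i k
          unfolding sum_product unfolding sum_distrib_left mult.assoc ..
        then show ?thesis by (simp only: sum_product[of p UNIV p UNIV] flip: sum_distrib_right)
      qed
      show ?thesis
        unfolding trig_def cnj_sum factor[symmetric]
        by (intro sum.cong refl) (simp add: mult_ac)
    qed
    finally show ?thesis .
  qed
  then have "complex_of_real (LINT x|M. cmod (trig c x) ^ 4) =
      (LINT x|M. (\<Sum>i\<in>UNIV. \<Sum>k\<in>UNIV. \<Sum>j\<in>UNIV. \<Sum>l\<in>UNIV. ?C i k j l * ?X i k j l x))"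
    by (simp flip: integral_complex_of_real)
  also have "\<dots> = (\<Sum>i\<in>UNIV. \<Sum>k\<in>UNIV. \<Sum>j\<in>UNIV. \<Sum>l\<in>UNIV. ?C i k j l * e i k j l)"
    using int_X by (simp add: Bochner_Integration.integral_sum X)
  also have "\<dots> = (\<Sum>i\<in>UNIV. \<Sum>k\<in>UNIV. of_real ((if i = k then 1 else 2) * ((cmod (c $ i))\<^sup>2 * (cmod (c $ k))\<^sup>2)))"
  proof (intro sum.cong refl)
    fix i k
    have "(\<Sum>j\<in>UNIV. \<Sum>l\<in>UNIV. ?C i k j l * e i k j l) = ?C i k i k + ?C i k k i * (if i = k then 0 else 1)"
      unfolding e_split distrib_left sum.distrib mult.assoc[symmetric] sum_distrib_right[symmetric] delta ..
    also have "\<dots> = of_real ((if i = k then 1 else 2) * ((cmod (c $ i))\<^sup>2 * (cmod (c $ k))\<^sup>2))"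
      unfolding of_real_mult complex_norm_square by (simp add: mult_ac)
    finally show "(\<Sum>j\<in>UNIV. \<Sum>l\<in>UNIV. ?C i k j l * e i k j l) =
      of_real ((if i = k then 1 else 2) * ((cmod (c $ i))\<^sup>2 * (cmod (c $ k))\<^sup>2))" .
  qed
  finally have "(LINT x|M. cmod (trig c x) ^ 4) =
      (\<Sum>i\<in>UNIV. \<Sum>k\<in>UNIV. (if i = k then 1 else 2) * ((cmod (c $ i))\<^sup>2 * (cmod (c $ k))\<^sup>2))"
    unfolding of_real_sum[symmetric] of_real_eq_iff .
  also have "\<dots> \<le> (\<Sum>i\<in>UNIV. \<Sum>k\<in>UNIV. 2 * ((cmod (c $ i))\<^sup>2 * (cmod (c $ k))\<^sup>2))"
    by (intro sum_mono mult_right_mono) auto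
  also have "\<dots> = 2 * ((\<Sum>i\<in>UNIV. (cmod (c $ i))\<^sup>2) * (\<Sum>k\<in>UNIV. (cmod (c $ k))\<^sup>2))"
    unfolding sum_product by (simp add: sum_distrib_left)
  also have "(\<Sum>i\<in>UNIV. (cmod (c $ i))\<^sup>2) = (norm c)\<^sup>2"
    by (simp add: norm_vec_def L2_set_def sum_nonneg)
  finally show ?thesis by (simp add: power2_eq_square power4_eq_xxxx)
qed

lemma interp_norm_le_sqrt2_norm: "interp_norm M UNIV chi (($) a) \<le> ennreal (sqrt 2 * norm a)"
proof (rule interp_norm_le_dual)
  fix c
  have "cmod (cdot a c) \<le> norm a * norm c" by (rule cmod_cdot_le)
  also have "\<dots> \<le> norm a * (sqrt 2 * l1_dual M chi c)"
    by (intro mult_left_mono norm_le_sqrt2_l1_dual fourth_moment) simp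
  finally show "cmod (cdot a c) \<le> sqrt 2 * norm a * l1_dual M chi c" by (simp add: mult_ac)
qed simp

end

section \<open>Haar measure and orthogonality of characters\<close>

locale haar_group = compact_metrizable_ab_group G X for G :: "('g, 'x) monoid_scheme" (structure) and X +
  fixes \<mu> :: "'g measure"
  assumes haar: "haar_prob G X \<mu>"
begin

lemma space_haar: "space \<mu> = carrier G"
  using haar topspace_eq_carrier by (simp add: haar_prob_def)

lemma sets_haar: "sets \<mu> = sigma_sets (topspace X) {V. openin X V}"
  using haar by (simp add: haar_prob_def)

sublocale prob_space \<mu>
  using haar by (simp add: haar_prob_def)

lemma openin_sets: "openin X V \<Longrightarrow> V \<in> sets \<mu>"
  unfolding sets_haar by (rule sigma_sets.Basic) simp

lemma continuous_imp_measurable: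
  fixes f :: "'g \<Rightarrow> 'b::topological_space"
  assumes "continuous_map X euclidean f"
  shows "f \<in> borel_measurable \<mu>"
proof (rule borel_measurableI)
  fix S :: "'b set" assume "open S"
  then have "openin X {x \<in> topspace X. f x \<in> S}"
    using assms by (intro openin_continuous_map_preimage[OF assms]) auto
  moreover have "{x \<in> topspace X. f x \<in> S} = f -` S \<inter> space \<mu>"
    using topspace_eq_carrier space_haar by auto
  ultimately show "f -` S \<inter> space \<mu> \<in> sets \<mu>" using openin_sets by simp
qed

lemma continuous_translation:
  assumes "g \<in> carrier G"
  shows "continuous_map X X (\<lambda>x. g \<otimes> x)"
proof -
  have "continuous_map X (prod_topology X X) (\<lambda>x. (g, x))"
    using assms by (intro continuous_map_pairedI) (auto simp: topspace_eq_carrier)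
  from continuous_map_compose[OF this continuous_mult] show ?thesis by (simp add: o_def)
qed

lemma translation_measurable:
  assumes "g \<in> carrier G"
  shows "(\<lambda>x. g \<otimes> x) \<in> measurable \<mu> \<mu>"
proof (rule measurable_sigma_sets[OF sets_haar])
  show "{V. openin X V} \<subseteq> Pow (topspace X)" using openin_subset by auto
  show "(\<lambda>x. g \<otimes> x) \<in> space \<mu> \<rightarrow> topspace X"
    using assms by (auto simp: space_haar topspace_eq_carrier)
  fix V assume "V \<in> {V. openin X V}"
  then have "openin X {x \<in> topspace X. g \<otimes> x \<in> V}"
    by (intro openin_continuous_map_preimage[OF continuous_translation[OF assms]]) auto
  moreover have "{x \<in> topspace X. g \<otimes> x \<in> V} = (\<lambda>x. g \<otimes> x) -` V \<inter> space \<mu>"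
    using topspace_eq_carrier space_haar by auto
  ultimately show "(\<lambda>x. g \<otimes> x) -` V \<inter> space \<mu> \<in> sets \<mu>" using openin_sets by simp
qed

lemma distr_translation:
  assumes g: "g \<in> carrier G"
  shows "distr \<mu> \<mu> (\<lambda>x. g \<otimes> x) = \<mu>"
proof (rule measure_eqI)
  fix B assume "B \<in> sets (distr \<mu> \<mu> (\<lambda>x. g \<otimes> x))"
  then have B: "B \<in> sets \<mu>" by simp
  have sub: "B \<subseteq> carrier G" using sets.sets_into_space[OF B] by (simp add: space_haar)
  have "(\<lambda>x. g \<otimes> x) -` B \<inter> space \<mu> = (\<lambda>x. inv g \<otimes> x) ` B"
  proof (intro equalityI subsetI)
    fix x assume x: "x \<in> (\<lambda>x. g \<otimes> x) -` B \<inter> space \<mu>"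
    then have "x = inv g \<otimes> (g \<otimes> x)" using g by (simp add: space_haar m_assoc[symmetric])
    then show "x \<in> (\<lambda>x. inv g \<otimes> x) ` B" using x by (intro image_eqI[of _ _ "g \<otimes> x"]) auto
  next
    fix y assume "y \<in> (\<lambda>x. inv g \<otimes> x) ` B"
    then obtain x where y: "y = inv g \<otimes> x" and "x \<in> B" by blast
    then have "x \<in> carrier G" using sub by auto
    then have "g \<otimes> y = x" "y \<in> carrier G" using g y by (simp_all add: m_assoc[symmetric])
    then show "y \<in> (\<lambda>x. g \<otimes> x) -` B \<inter> space \<mu>" using \<open>x \<in> B\<close> by (simp add: space_haar)
  qed
  then have "emeasure (distr \<mu> \<mu> (\<lambda>x. g \<otimes> x)) B = emeasure \<mu> ((\<lambda>x. inv g \<otimes> x) ` B)"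
    using B by (simp add: emeasure_distr translation_measurable[OF g])
  also have "\<dots> = emeasure \<mu> B"
    using haar B g by (simp add: haar_prob_def)
  finally show "emeasure (distr \<mu> \<mu> (\<lambda>x. g \<otimes> x)) B = emeasure \<mu> B" .
qed simp

lemma integral_translation:
  fixes f :: "'g \<Rightarrow> 'b::{banach, second_countable_topology}"
  assumes "g \<in> carrier G" "f \<in> borel_measurable \<mu>"
  shows "(LINT x|\<mu>. f (g \<otimes> x)) = (LINT x|\<mu>. f x)"
proof -
  have "(LINT x|\<mu>. f (g \<otimes> x)) = (LINT x|distr \<mu> \<mu> (\<lambda>x. g \<otimes> x). f x)"
    using integral_distr[OF translation_measurable[OF assms(1)] assms(2)] by simp
  then show ?thesis using distr_translation[OF assms(1)] by simp
qed

text \<open>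
  Translation by \<open>g\<close> multiplies the integral by \<open>\<psi> g \<noteq> 1\<close> and leaves it unchanged.
\<close>

lemma integral_nontrivial_hom:
  fixes \<psi> :: "'g \<Rightarrow> complex"
  assumes \<psi>: "\<psi> \<in> borel_measurable \<mu>"
    and hom: "\<And>x y. x \<in> carrier G \<Longrightarrow> y \<in> carrier G \<Longrightarrow> \<psi> (x \<otimes> y) = \<psi> x * \<psi> y"
    and g: "g \<in> carrier G" "\<psi> g \<noteq> 1"
  shows "(LINT x|\<mu>. \<psi> x) = 0"
proof -
  have "(LINT x|\<mu>. \<psi> x) = (LINT x|\<mu>. \<psi> (g \<otimes> x))"
    using integral_translation[OF g(1) \<psi>] by simp
  also have "\<dots> = (LINT x|\<mu>. \<psi> g * \<psi> x)"
    by (intro Bochner_Integration.integral_cong refl) (simp add: hom g space_haar)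
  finally have "(1 - \<psi> g) * (LINT x|\<mu>. \<psi> x) = 0" by (simp add: algebra_simps)
  then show ?thesis using g(2) by simp
qed

lemma character_measurable: "character G X f \<Longrightarrow> f \<in> borel_measurable \<mu>"
  by (rule continuous_imp_measurable) (simp add: character_def continuous_map_in_subtopology)

lemma character_mult:
  "character G X f \<Longrightarrow> x \<in> carrier G \<Longrightarrow> y \<in> carrier G \<Longrightarrow> f (x \<otimes> y) = f x * f y"
  by (simp add: character_def hom_def mult_group_on_def)

lemma character_norm: "character G X f \<Longrightarrow> x \<in> carrier G \<Longrightarrow> cmod (f x) = 1"
  by (auto simp: character_def hom_def mult_group_on_def circle_def)

lemma unimodular_family_characters:
  assumes "distinct_characters G X J chi"
  shows "unimodular_family \<mu> J chi"
proof
  show "chi j \<in> borel_measurable \<mu>" if "j \<in> J" for j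
    using assms that by (auto simp: distinct_characters_def intro: character_measurable)
  show "cmod (chi j x) = 1" if "j \<in> J" "x \<in> space \<mu>" for j x
    using assms that by (auto simp: distinct_characters_def space_haar intro: character_norm)
qed

lemma orthonormal_family_characters:
  fixes chi :: "'n::finite \<Rightarrow> 'g \<Rightarrow> complex"
  assumes "distinct_characters G X UNIV chi"
  shows "orthonormal_family \<mu> chi"
proof -
  interpret unimodular_family \<mu> UNIV chi by (rule unimodular_family_characters[OF assms])
  have ch: "character G X (chi j)" for j using assms by (simp add: distinct_characters_def)
  have self: "chi j x * cnj (chi j x) = 1" if "x \<in> carrier G" for j x
    using character_norm[OF ch that, of j] by (simp flip: complex_norm_square)
  show ?thesis
  proof
    fix i j
    show "(LINT x|\<mu>. chi i x * cnj (chi j x)) = (if i = j then 1 else 0)"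
    proof (cases "i = j")
      case True
      have "(LINT x|\<mu>. chi j x * cnj (chi j x)) = (LINT x|\<mu>. 1)"
        by (intro Bochner_Integration.integral_cong refl) (simp add: self space_haar)
      then show ?thesis using True by (simp add: prob_space)
    next
      case False
      then obtain g where g: "g \<in> carrier G" "chi i g \<noteq> chi j g"
        using assms by (metis distinct_characters_def UNIV_I)
      have "(LINT x|\<mu>. chi i x * cnj (chi j x)) = 0"
      proof (rule integral_nontrivial_hom[OF _ _ g(1)])
        show "(\<lambda>x. chi i x * cnj (chi j x)) \<in> borel_measurable \<mu>"
          using character_measurable[OF ch, measurable] by measurable
        show "chi i g * cnj (chi j g) \<noteq> 1"
        proof
          assume "chi i g * cnj (chi j g) = 1"
          then have "chi i g * (chi j g * cnj (chi j g)) = chi j g" by (simp add: mult_ac)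
          then show False using g self[OF g(1), of j] by simp
        qed
      qed (simp add: character_mult[OF ch])
      then show ?thesis using False by simp
    qed
  qed
qed

text \<open>
  If \<open>{i, k} \<noteq> {j, l}\<close>, some coordinate \<open>m\<close> occurs in \<open>z\<^sub>i z\<^sub>k cnj z\<^sub>j cnj z\<^sub>l\<close> with a total exponent between
  -2 and 2 other than 0. The full torus contains the point with \<open>\<i>\<close> at \<open>m\<close> and 1 elsewhere, where the product is
  \<open>\<i>\<close> to that exponent and therefore not 1.
\<close>

lemma orthonormal_pairs_family_full_torus:
  fixes chi :: "'n::finite \<Rightarrow> 'g \<Rightarrow> complex"
  assumes dist: "distinct_characters G X UNIV chi" and surj: "torus \<subseteq> joint_map chi ` carrier G"
  shows "orthonormal_pairs_family \<mu> chi"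
proof -
  interpret orthonormal_family \<mu> chi by (rule orthonormal_family_characters[OF dist])
  have ch: "character G X (chi j)" for j using dist by (simp add: distinct_characters_def)
  show ?thesis
  proof
    fix i k j l :: 'n
    assume ne: "{i, k} \<noteq> {j, l}"
    define w where "w m p = (if p = m then \<i> else 1)" for m p :: 'n
    have "\<exists>m. w m i * w m k * cnj (w m j) * cnj (w m l) \<noteq> 1"
    proof (rule ccontr)
      assume "\<nexists>m. w m i * w m k * cnj (w m j) * cnj (w m l) \<noteq> 1"
      then have *: "w m i * w m k * cnj (w m j) * cnj (w m l) = 1" for m by blast
      show False
        using ne *[of i] *[of k] *[of j] *[of l]
        by (cases "i = k"; cases "i = j"; cases "i = l"; cases "k = j"; cases "k = l"; cases "j = l")
           (simp_all add: w_def insert_commute complex_eq_iff)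
    qed
    then obtain m where m: "w m i * w m k * cnj (w m j) * cnj (w m l) \<noteq> 1" by blast
    have "(\<chi> p. w m p) \<in> torus" by (simp add: torus_def circle_def w_def)
    then have "(\<chi> p. w m p) \<in> joint_map chi ` carrier G" by (rule subsetD[OF surj])
    then obtain g where g: "g \<in> carrier G" "joint_map chi g = (\<chi> p. w m p)" by (metis imageE)
    have w: "chi p g = w m p" for p
      using arg_cong[OF g(2), of "\<lambda>v. v $ p"] by (simp add: joint_map_def)
    show "(LINT x|\<mu>. chi i x * chi k x * cnj (chi j x) * cnj (chi l x)) = 0"
    proof (rule integral_nontrivial_hom[OF _ _ g(1)])
      show "(\<lambda>x. chi i x * chi k x * cnj (chi j x) * cnj (chi l x)) \<in> borel_measurable \<mu>"
        using character_measurable[OF ch, measurable] by measurable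
    qed (simp_all add: character_mult[OF ch] w m)
  qed
qed

end

section \<open>Closures of subgroups of the torus\<close>

definition vcnj :: "complex ^ 'n \<Rightarrow> complex ^ 'n" where
  "vcnj z = (\<chi> j. cnj (z $ j))"

lemma continuous_on_vec_mult:
  fixes f g :: "'a::topological_space \<Rightarrow> complex ^ 'n"
  assumes "continuous_on S f" "continuous_on S g"
  shows "continuous_on S (\<lambda>x. f x * g x)"
  unfolding times_vec_def using assms by (intro continuous_intros)

lemma continuous_on_vcnj: "continuous_on S (vcnj :: complex ^ 'n \<Rightarrow> _)"
  unfolding vcnj_def[abs_def] by (intro continuous_intros)

lemma closed_torus: "closed (torus :: (complex ^ 'n) set)"
proof -
  have "torus = (\<Inter>j. {z :: complex ^ 'n. cmod (z $ j) = 1})" by (auto simp: torus_def circle_def)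
  also have "closed \<dots>" by (intro closed_INT ballI closed_Collect_eq continuous_intros)
  finally show ?thesis .
qed

lemma bounded_torus: "bounded (torus :: (complex ^ 'n) set)"
proof (rule boundedI)
  fix z :: "complex ^ 'n" assume "z \<in> torus"
  then have "(\<Sum>j\<in>UNIV. cmod (z $ j)) = real CARD('n)" by (simp add: torus_def circle_def)
  then show "norm z \<le> real CARD('n)" using L2_set_le_sum[of UNIV "\<lambda>j. cmod (z $ j)"]
    by (simp add: norm_vec_def)
qed

lemma vec_mult_vcnj: "z \<in> torus \<Longrightarrow> z * vcnj z = 1"
  by (simp add: vec_eq_iff vcnj_def torus_def circle_def flip: complex_norm_square)

locale torus_subgroup =
  fixes H :: "(complex ^ 'n) set"
  assumes sub: "H \<subseteq> torus" and one: "1 \<in> H"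
    and mult: "\<And>x y. x \<in> H \<Longrightarrow> y \<in> H \<Longrightarrow> x * y \<in> H"
    and cnj: "\<And>x. x \<in> H \<Longrightarrow> vcnj x \<in> H"
begin

lemma closure_sub: "closure H \<subseteq> torus"
  using sub closed_torus by (rule closure_minimal)

lemma closure_mult: "x \<in> closure H \<Longrightarrow> y \<in> closure H \<Longrightarrow> x * y \<in> closure H"
proof -
  assume "x \<in> closure H" "y \<in> closure H"
  then have "(x, y) \<in> closure (H \<times> H)" by (simp add: closure_Times)
  moreover have "(\<lambda>(x, y). x * y) ` closure (H \<times> H) \<subseteq> closure H"
  proof (rule image_closure_subset)
    show "continuous_on (closure (H \<times> H)) (\<lambda>(x, y). x * y)"
      unfolding case_prod_beta by (intro continuous_on_vec_mult continuous_intros)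
    show "(\<lambda>(x, y). x * y) ` (H \<times> H) \<subseteq> closure H" using mult closure_subset[of H] by auto
  qed simp
  ultimately show "x * y \<in> closure H" by force
qed

lemma closure_vcnj: "x \<in> closure H \<Longrightarrow> vcnj x \<in> closure H"
proof -
  have "vcnj ` closure H \<subseteq> closure H"
    by (rule image_closure_subset[OF continuous_on_vcnj]) (use cnj closure_subset in auto)
  then show "x \<in> closure H \<Longrightarrow> vcnj x \<in> closure H" by blast
qed

lemma comm_group_closure: "comm_group (mult_group_on (closure H))"
proof (rule comm_groupI)
  fix x assume "x \<in> carrier (mult_group_on (closure H))"
  then show "\<exists>y\<in>carrier (mult_group_on (closure H)). y \<otimes>\<^bsub>mult_group_on (closure H)\<^esub> x = \<one>\<^bsub>mult_group_on (closure H)\<^esub>"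
    using vec_mult_vcnj[of x] closure_sub
    by (intro bexI[of _ "vcnj x"]) (auto simp: mult_group_on_def closure_vcnj mult.commute)
qed (use closure_subset one in \<open>auto simp: mult_group_on_def closure_mult mult_ac\<close>)

lemma inv_closure:
  assumes "x \<in> closure H"
  shows "inv\<^bsub>mult_group_on (closure H)\<^esub> x = vcnj x"
proof -
  interpret comm_group "mult_group_on (closure H)" by (rule comm_group_closure)
  show ?thesis
    by (rule inv_equality)
       (use assms vec_mult_vcnj[of x] closure_sub in \<open>auto simp: mult_group_on_def closure_vcnj mult.commute\<close>)
qed

theorem compact_group_closure:
  "compact_metrizable_ab_group (mult_group_on (closure H)) (top_of_set (closure H))"
proof -
  interpret comm_group "mult_group_on (closure H)" by (rule comm_group_closure)
  let ?G = "mult_group_on (closure H)" and ?X = "top_of_set (closure H)"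
  show ?thesis
  proof
    show "topspace ?X = carrier ?G" by (simp add: mult_group_on_def)
    have "continuous_map (top_of_set (closure H \<times> closure H)) ?X (\<lambda>(x, y). x \<otimes>\<^bsub>?G\<^esub> y)"
      unfolding continuous_map_subtopology_eu
      by (auto simp: mult_group_on_def closure_mult case_prod_beta intro!: continuous_on_vec_mult continuous_intros)
    then show "continuous_map (prod_topology ?X ?X) ?X (\<lambda>(x, y). x \<otimes>\<^bsub>?G\<^esub> y)"
      by (simp flip: subtopology_Times)
    have "continuous_map ?X ?X vcnj"
      unfolding continuous_map_subtopology_eu using closure_vcnj by (auto intro: continuous_on_vcnj)
    then show "continuous_map ?X ?X (\<lambda>x. inv\<^bsub>?G\<^esub> x)"
      by (rule continuous_map_eq) (simp add: inv_closure)
    have "compact (closure H)"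
      using closed_torus bounded_torus closure_sub bounded_subset by (auto simp: compact_eq_bounded_closed)
    then show "compact_space ?X" by (simp add: compact_space_subtopology)
    show "metrizable_space ?X" by (simp add: metrizable_space_euclidean metrizable_space_subtopology)
  qed
qed

lemma character_closure: "character (mult_group_on (closure H)) (top_of_set (closure H)) (\<lambda>z. z $ j)"
  using closure_sub unfolding character_def hom_def continuous_map_subtopology_eu
  by (auto simp: mult_group_on_def torus_def intro!: continuous_intros)

lemma distinct_characters_closure:
  assumes "\<And>i j. i \<noteq> j \<Longrightarrow> \<exists>z\<in>H. z $ i \<noteq> z $ j"
  shows "distinct_characters (mult_group_on (closure H)) (top_of_set (closure H)) UNIV (\<lambda>j z. z $ j)"
  unfolding distinct_characters_def
proof (intro conjI ballI impI character_closure)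
  fix i j :: 'n assume "i \<noteq> j"
  then obtain z where "z \<in> H" "z $ i \<noteq> z $ j" using assms by blast
  then show "\<exists>x\<in>carrier (mult_group_on (closure H)). x $ i \<noteq> x $ j"
    using closure_subset[of H] by (auto simp: mult_group_on_def)
qed

end

section \<open>Equidistribution of orbits for Abel means\<close>

text \<open>
  The means \<open>m n\<close> are approximated by means along each orbit translated by \<open>g\<close>. Integrating over \<open>g\<close>
  and exchanging the integrals turns the translated means into the constant \<open>I\<close>, and dominated
  convergence removes the error.
\<close>

lemma tendsto_average_of_approx_invariant:
  fixes h :: "'t \<Rightarrow> 'g \<Rightarrow> real"
  assumes mu: "prob_space \<mu>" and P: "\<And>n. prob_space (P n)" "\<And>n. sets (P n) = sets T"
    and h: "(\<lambda>(t, g). h t g) \<in> borel_measurable (T \<Otimes>\<^sub>M \<mu>)"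
    and bound: "\<And>t g. t \<in> space T \<Longrightarrow> g \<in> space \<mu> \<Longrightarrow> \<bar>h t g\<bar> \<le> B"
    and avg: "\<And>t. t \<in> space T \<Longrightarrow> (LINT g|\<mu>. h t g) = I"
    and m: "\<And>g. g \<in> space \<mu> \<Longrightarrow> (\<lambda>n. (LINT t|P n. h t g) - m n) \<longlonglongrightarrow> 0" "\<And>n. \<bar>m n\<bar> \<le> B"
  shows "m \<longlonglongrightarrow> I"
proof -
  interpret mu: prob_space \<mu> by (rule mu)
  have space_P: "space (P n) = space T" for n using sets_eq_imp_space_eq[OF P(2)] .
  have h_n: "(\<lambda>(t, g). h t g) \<in> borel_measurable (P n \<Otimes>\<^sub>M \<mu>)" for n
    using h measurable_cong_sets[OF sets_pair_measure_cong[OF P(2) refl] refl] by blast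
  have h_n': "(\<lambda>(g, t). h t g) \<in> borel_measurable (\<mu> \<Otimes>\<^sub>M P n)" for n
    using measurable_pair_swap[OF h_n] by simp
  have inner_meas: "(\<lambda>g. LINT t|P n. h t g) \<in> borel_measurable \<mu>" for n
  proof -
    interpret Pn: prob_space "P n" by (rule P)
    show ?thesis using h_n' by (rule Pn.borel_measurable_lebesgue_integral)
  qed
  have inner_bound: "\<bar>LINT t|P n. h t g\<bar> \<le> B" if "g \<in> space \<mu>" for n g
  proof -
    interpret Pn: prob_space "P n" by (rule P)
    have [measurable]: "(\<lambda>t. h t g) \<in> borel_measurable (P n)"
      using measurable_Pair1[OF h_n[of n] that] by simp
    have AEb: "AE t in P n. norm (h t g) \<le> B" using bound[OF _ that] by (auto simp: space_P)
    have "integrable (P n) (\<lambda>t. h t g)" by (rule Pn.integrable_of_AE_bounded[OF _ AEb]) simp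
    moreover have "AE t in P n. h t g \<le> B" using AEb by eventually_elim simp
    moreover have "AE t in P n. - B \<le> h t g" using AEb by eventually_elim auto
    ultimately show ?thesis
      using Pn.integral_ge_const[of "\<lambda>t. h t g" "- B"] Pn.integral_le_const[of "\<lambda>t. h t g" B]
      by (simp add: abs_le_iff)
  qed
  have eq: "(LINT g|\<mu>. (LINT t|P n. h t g) - m n) = I - m n" for n
  proof -
    interpret Pn: prob_space "P n" by (rule P)
    interpret pair_prob_space "P n" \<mu> ..
    have int: "integrable (P n \<Otimes>\<^sub>M \<mu>) (\<lambda>(t, g). h t g)"
      by (rule P.integrable_of_AE_bounded[OF h_n, of B])
         (use bound in \<open>auto simp: space_pair_measure space_P intro!: AE_I2\<close>)
    have "(LINT g|\<mu>. LINT t|P n. h t g) = (LINT t|P n. LINT g|\<mu>. h t g)"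
      using Fubini_integral[OF int] by simp
    also have "\<dots> = (LINT t|P n. I)"
      by (intro Bochner_Integration.integral_cong refl) (simp add: avg space_P)
    finally have *: "(LINT g|\<mu>. LINT t|P n. h t g) = I" by (simp add: Pn.prob_space)
    have "integrable \<mu> (\<lambda>g. LINT t|P n. h t g)"
      by (rule mu.integrable_of_AE_bounded[OF inner_meas, of n B]) (use inner_bound in \<open>auto intro!: AE_I2\<close>)
    then show ?thesis by (simp add: * mu.prob_space)
  qed
  have "(\<lambda>n. LINT g|\<mu>. (LINT t|P n. h t g) - m n) \<longlonglongrightarrow> (LINT g|\<mu>. 0)"
  proof (rule integral_dominated_convergence[where w = "\<lambda>_. 2 * B"])
    show "AE g in \<mu>. (\<lambda>n. (LINT t|P n. h t g) - m n) \<longlonglongrightarrow> 0" using m(1) by (auto intro!: AE_I2)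
    show "AE g in \<mu>. norm ((LINT t|P n. h t g) - m n) \<le> 2 * B" for n
      using inner_bound[of _ n] m(2)[of n] by (auto intro!: AE_I2) (smt (verit))
    show "(\<lambda>g. (LINT t|P n. h t g) - m n) \<in> borel_measurable \<mu>" for n
      using inner_meas[of n] by measurable
  qed auto
  then have "(\<lambda>n. I - m n) \<longlonglongrightarrow> 0" by (simp add: eq)
  then have "(\<lambda>n. I - (I - m n)) \<longlonglongrightarrow> I - 0" by (intro tendsto_intros)
  then show ?thesis by simp
qed

text \<open>
  Unlike \<^const>\<open>cdot\<close>, this pairing does not conjugate, so \<open>bdot c\<close> is the trigonometric polynomial
  with coefficients \<open>c\<close> in the coordinate characters.
\<close>

definition bdot :: "complex ^ 'n \<Rightarrow> complex ^ 'n \<Rightarrow> complex" where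
  "bdot c z = (\<Sum>j\<in>UNIV. c $ j * z $ j)"

lemma bdot_mult: "bdot (c * g) z = bdot c (g * z)"
  by (simp add: bdot_def mult_ac)

lemma norm_bdot_le:
  assumes "z \<in> torus"
  shows "cmod (bdot c z) \<le> real CARD('n) * norm (c :: complex ^ 'n)"
proof -
  have "cmod (bdot c z) \<le> (\<Sum>j\<in>UNIV. cmod (c $ j))"
    unfolding bdot_def by (rule sum_norm_le) (use assms in \<open>auto simp: norm_mult torus_def circle_def\<close>)
  also have "\<dots> \<le> real CARD('n) * norm c"
    by (rule sum_norm_le_card_norm)
  finally show ?thesis .
qed

lemma bdot_diff: "bdot c z - bdot c' z = bdot (c - c') z"
  by (simp add: bdot_def sum_subtractf left_diff_distrib)

lemma continuous_on_bdot: "continuous_on S f \<Longrightarrow> continuous_on S g \<Longrightarrow> continuous_on S (\<lambda>x. bdot (f x) (g x))"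
  unfolding bdot_def by (intro continuous_intros)

lemma borel_measurable_bdot [measurable]: "bdot c \<in> borel_measurable borel"
  by (intro borel_measurable_continuous_onI continuous_on_bdot continuous_on_const continuous_on_id)

text \<open>
  The laws \<open>P n\<close> weight the points \<open>x t\<close> of the torus. The mean of \<open>|\<Sum> c\<^sub>j x\<^sub>j|\<close> is a seminorm in \<open>c\<close>, and
  translating the points by \<open>g\<close> amounts to replacing \<open>c\<close> by \<open>c * g\<close>. Invariance of the means under
  translations can thus be studied as a property of these seminorms.
\<close>

locale torus_sampling =
  fixes P :: "nat \<Rightarrow> 't measure" and T :: "'t measure" and x :: "'t \<Rightarrow> complex ^ 'n"
  assumes prob_P: "prob_space (P n)" and sets_P: "sets (P n) = sets T"
    and x_meas: "x \<in> borel_measurable T" and x_torus: "t \<in> space T \<Longrightarrow> x t \<in> torus"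
begin

lemma space_P: "space (P n) = space T"
  using sets_eq_imp_space_eq[OF sets_P] .

lemma x_meas_P [measurable]: "x \<in> borel_measurable (P n)"
  using x_meas measurable_cong_sets[OF sets_P refl] by blast

definition mean :: "nat \<Rightarrow> complex ^ 'n \<Rightarrow> real" where
  "mean n c = (LINT t|P n. cmod (bdot c (x t)))"

lemma integrable_bdot: "integrable (P n) (\<lambda>t. bdot c (x t))"
proof -
  interpret prob_space "P n" by (rule prob_P)
  show ?thesis
    by (rule integrable_of_AE_bounded[of _ "real CARD('n) * norm c"])
       (auto intro!: AE_I2 norm_bdot_le x_torus simp: space_P)
qed

lemma mean_bound: "\<bar>mean n c\<bar> \<le> real CARD('n) * norm c"
proof -
  interpret prob_space "P n" by (rule prob_P)
  have "mean n c \<le> real CARD('n) * norm c"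
    unfolding mean_def using integrable_bdot
    by (intro integral_le_const) (auto intro!: AE_I2 norm_bdot_le x_torus simp: space_P)
  moreover have "0 \<le> mean n c" by (simp add: mean_def)
  ultimately show ?thesis by simp
qed

lemma mean_lipschitz: "\<bar>mean n c - mean n c'\<bar> \<le> mean n (c - c')"
proof -
  have "\<bar>mean n c - mean n c'\<bar> = \<bar>LINT t|P n. cmod (bdot c (x t)) - cmod (bdot c' (x t))\<bar>"
    unfolding mean_def using integrable_bdot by simp
  also have "\<dots> \<le> (LINT t|P n. \<bar>cmod (bdot c (x t)) - cmod (bdot c' (x t))\<bar>)"
    by (rule integral_abs_bound)
  also have "\<dots> \<le> (LINT t|P n. cmod (bdot (c - c') (x t)))"
  proof (rule integral_mono)
    show "integrable (P n) (\<lambda>t. \<bar>cmod (bdot c (x t)) - cmod (bdot c' (x t))\<bar>)"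
      using integrable_bdot by auto
    show "integrable (P n) (\<lambda>t. cmod (bdot (c - c') (x t)))" using integrable_bdot by auto
    show "\<bar>cmod (bdot c (x t)) - cmod (bdot c' (x t))\<bar> \<le> cmod (bdot (c - c') (x t))" for t
      unfolding bdot_diff[symmetric] by (rule norm_triangle_ineq3)
  qed
  finally show ?thesis by (simp add: mean_def)
qed

text \<open>
  The means are Lipschitz in \<open>c\<close>, uniformly in \<open>n\<close>, so asymptotic invariance passes from \<open>H\<close> to its
  closure.
\<close>

lemma mean_shift_closure:
  assumes shift: "\<And>s. s \<in> H \<Longrightarrow> (\<lambda>n. mean n (c * s) - mean n c) \<longlonglongrightarrow> 0" and g: "g \<in> closure H"
  shows "(\<lambda>n. mean n (c * g) - mean n c) \<longlonglongrightarrow> 0"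
proof (rule tendstoI)
  fix e :: real assume e: "0 < e"
  obtain s where s: "\<And>k. s k \<in> H" "s \<longlonglongrightarrow> g" using g closure_sequential by blast
  have "continuous_on UNIV (\<lambda>z. c * z)" by (intro continuous_on_vec_mult continuous_intros)
  then have "(\<lambda>k. c * s k) \<longlonglongrightarrow> c * g"
    using s(2) by (auto simp: continuous_on_eq_continuous_at intro: isCont_tendsto_compose)
  then have "(\<lambda>k. real CARD('n) * norm (c * g - c * s k)) \<longlonglongrightarrow> real CARD('n) * norm (c * g - c * g)"
    by (intro tendsto_intros)
  then have "\<forall>\<^sub>F k in sequentially. real CARD('n) * norm (c * g - c * s k) < e / 2"
    by (rule order_tendstoD(2)) (use e in simp)
  then obtain k where k: "real CARD('n) * norm (c * g - c * s k) < e / 2"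
    by (auto simp: eventually_sequentially)
  have "\<forall>\<^sub>F n in sequentially. \<bar>mean n (c * s k) - mean n c\<bar> < e / 2"
    using tendstoD[OF shift[OF s(1)[of k]], of "e / 2"] e by (simp add: dist_real_def)
  then show "\<forall>\<^sub>F n in sequentially. dist (mean n (c * g) - mean n c) 0 < e"
  proof eventually_elim
    case (elim n)
    have "\<bar>mean n (c * g) - mean n (c * s k)\<bar> < e / 2"
      using mean_lipschitz[of n "c * g" "c * s k"] mean_bound[of n "c * g - c * s k"] k by linarith
    then show ?case using elim unfolding dist_real_def by linarith
  qed
qed

lemma mean_tendsto_l1_dual:
  assumes H: "torus_subgroup H" and G: "G = closure H" and x: "\<And>t. t \<in> space T \<Longrightarrow> x t \<in> H"
    and haar: "haar_prob (mult_group_on G) (top_of_set G) \<mu>"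
    and shift: "\<And>s. s \<in> H \<Longrightarrow> (\<lambda>n. mean n (c * s) - mean n c) \<longlonglongrightarrow> 0"
  shows "(\<lambda>n. mean n c) \<longlonglongrightarrow> l1_dual \<mu> (\<lambda>j z. z $ j) c"
proof -
  interpret H: torus_subgroup H by (rule H)
  interpret haar_group "mult_group_on G" "top_of_set G" \<mu>
    unfolding haar_group_def haar_group_axioms_def using H.compact_group_closure haar G by blast
  have sp: "space \<mu> = G" by (simp add: space_haar mult_group_on_def)
  have xG: "x t \<in> G" if "t \<in> space T" for t using x[OF that] closure_subset G by blast
  have GT: "z \<in> torus" if "z \<in> G" for z using that G H.closure_sub by blast
  have id_meas [measurable]: "(\<lambda>z. z) \<in> borel_measurable \<mu>"
    by (rule continuous_imp_measurable) (simp add: continuous_map_id_subt)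
  have mult_meas: "(\<lambda>(u, v). u * v) \<in> borel_measurable (borel \<Otimes>\<^sub>M (borel :: (complex ^ 'n) measure))"
    unfolding borel_prod case_prod_beta
    by (intro borel_measurable_continuous_onI continuous_on_vec_mult continuous_intros)
  show ?thesis
  proof (rule tendsto_average_of_approx_invariant[where P = P and T = T and \<mu> = \<mu> and
        h = "\<lambda>t g. cmod (bdot c (g * x t))" and B = "real CARD('n) * norm c"])
    show "(\<lambda>(t, g). cmod (bdot c (g * x t))) \<in> borel_measurable (T \<Otimes>\<^sub>M \<mu>)"
    proof -
      note x_meas [measurable]
      have "(\<lambda>p. (snd p, x (fst p))) \<in> measurable (T \<Otimes>\<^sub>M \<mu>) (borel \<Otimes>\<^sub>M borel)"
        by measurable
      from measurable_compose[OF this mult_meas] have [measurable]: "(\<lambda>p. snd p * x (fst p)) \<in> borel_measurable (T \<Otimes>\<^sub>M \<mu>)"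
        by simp
      show ?thesis unfolding case_prod_beta by measurable
    qed
    show "\<bar>cmod (bdot c (g * x t))\<bar> \<le> real CARD('n) * norm c" if "t \<in> space T" "g \<in> space \<mu>" for t g
      using that GT[OF xG] GT[of g] by (simp add: sp) (intro norm_bdot_le, simp add: torus_def circle_def norm_mult)
    show "(LINT g|\<mu>. cmod (bdot c (g * x t))) = l1_dual \<mu> (\<lambda>j z. z $ j) c" if "t \<in> space T" for t
    proof -
      have "(\<lambda>z. cmod (bdot c z)) \<in> borel_measurable \<mu>" by measurable
      then have "(LINT g|\<mu>. cmod (bdot c (x t * g))) = (LINT g|\<mu>. cmod (bdot c g))"
        using integral_translation[of "x t" "\<lambda>z. cmod (bdot c z)"] xG[OF that] by (simp add: mult_group_on_def)
      then show ?thesis by (simp add: mult.commute l1_dual_def bdot_def)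
    qed
    show "(\<lambda>n. (LINT t|P n. cmod (bdot c (g * x t))) - mean n c) \<longlonglongrightarrow> 0" if "g \<in> space \<mu>" for g
    proof -
      have "(\<lambda>n. mean n (c * g) - mean n c) \<longlonglongrightarrow> 0"
        by (rule mean_shift_closure[OF shift]) (use that in \<open>auto simp: sp G\<close>)
      then show ?thesis by (simp add: mean_def[of _ "c * g"] bdot_mult)
    qed
  qed (use prob_P sets_P mean_bound prob_space_axioms in auto)
qed

text \<open>
  The set \<open>S\<close> is the initial segment on which \<open>e\<close> may be large; the laws do not charge it in the limit.
\<close>

lemma norm_cdot_le_of_means:
  fixes a :: "complex ^ 'n"
  assumes int: "\<And>n. integrable (P n) e"
    and coeff: "\<And>j. (\<lambda>n. LINT t|P n. e t * cnj (x t $ j)) \<longlonglongrightarrow> a $ j"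
    and mean: "(\<lambda>n. mean n c) \<longlonglongrightarrow> l"
    and tail: "\<And>M. A < M \<Longrightarrow> \<exists>S\<in>sets T. (\<forall>n. AE t in P n. t \<notin> S \<longrightarrow> cmod (e t) \<le> M) \<and>
        (\<lambda>n. LINT t|P n. indicator S t * cmod (e t)) \<longlonglongrightarrow> 0"
    and A: "0 \<le> A"
  shows "cmod (cdot a c) \<le> A * l"
proof -
  have e_meas [measurable]: "e \<in> borel_measurable (P n)" for n using int by auto
  define C where "C = real CARD('n) * norm c"
  have lim: "(\<lambda>n. LINT t|P n. e t * cnj (bdot c (x t))) \<longlonglongrightarrow> cdot a c"
  proof -
    have int_j: "integrable (P n) (\<lambda>t. e t * cnj (x t $ j))" for n j
    proof (rule Bochner_Integration.integrable_bound[OF int[of n]])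
      have "(\<lambda>z::complex ^ 'n. z $ j) \<in> borel_measurable borel"
        by (intro borel_measurable_continuous_onI continuous_intros)
      then have [measurable]: "(\<lambda>t. x t $ j) \<in> borel_measurable (P n)"
        using x_meas_P measurable_compose by blast
      show "(\<lambda>t. e t * cnj (x t $ j)) \<in> borel_measurable (P n)" by measurable
      show "AE t in P n. norm (e t * cnj (x t $ j)) \<le> norm (e t)"
        using x_torus by (auto intro!: AE_I2 simp: space_P norm_mult torus_def circle_def)
    qed
    have "(LINT t|P n. e t * cnj (bdot c (x t))) = (\<Sum>j\<in>UNIV. (LINT t|P n. e t * cnj (x t $ j)) * cnj (c $ j))" for n
    proof -
      have "(LINT t|P n. e t * cnj (bdot c (x t))) = (LINT t|P n. (\<Sum>j\<in>UNIV. e t * cnj (x t $ j) * cnj (c $ j)))"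
        by (simp add: bdot_def sum_distrib_left mult_ac)
      also have "\<dots> = (\<Sum>j\<in>UNIV. (LINT t|P n. e t * cnj (x t $ j) * cnj (c $ j)))"
        by (intro Bochner_Integration.integral_sum integrable_mult_left int_j)
      finally show ?thesis by simp
    qed
    moreover have "(\<lambda>n. \<Sum>j\<in>UNIV. (LINT t|P n. e t * cnj (x t $ j)) * cnj (c $ j)) \<longlonglongrightarrow> cdot a c"
      unfolding cdot_def by (intro tendsto_intros coeff)
    ultimately show ?thesis by simp
  qed
  have crude: "cmod (bdot c (x t)) * cmod (e t) \<le> C * cmod (e t)" if "t \<in> space T" for t
    using norm_bdot_le[of "x t" c] x_torus[OF that] by (intro mult_right_mono) (auto simp: C_def)
  have le: "cmod (cdot a c) \<le> M * l" if M: "A < M" for M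
  proof -
    obtain S where S: "S \<in> sets T" "\<And>n. AE t in P n. t \<notin> S \<longrightarrow> cmod (e t) \<le> M"
        and S0: "(\<lambda>n. LINT t|P n. indicator S t * cmod (e t)) \<longlonglongrightarrow> 0"
      using tail[OF M] by blast
    have [measurable]: "S \<in> sets (P n)" for n using S(1) sets_P by blast
    have "cmod (LINT t|P n. e t * cnj (bdot c (x t))) \<le>
        C * (LINT t|P n. indicator S t * cmod (e t)) + M * mean n c" for n
    proof -
      have int_S: "integrable (P n) (\<lambda>t. indicator S t * cmod (e t))"
        by (rule Bochner_Integration.integrable_bound[OF int[of n]]) (auto simp: indicator_def)
      have "cmod (LINT t|P n. e t * cnj (bdot c (x t))) \<le> (LINT t|P n. cmod (e t * cnj (bdot c (x t))))"
        by (rule integral_norm_bound)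
      also have "\<dots> \<le> (LINT t|P n. C * (indicator S t * cmod (e t)) + M * cmod (bdot c (x t)))"
      proof (rule integral_mono_AE)
        show "integrable (P n) (\<lambda>t. C * (indicator S t * cmod (e t)) + M * cmod (bdot c (x t)))"
          using int_S integrable_bdot by auto
        have "integrable (P n) (\<lambda>t. C * cmod (e t))" using int by auto
        then have "integrable (P n) (\<lambda>t. e t * cnj (bdot c (x t)))"
        proof (rule Bochner_Integration.integrable_bound)
          show "AE t in P n. norm (e t * cnj (bdot c (x t))) \<le> norm (C * cmod (e t))"
            by (rule AE_I2) (use crude in \<open>simp add: norm_mult space_P mult.commute C_def\<close>)
        qed measurable
        then show "integrable (P n) (\<lambda>t. cmod (e t * cnj (bdot c (x t))))" by auto
        show "AE t in P n. cmod (e t * cnj (bdot c (x t))) \<le> C * (indicator S t * cmod (e t)) + M * cmod (bdot c (x t))"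
          using S(2)[of n] AE_space
        proof eventually_elim
          case (elim t)
          show ?case
          proof (cases "t \<in> S")
            case True
            have "cmod (bdot c (x t)) * cmod (e t) \<le> C * cmod (e t)"
              using crude elim(2) by (simp add: space_P)
            moreover have "0 \<le> M * cmod (bdot c (x t))" using M A by simp
            ultimately show ?thesis using True by (simp add: norm_mult mult.commute)
          next
            case False
            then show ?thesis using elim by (auto simp: norm_mult intro: mult_right_mono)
          qed
        qed
      qed
      also have "\<dots> = C * (LINT t|P n. indicator S t * cmod (e t)) + M * mean n c"
        using int_S integrable_bdot by (simp add: mean_def)
      finally show ?thesis .
    qed
    moreover have "(\<lambda>n. C * (LINT t|P n. indicator S t * cmod (e t)) + M * mean n c) \<longlonglongrightarrow> C * 0 + M * l"
      by (intro tendsto_intros S0 mean)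
    ultimately show ?thesis
      using LIMSEQ_le[OF tendsto_norm[OF lim]] by force
  qed
  have "(\<lambda>n. (A + 1 / real (Suc n)) * l) \<longlonglongrightarrow> (A + 0) * l"
    by (intro tendsto_intros LIMSEQ_Suc[OF lim_1_over_n])
  then show ?thesis
    using LIMSEQ_le_const[of _ "(A + 0) * l" "cmod (cdot a c)"] le by force
qed

end

section \<open>Half-line errors\<close>

text \<open>
  The law whose expectations are the continuous Abel means. It lives on the Lebesgue sets because a
  half-line error is only Lebesgue measurable.
\<close>

definition exp_law :: "real \<Rightarrow> real measure" where
  "exp_law \<epsilon> = density lebesgue (\<lambda>t. ennreal (exponential_density \<epsilon> t))"

lemma sets_exp_law [simp]: "sets (exp_law \<epsilon>) = sets lebesgue"
  by (simp add: exp_law_def)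

lemma exponential_density_measurable [measurable]: "exponential_density \<epsilon> \<in> borel_measurable borel"
  by (rule borel_measurable_erlang_density)

lemma prob_space_exp_law:
  assumes "0 < \<epsilon>"
  shows "prob_space (exp_law \<epsilon>)"
proof
  interpret E: prob_space "density lborel (exponential_density \<epsilon>)"
    by (rule prob_space_exponential_density[OF assms])
  have "emeasure (exp_law \<epsilon>) (space (exp_law \<epsilon>)) = (\<integral>\<^sup>+ t. ennreal (exponential_density \<epsilon> t) \<partial>lebesgue)"
    by (simp add: exp_law_def emeasure_density measurable_completion cong: nn_integral_cong)
  also have "\<dots> = (\<integral>\<^sup>+ t. ennreal (exponential_density \<epsilon> t) \<partial>lborel)"
    by (simp add: nn_integral_completion)
  also have "\<dots> = 1"
    using E.emeasure_space_1 by (simp add: emeasure_density)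
  finally show "emeasure (exp_law \<epsilon>) (space (exp_law \<epsilon>)) = 1" .
qed

lemma exp_law_integral:
  fixes f :: "real \<Rightarrow> 'b::{banach, second_countable_topology}"
  assumes "0 < \<epsilon>" "f \<in> borel_measurable lebesgue"
  shows "(LINT t|exp_law \<epsilon>. f t) = (LINT t|lebesgue. exponential_density \<epsilon> t *\<^sub>R f t)"
    and "integrable (exp_law \<epsilon>) f \<longleftrightarrow> integrable lebesgue (\<lambda>t. exponential_density \<epsilon> t *\<^sub>R f t)"
  unfolding exp_law_def
  by (subst integral_density integrable_density;
      use assms exponential_density_nonneg in \<open>auto simp: measurable_completion\<close>)+

text \<open>
  With \<open>k\<close> the exponential density, the difference is \<open>\<integral> (k (u - s) - k u) \<psi> u du\<close>. The bracket is
  negative only on \<open>[0, s]\<close>, where it is at least \<open>- \<epsilon>\<close>. As both densities have integral 1, its \<open>L\<^sup>1\<close> norm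
  is twice the integral of its negative part.
\<close>

lemma exp_law_translate:
  fixes \<psi> :: "real \<Rightarrow> real"
  assumes eps: "0 < \<epsilon>" and s: "0 \<le> s" and [measurable]: "\<psi> \<in> borel_measurable borel"
    and B: "\<And>t. \<bar>\<psi> t\<bar> \<le> B"
  shows "\<bar>(LINT t|exp_law \<epsilon>. \<psi> (t + s)) - (LINT t|exp_law \<epsilon>. \<psi> t)\<bar> \<le> 2 * B * s * \<epsilon>"
proof -
  let ?k = "exponential_density \<epsilon>"
  interpret E: prob_space "density lborel ?k"
    by (rule prob_space_exponential_density[OF eps])
  have k_int: "integrable lborel ?k" and k1: "(LINT t|lborel. ?k t) = 1"
  proof -
    have "integrable (density lborel ?k) (\<lambda>_. 1::real)" by simp
    then show "integrable lborel ?k"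
      by (subst (asm) integrable_density) (use eps in \<open>auto intro: exponential_density_nonneg\<close>)
    have "(LINT t|density lborel ?k. (1::real)) = 1" using E.prob_space by simp
    then show "(LINT t|lborel. ?k t) = 1"
      by (subst (asm) integral_density) (use eps in \<open>auto intro: exponential_density_nonneg\<close>)
  qed
  have law: "(LINT t|exp_law \<epsilon>. f t) = (LINT t|lborel. ?k t * f t)" if [measurable]: "f \<in> borel_measurable borel" for f :: "real \<Rightarrow> real"
    using exp_law_integral(1)[OF eps, of f] that by (simp add: measurable_completion integral_completion)
  have ks_int: "integrable lborel (\<lambda>u. ?k (u - s))"
    using lborel_integrable_real_affine[OF k_int, of 1 "- s"] by simp
  have ks1: "(LINT u|lborel. ?k (u - s)) = 1"
    using lborel_integral_real_affine[of 1 ?k "- s"] k1 by simp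
  have B0: "0 \<le> B" using B[of 0] by simp
  have int_mult: "integrable lborel (\<lambda>u. f u * \<psi> u)" if f: "integrable lborel f" for f :: "real \<Rightarrow> real"
  proof (rule Bochner_Integration.integrable_bound)
    show "integrable lborel (\<lambda>u. B * f u)" using f by simp
    show "AE u in lborel. norm (f u * \<psi> u) \<le> norm (B * f u)"
      using B B0 by (auto simp: abs_mult mult.commute[of B] intro!: mult_left_mono)
    show "(\<lambda>u. f u * \<psi> u) \<in> borel_measurable lborel" using f by auto
  qed
  have "(LINT t|exp_law \<epsilon>. \<psi> (t + s)) = (LINT t|lborel. ?k t * \<psi> (t + s))" by (rule law) simp
  also have "\<dots> = (LINT u|lborel. ?k (u - s) * \<psi> u)"
    using lborel_integral_real_affine[of 1 "\<lambda>t. ?k t * \<psi> (t + s)" "- s"] by simp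
  finally have "(LINT t|exp_law \<epsilon>. \<psi> (t + s)) - (LINT t|exp_law \<epsilon>. \<psi> t) =
      (LINT u|lborel. ?k (u - s) * \<psi> u) - (LINT u|lborel. ?k u * \<psi> u)" by (simp add: law)
  also have "\<dots> = (LINT u|lborel. (?k (u - s) - ?k u) * \<psi> u)"
    using int_mult[OF ks_int] int_mult[OF k_int] by (simp add: left_diff_distrib)
  also have "\<bar>\<dots>\<bar> \<le> (LINT u|lborel. \<bar>(?k (u - s) - ?k u) * \<psi> u\<bar>)" by (rule integral_abs_bound)
  also have "\<dots> \<le> (LINT u|lborel. B * (?k (u - s) - ?k u + 2 * \<epsilon> * indicator {0..s} u))"
  proof (rule integral_mono)
    show "integrable lborel (\<lambda>u. \<bar>(?k (u - s) - ?k u) * \<psi> u\<bar>)"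
      by (intro integrable_abs int_mult Bochner_Integration.integrable_diff ks_int k_int)
    show "integrable lborel (\<lambda>u. B * (?k (u - s) - ?k u + 2 * \<epsilon> * indicator {0..s} u))"
      by (intro integrable_mult_right Bochner_Integration.integrable_add Bochner_Integration.integrable_diff
          ks_int k_int integrable_real_indicator) (simp_all add: emeasure_lborel_Icc_eq)
    fix u
    have "\<bar>?k (u - s) - ?k u\<bar> \<le> ?k (u - s) - ?k u + 2 * \<epsilon> * indicator {0..s} u"
    proof (cases "u - s < 0")
      case True
      have "?k u \<le> \<epsilon>" if "0 \<le> u" using that eps by (simp add: exponential_density_def)
      moreover have "0 \<le> ?k u" using eps by (rule exponential_density_nonneg)
      ultimately show ?thesis using True by (auto simp: exponential_density_def[of \<epsilon> "u - s"] indicator_def) (auto simp: exponential_density_def)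
    next
      case False
      then have "?k u \<le> ?k (u - s)"
        using s eps mult_nonneg_nonneg[of s \<epsilon>] by (simp add: exponential_density_def algebra_simps)
      then show ?thesis using eps by (simp add: indicator_def)
    qed
    then have "\<bar>?k (u - s) - ?k u\<bar> * \<bar>\<psi> u\<bar> \<le> (?k (u - s) - ?k u + 2 * \<epsilon> * indicator {0..s} u) * B"
      using B[of u] by (intro mult_mono) auto
    then show "\<bar>(?k (u - s) - ?k u) * \<psi> u\<bar> \<le> B * (?k (u - s) - ?k u + 2 * \<epsilon> * indicator {0..s} u)"
      by (simp add: abs_mult mult.commute)
  qed
  also have "\<dots> = B * (2 * \<epsilon> * s)"
    using ks_int k_int s by (simp add: ks1 k1)
  finally show ?thesis by (simp add: mult_ac)
qed

lemma cis_power_torus: "(\<chi> j. cis (f j)) \<in> torus"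
  by (simp add: torus_def circle_def)

lemma vcnj_cis: "vcnj (\<chi> j. cis (f j)) = (\<chi> j. cis (- f j))"
  by (simp add: vcnj_def vec_eq_iff cis_cnj)

definition line_flow :: "('n \<Rightarrow> real) \<Rightarrow> real \<Rightarrow> complex ^ 'n" where
  "line_flow \<gamma> y = (\<chi> j. cis (\<gamma> j * y))"

lemma line_flow_add: "line_flow \<gamma> (s + t) = line_flow \<gamma> s * line_flow \<gamma> t"
  by (simp add: line_flow_def vec_eq_iff cis_mult distrib_left)

lemma line_flow_0: "line_flow \<gamma> 0 = 1"
  by (simp add: line_flow_def vec_eq_iff)

lemma line_flow_torus: "line_flow \<gamma> y \<in> torus"
  unfolding line_flow_def by (rule cis_power_torus)

lemma line_flow_measurable [measurable]: "line_flow \<gamma> \<in> borel_measurable borel"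
  unfolding line_flow_def[abs_def] by (intro borel_measurable_continuous_onI continuous_intros)

lemma torus_subgroup_line: "torus_subgroup (range (line_flow \<gamma>))"
proof
  show "range (line_flow \<gamma>) \<subseteq> torus" using line_flow_torus by auto
  show "1 \<in> range (line_flow \<gamma>)" using line_flow_0[of \<gamma>] by (metis rangeI)
  show "x * y \<in> range (line_flow \<gamma>)" if "x \<in> range (line_flow \<gamma>)" "y \<in> range (line_flow \<gamma>)" for x y
    using that by (auto simp flip: line_flow_add)
  show "vcnj x \<in> range (line_flow \<gamma>)" if "x \<in> range (line_flow \<gamma>)" for x
  proof -
    obtain y where "x = line_flow \<gamma> y" using \<open>x \<in> range (line_flow \<gamma>)\<close> by blast
    then have "vcnj x = line_flow \<gamma> (- y)" by (simp add: line_flow_def vcnj_cis)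
    then show ?thesis by simp
  qed
qed

lemma cont_orbit_eq: "cont_orbit \<gamma> = closure (range (line_flow \<gamma>))"
  by (simp add: cont_orbit_def line_flow_def[abs_def])

lemma line_flow_separates:
  assumes "inj \<gamma>" "i \<noteq> j"
  shows "\<exists>z\<in>range (line_flow \<gamma>). z $ i \<noteq> z $ j"
proof -
  have ne: "\<gamma> i - \<gamma> j \<noteq> 0" using assms by (auto dest: injD)
  define y where "y = pi / (\<gamma> i - \<gamma> j)"
  have eq: "\<gamma> i * y = pi + \<gamma> j * y" using ne by (simp add: y_def field_simps)
  have "cis (\<gamma> i * y) = - cis (\<gamma> j * y)" unfolding eq by (simp flip: cis_mult)
  then have "line_flow \<gamma> y $ i \<noteq> line_flow \<gamma> y $ j" by (simp add: line_flow_def)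
  then show ?thesis by blast
qed

text \<open>
  The essential suprema over \<open>[Y, \<infinity>)\<close> decrease in \<open>Y\<close>, even where \<open>F\<close> fails to be measurable, since the
  essential supremum of a nonmeasurable function is \<open>\<infinity>\<close>. Hence the tail amplitude is their infimum.
\<close>

lemma half_line_tail:
  assumes "cont_tail_amplitude F < M"
  shows "\<exists>Y. 0 \<le> Y \<and> (AE t in lebesgue. Y \<le> t \<longrightarrow> ennreal (cmod (F t)) \<le> M)"
proof -
  let ?g = "\<lambda>Y. esssup (lebesgue_on {Y..}) (\<lambda>y. ennreal (cmod (F y)))"
  have anti: "?g Y' \<le> ?g Y" if "Y \<le> Y'" for Y Y'
  proof (cases "(\<lambda>y. ennreal (cmod (F y))) \<in> borel_measurable (lebesgue_on {Y..})")
    case True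
    have sub: "{Y'..} \<subseteq> {Y..}" using that by auto
    have meas: "(\<lambda>y. ennreal (cmod (F y))) \<in> borel_measurable (lebesgue_on {Y'..})"
      using measurable_restrict_mono[OF True sub] .
    have "AE y in lebesgue_on {Y..}. ennreal (cmod (F y)) \<le> ?g Y" by (rule esssup_AE)
    then have "AE y in lebesgue. y \<in> {Y..} \<longrightarrow> ennreal (cmod (F y)) \<le> ?g Y"
      by (subst (asm) AE_restrict_space_iff) auto
    then have "AE y in lebesgue_on {Y'..}. ennreal (cmod (F y)) \<le> ?g Y"
      by (subst AE_restrict_space_iff) (use sub in \<open>auto elim!: eventually_mono\<close>)
    then show ?thesis by (rule esssup_I[OF meas])
  qed (simp add: esssup_non_measurable)
  have lim: "(?g \<longlongrightarrow> (INF Y. ?g Y)) at_top"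
  proof (rule decreasing_tendsto)
    show "\<forall>\<^sub>F Y in at_top. (INF Y. ?g Y) \<le> ?g Y" by (intro always_eventually allI INF_lower) simp
    fix z assume "(INF Y. ?g Y) < z"
    then obtain Y where Y: "?g Y < z" by (auto simp: INF_less_iff)
    show "\<forall>\<^sub>F Y in at_top. ?g Y < z"
      using eventually_ge_at_top[of Y] by eventually_elim (rule le_less_trans[OF anti Y])
  qed
  then have "cont_tail_amplitude F = (INF Y. ?g Y)"
    unfolding cont_tail_amplitude_def by (intro tendsto_Lim) simp_all
  then obtain Y where Y: "?g Y < M" using assms by (auto simp: INF_less_iff)
  have "AE y in lebesgue_on {max 0 Y..}. ennreal (cmod (F y)) \<le> ?g (max 0 Y)" by (rule esssup_AE)
  then have "AE y in lebesgue. y \<in> {max 0 Y..} \<longrightarrow> ennreal (cmod (F y)) \<le> ?g (max 0 Y)"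
    by (subst (asm) AE_restrict_space_iff) auto
  then have "AE y in lebesgue. max 0 Y \<le> y \<longrightarrow> ennreal (cmod (F y)) \<le> M"
    by eventually_elim (use Y anti[of Y "max 0 Y"] in \<open>auto intro: order_trans\<close>)
  then show ?thesis by (intro exI[of _ "max 0 Y"]) simp
qed

lemma half_line_bound:
  fixes a :: "complex ^ 'n"
  assumes F: "half_line_error F" and coeff: "\<And>j. has_cont_abel_coeff F (\<gamma> j) (a $ j)"
    and tail: "cont_tail_amplitude F \<le> ennreal A" and A: "0 \<le> A"
    and haar: "haar_prob (mult_group_on (cont_orbit \<gamma>)) (top_of_set (cont_orbit \<gamma>)) \<mu>"
  shows "cmod (cdot a c) \<le> A * l1_dual \<mu> (\<lambda>j z. z $ j) c"
proof -
  \<comment> \<open>The Abel limits are sampled along a sequence, as dominated convergence requires.\<close>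
  define eps where "eps n = 1 / real (Suc n)" for n
  have eps_pos: "0 < eps n" for n by (simp add: eps_def)
  have eps_nz: "eps n \<noteq> 0" for n by (simp add: eps_def)
  have eps_lim: "eps \<longlonglongrightarrow> 0" unfolding eps_def by (rule LIMSEQ_Suc[OF lim_1_over_n])
  have eps_at: "filterlim eps (at_right 0) sequentially"
    using eps_lim eps_pos eps_nz by (simp add: filterlim_at)
  \<comment> \<open>Nothing is known about \<open>F\<close> at negative arguments, not even measurability.\<close>
  define e where "e t = indicator {0..} t *\<^sub>R F t" for t
  have int_w: "set_integrable lebesgue {0..} (\<lambda>y. cmod (F y) * exp (- \<epsilon> * y))" if "0 < \<epsilon>" for \<epsilon>
    using F that by (simp add: half_line_error_def)
  have int_loc: "set_integrable lebesgue {0..T} F" for T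
    using F by (simp add: half_line_error_def)
  have e_meas [measurable]: "e \<in> borel_measurable lebesgue"
  proof (rule borel_measurable_LIMSEQ_metric[where f = "\<lambda>i t. indicator {0..real i} t *\<^sub>R F t"])
    show "(\<lambda>t. indicator {0..real i} t *\<^sub>R F t) \<in> borel_measurable lebesgue" for i
      using int_loc[of "real i"] unfolding set_integrable_def by auto
    fix t :: real
    obtain N :: nat where N: "t \<le> real N" using real_arch_simple by blast
    have "indicator {0..real i} t *\<^sub>R F t = e t" if "i \<ge> N" for i
      using that N by (auto simp: e_def indicator_def)
    then show "(\<lambda>i. indicator {0..real i} t *\<^sub>R F t) \<longlonglongrightarrow> e t"
      by (intro tendsto_eventually) (auto simp: eventually_sequentially)
  qed
  interpret torus_sampling "\<lambda>n. exp_law (eps n)" lebesgue "line_flow \<gamma>"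
    by (intro torus_sampling.intro prob_space_exp_law eps_pos sets_exp_law line_flow_torus)
       (rule measurable_completion, simp)
  have kern: "exponential_density (eps n) t *\<^sub>R (e t) = eps n *\<^sub>R (indicator {0..} t *\<^sub>R (F t * of_real (exp (- eps n * t))))" for n t
    by (auto simp: exponential_density_def e_def indicator_def scaleR_conv_of_real mult_ac)
  have int_Fw: "integrable lebesgue (\<lambda>t. indicator {0..} t *\<^sub>R (F t * of_real (exp (- eps n * t))))" for n
  proof (rule Bochner_Integration.integrable_bound)
    show "integrable lebesgue (\<lambda>y. indicator {0..} y *\<^sub>R (cmod (F y) * exp (- eps n * y)))"
      using int_w[OF eps_pos] by (simp add: set_integrable_def)
    have "(\<lambda>t. e t * of_real (exp (- eps n * t))) \<in> borel_measurable lebesgue"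
      by (intro borel_measurable_times e_meas measurable_completion) measurable
    then show "(\<lambda>t. indicator {0..} t *\<^sub>R (F t * of_real (exp (- eps n * t)))) \<in> borel_measurable lebesgue"
      by (simp add: e_def)
  qed (auto simp: norm_mult)
  have int_e: "integrable (exp_law (eps n)) e" for n
    using int_Fw[of n] by (subst exp_law_integral(2)[OF eps_pos e_meas]) (simp only: kern integrable_scaleR_right)
  show ?thesis
  proof (rule norm_cdot_le_of_means[OF int_e _ _ _ A])
    fix j
    have "(LINT t|exp_law (eps n). e t * cnj (line_flow \<gamma> t $ j)) =
       of_real (eps n) * (LINT y:{0..}|lebesgue. F y * of_real (exp (- eps n * y)) * cis (- \<gamma> j * y))" for n
    proof -
      have [measurable]: "(\<lambda>t. e t * cnj (line_flow \<gamma> t $ j)) \<in> borel_measurable lebesgue"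
      proof -
        have "(\<lambda>t. cnj (cis (\<gamma> j * t))) \<in> borel_measurable borel"
          by (intro borel_measurable_continuous_onI continuous_intros)
        then show ?thesis
          unfolding line_flow_def by (intro borel_measurable_times e_meas measurable_completion) simp
      qed
      have "(LINT t|exp_law (eps n). e t * cnj (line_flow \<gamma> t $ j)) =
         (LINT t|lebesgue. exponential_density (eps n) t *\<^sub>R (e t * cnj (line_flow \<gamma> t $ j)))"
        by (rule exp_law_integral(1)[OF eps_pos]) measurable
      also have "\<dots> = (LINT t|lebesgue. of_real (eps n) * (indicator {0..} t *\<^sub>R (F t * of_real (exp (- eps n * t)) * cis (- \<gamma> j * t))))"
        by (intro Bochner_Integration.integral_cong refl)
           (auto simp: exponential_density_def e_def indicator_def scaleR_conv_of_real line_flow_def cis_cnj mult_ac)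
      finally show ?thesis unfolding integral_mult_right_zero set_lebesgue_integral_def .
    qed
    moreover have "(\<lambda>n. of_real (eps n) * (LINT y:{0..}|lebesgue. F y * of_real (exp (- eps n * y)) * cis (- \<gamma> j * y))) \<longlonglongrightarrow> a $ j"
      using filterlim_compose[OF coeff[of j, unfolded has_cont_abel_coeff_def] eps_at] by simp
    ultimately show "(\<lambda>n. LINT t|exp_law (eps n). e t * cnj (line_flow \<gamma> t $ j)) \<longlonglongrightarrow> a $ j" by simp
  next
    show "(\<lambda>n. mean n c) \<longlonglongrightarrow> l1_dual \<mu> (\<lambda>j z. z $ j) c"
    proof (rule mean_tendsto_l1_dual[OF torus_subgroup_line cont_orbit_eq _ haar])
      \<comment> \<open>Only forward shifts keep the half-line; a backward shift is a forward shift for other coefficients.\<close>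
      have fwd: "(\<lambda>n. mean n (c * line_flow \<gamma> s) - mean n c) \<longlonglongrightarrow> 0" if s: "0 \<le> s" for s c
      proof (rule Lim_null_comparison)
        let ?B = "real CARD('n) * norm c"
        have "\<bar>mean n (c * line_flow \<gamma> s) - mean n c\<bar> \<le> 2 * ?B * s * eps n" for n
        proof -
          have "mean n (c * line_flow \<gamma> s) = (LINT t|exp_law (eps n). cmod (bdot c (line_flow \<gamma> (t + s))))"
            unfolding mean_def bdot_mult by (simp add: line_flow_add mult.commute)
          then show ?thesis
            unfolding mean_def[of n c]
            using exp_law_translate[OF eps_pos s, of "\<lambda>t. cmod (bdot c (line_flow \<gamma> t))" ?B n]
              norm_bdot_le[OF line_flow_torus, of c] by simp
        qed
        then show "\<forall>\<^sub>F n in sequentially. norm (mean n (c * line_flow \<gamma> s) - mean n c) \<le> 2 * ?B * s * eps n" by simp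
        show "(\<lambda>n. 2 * ?B * s * eps n) \<longlonglongrightarrow> 0" by (rule tendsto_mult_right_zero[OF eps_lim])
      qed
      fix z assume "z \<in> range (line_flow \<gamma>)"
      then obtain s where z: "z = line_flow \<gamma> s" by blast
      show "(\<lambda>n. mean n (c * z) - mean n c) \<longlonglongrightarrow> 0"
      proof (cases "0 \<le> s")
        case True
        then show ?thesis using fwd z by simp
      next
        case False
        have "c * line_flow \<gamma> s * line_flow \<gamma> (- s) = c"
          unfolding mult.assoc by (simp flip: line_flow_add add: line_flow_0)
        then have "(\<lambda>n. - (mean n c - mean n (c * line_flow \<gamma> s))) \<longlonglongrightarrow> - 0"
          using fwd[of "- s" "c * line_flow \<gamma> s"] False by (intro tendsto_minus) simp
        then show ?thesis using z by simp
      qed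
    qed auto
  next
    fix M assume M: "A < M"
    then have "cont_tail_amplitude F < ennreal M"
      using tail A by (auto intro: le_less_trans simp: ennreal_less_iff)
    then obtain Y where Y: "0 \<le> Y" "AE t in lebesgue. Y \<le> t \<longrightarrow> ennreal (cmod (F t)) \<le> ennreal M"
      using half_line_tail by blast
    have AE: "AE t in lebesgue. Y \<le> t \<longrightarrow> cmod (F t) \<le> M"
      using Y(2) by eventually_elim (use M A in \<open>auto simp: ennreal_le_iff\<close>)
    let ?K = "LINT t|lebesgue. indicator {0..Y} t *\<^sub>R cmod (F t)"
    have intK: "integrable lebesgue (\<lambda>t. indicator {0..Y} t *\<^sub>R cmod (F t))"
      using int_loc[of Y] set_integrable_norm unfolding set_integrable_def[symmetric] by blast
    show "\<exists>S\<in>sets lebesgue. (\<forall>n. AE t in exp_law (eps n). t \<notin> S \<longrightarrow> cmod (e t) \<le> M) \<and>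
        (\<lambda>n. LINT t|exp_law (eps n). indicator S t * cmod (e t)) \<longlonglongrightarrow> 0"
    proof (intro bexI[of _ "{..Y}"] conjI allI)
      show "AE t in exp_law (eps n). t \<notin> {..Y} \<longrightarrow> cmod (e t) \<le> M" for n
        unfolding exp_law_def
        by (subst AE_density) (use AE A M in \<open>auto simp: measurable_completion e_def indicator_def elim!: eventually_mono\<close>)
      show "(\<lambda>n. LINT t|exp_law (eps n). indicator {..Y} t * cmod (e t)) \<longlonglongrightarrow> 0"
      proof (rule Lim_null_comparison)
        have "\<bar>LINT t|exp_law (eps n). indicator {..Y} t * cmod (e t)\<bar> \<le> eps n * ?K" for n
        proof -
          have meas: "(\<lambda>t. indicator {..Y} t * cmod (e t)) \<in> borel_measurable lebesgue"
            by (intro borel_measurable_times borel_measurable_indicator measurable_compose[OF e_meas borel_measurable_norm]) simp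
          have "(LINT t|exp_law (eps n). indicator {..Y} t * cmod (e t)) =
              (LINT t|lebesgue. exponential_density (eps n) t *\<^sub>R (indicator {..Y} t * cmod (e t)))"
            by (rule exp_law_integral(1)[OF eps_pos meas])
          also have "\<dots> \<le> (LINT t|lebesgue. eps n * (indicator {0..Y} t *\<^sub>R cmod (F t)))"
          proof (rule integral_mono')
            show "integrable lebesgue (\<lambda>t. eps n * (indicator {0..Y} t *\<^sub>R cmod (F t)))" using intK by simp
            show "exponential_density (eps n) t *\<^sub>R (indicator {..Y} t * cmod (e t)) \<le> eps n * (indicator {0..Y} t *\<^sub>R cmod (F t))" for t
              using eps_pos[of n] by (auto simp: exponential_density_def e_def indicator_def intro!: mult_left_le_one_le)
            show "0 \<le> eps n * (indicator {0..Y} t *\<^sub>R cmod (F t))" for t using eps_pos[of n] by simp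
          qed
          finally have "(LINT t|exp_law (eps n). indicator {..Y} t * cmod (e t)) \<le> eps n * ?K" by simp
          then show ?thesis by (simp add: abs_of_nonneg)
        qed
        then show "\<forall>\<^sub>F n in sequentially. norm (LINT t|exp_law (eps n). indicator {..Y} t * cmod (e t)) \<le> eps n * ?K" by simp
        show "(\<lambda>n. eps n * ?K) \<longlonglongrightarrow> 0" by (rule tendsto_mult_left_zero[OF eps_lim])
      qed
    qed simp
  qed
qed

section \<open>Sequence errors\<close>

lemma geometric_pmf_integral:
  fixes f :: "nat \<Rightarrow> 'b::{banach, second_countable_topology}"
  assumes p: "0 < p" "p \<le> 1"
  shows "integrable (measure_pmf (geometric_pmf p)) f \<longleftrightarrow> summable (\<lambda>n. norm (((1 - p) ^ n * p) *\<^sub>R f n))" (is ?int)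
    and "summable (\<lambda>n. norm (((1 - p) ^ n * p) *\<^sub>R f n)) \<Longrightarrow>
      (LINT n|geometric_pmf p. f n) = (\<Sum>n. ((1 - p) ^ n * p) *\<^sub>R f n)"
proof -
  have dens: "measure_pmf (geometric_pmf p) = density (count_space UNIV) (\<lambda>n. ennreal ((1 - p) ^ n * p))"
    by (subst measure_pmf_eq_density) (simp add: p)
  have "integrable (measure_pmf (geometric_pmf p)) f \<longleftrightarrow> integrable (count_space UNIV) (\<lambda>n. ((1 - p) ^ n * p) *\<^sub>R f n)"
    unfolding dens by (rule integrable_density) (use p in auto)
  then show ?int by (simp add: integrable_count_space_nat_iff)
  assume sum: "summable (\<lambda>n. norm (((1 - p) ^ n * p) *\<^sub>R f n))"
  have "(LINT n|geometric_pmf p. f n) = (LINT n|count_space UNIV. ((1 - p) ^ n * p) *\<^sub>R f n)"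
    unfolding dens by (rule integral_density) (use p in auto)
  also have "\<dots> = (\<Sum>n. ((1 - p) ^ n * p) *\<^sub>R f n)"
    using sum by (intro integral_count_space_nat) (simp add: integrable_count_space_nat_iff)
  finally show "(LINT n|geometric_pmf p. f n) = (\<Sum>n. ((1 - p) ^ n * p) *\<^sub>R f n)" .
qed

text \<open>
  Splitting off the first term gives \<open>E \<psi>(n) = p \<psi>(0) + (1 - p) E \<psi>(n + 1)\<close>, so the difference of the two
  expectations is \<open>p\<close> times a bounded quantity.
\<close>

lemma geometric_pmf_translate:
  fixes \<psi> :: "nat \<Rightarrow> real"
  assumes p: "0 < p" "p \<le> 1" and B: "\<And>n. \<bar>\<psi> n\<bar> \<le> B"
  shows "\<bar>(LINT n|geometric_pmf p. \<psi> (Suc n)) - (LINT n|geometric_pmf p. \<psi> n)\<bar> \<le> 2 * B * p"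
proof -
  have int: "integrable (geometric_pmf p) f" if "\<And>n. \<bar>f n\<bar> \<le> B" for f :: "nat \<Rightarrow> real"
    using that by (intro measure_pmf.integrable_const_bound[of _ B]) auto
  note sum = int[unfolded geometric_pmf_integral(1)[OF p]]
  have sum0: "summable (\<lambda>n. ((1 - p) ^ n * p) *\<^sub>R \<psi> n)" using sum[OF B] by (rule summable_norm_cancel)
  let ?I = "LINT n|geometric_pmf p. \<psi> n" and ?J = "LINT n|geometric_pmf p. \<psi> (Suc n)"
  have "?I = (\<Sum>n. ((1 - p) ^ n * p) *\<^sub>R \<psi> n)"
    using sum[OF B] by (rule geometric_pmf_integral(2)[OF p])
  also have "\<dots> = p * \<psi> 0 + (\<Sum>n. ((1 - p) ^ Suc n * p) *\<^sub>R \<psi> (Suc n))"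
    using suminf_split_head[OF sum0] by simp
  also have "(\<Sum>n. ((1 - p) ^ Suc n * p) *\<^sub>R \<psi> (Suc n)) = (\<Sum>n. (1 - p) * (((1 - p) ^ n * p) *\<^sub>R \<psi> (Suc n)))"
    by (simp add: mult_ac)
  also have "\<dots> = (1 - p) * ?J"
    using sum[of "\<lambda>n. \<psi> (Suc n)"] B
    by (subst suminf_mult) (auto intro: summable_norm_cancel simp: geometric_pmf_integral(2)[OF p])
  finally have eq: "?J - ?I = p * (?J - \<psi> 0)" by (simp add: algebra_simps)
  have "\<bar>?J\<bar> \<le> B"
  proof -
    have AE: "AE n in geometric_pmf p. \<psi> (Suc n) \<le> B" "AE n in geometric_pmf p. - B \<le> \<psi> (Suc n)"
      using B by (auto simp: abs_le_iff intro!: AE_I2) (smt (verit))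
    show ?thesis
      using measure_pmf.integral_le_const[OF int AE(1)] measure_pmf.integral_ge_const[OF int AE(2)] B
      by (auto simp: abs_le_iff)
  qed
  then have "\<bar>?J - \<psi> 0\<bar> \<le> 2 * B" using B[of 0] by linarith
  then have "p * \<bar>?J - \<psi> 0\<bar> \<le> p * (2 * B)" using p by (intro mult_left_mono) auto
  then show ?thesis unfolding eq using p by (simp add: abs_mult mult_ac)
qed

definition cyclic_flow :: "('n \<Rightarrow> real) \<Rightarrow> int \<Rightarrow> complex ^ 'n" where
  "cyclic_flow \<theta> n = (\<chi> j. cis (of_int n * \<theta> j))"

lemma cyclic_flow_add: "cyclic_flow \<theta> (s + t) = cyclic_flow \<theta> s * cyclic_flow \<theta> t"
  by (simp add: cyclic_flow_def vec_eq_iff cis_mult distrib_right)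

lemma cyclic_flow_0: "cyclic_flow \<theta> 0 = 1"
  by (simp add: cyclic_flow_def vec_eq_iff)

lemma cyclic_flow_torus: "cyclic_flow \<theta> y \<in> torus"
  unfolding cyclic_flow_def by (rule cis_power_torus)

lemma torus_subgroup_cyclic: "torus_subgroup (range (cyclic_flow \<theta>))"
proof
  show "range (cyclic_flow \<theta>) \<subseteq> torus" using cyclic_flow_torus by auto
  show "1 \<in> range (cyclic_flow \<theta>)" using cyclic_flow_0[of \<theta>] by (metis rangeI)
  show "x * y \<in> range (cyclic_flow \<theta>)" if "x \<in> range (cyclic_flow \<theta>)" "y \<in> range (cyclic_flow \<theta>)" for x y
    using that by (auto simp flip: cyclic_flow_add)
  show "vcnj x \<in> range (cyclic_flow \<theta>)" if "x \<in> range (cyclic_flow \<theta>)" for x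
  proof -
    obtain y where "x = cyclic_flow \<theta> y" using \<open>x \<in> range (cyclic_flow \<theta>)\<close> by blast
    then have "vcnj x = cyclic_flow \<theta> (- y)" by (simp add: cyclic_flow_def vcnj_cis)
    then show ?thesis by simp
  qed
qed

lemma disc_orbit_eq: "disc_orbit \<theta> = closure (range (cyclic_flow \<theta>))"
  by (simp add: disc_orbit_def cyclic_flow_def[abs_def])

lemma cyclic_flow_separates:
  assumes "\<not> [\<theta> i = \<theta> j] (rmod 2 * pi)"
  shows "\<exists>z\<in>range (cyclic_flow \<theta>). z $ i \<noteq> z $ j"
proof -
  have "cyclic_flow \<theta> 1 $ i \<noteq> cyclic_flow \<theta> 1 $ j"
    using assms by (simp add: cyclic_flow_def cis_eq_iff)
  then show ?thesis by blast
qed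

lemma sequence_tail:
  assumes "disc_tail_amplitude F < M"
  shows "\<exists>N. \<forall>n\<ge>N. ennreal (cmod (F n)) \<le> M"
proof -
  let ?g = "\<lambda>N. SUP n\<in>{N..}. ennreal (cmod (F n))"
  have "decseq ?g" by (intro decseq_SucI SUP_subset_mono) auto
  then have "?g \<longlonglongrightarrow> (INF N. ?g N)" by (rule LIMSEQ_INF)
  then have "disc_tail_amplitude F = (INF N. ?g N)" unfolding disc_tail_amplitude_def by (rule limI)
  then obtain N where N: "?g N < M" using assms by (auto simp: INF_less_iff)
  have "ennreal (cmod (F n)) \<le> M" if "n \<ge> N" for n
  proof -
    have "ennreal (cmod (F n)) \<le> ?g N" by (rule SUP_upper) (use that in simp)
    with N show ?thesis by simp
  qed
  then show ?thesis by blast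
qed

lemma sequence_bound:
  fixes a :: "complex ^ 'n"
  assumes F: "sequence_error F" and coeff: "\<And>j. has_disc_abel_coeff F (\<theta> j) (a $ j)"
    and tail: "disc_tail_amplitude F \<le> ennreal A" and A: "0 \<le> A"
    and haar: "haar_prob (mult_group_on (disc_orbit \<theta>)) (top_of_set (disc_orbit \<theta>)) \<mu>"
  shows "cmod (cdot a c) \<le> A * l1_dual \<mu> (\<lambda>j z. z $ j) c"
proof -
  \<comment> \<open>The geometric parameter is \<open>1 - \<rho>\<close>; starting at 1/2 keeps \<open>\<rho>\<close> strictly between 0 and 1.\<close>
  define p where "p k = 1 / real (Suc (Suc k))" for k
  have p: "0 < p k" "p k \<le> 1" "p k < 1" for k by (simp_all add: p_def)
  have p_lim: "p \<longlonglongrightarrow> 0" unfolding p_def by (intro LIMSEQ_Suc lim_1_over_n)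
  have "(\<lambda>k. 1 - p k) \<longlonglongrightarrow> 1 - 0" by (intro tendsto_intros p_lim)
  then have rho_at: "filterlim (\<lambda>k. 1 - p k) (at_left 1) sequentially"
    using p by (auto simp: filterlim_at less_imp_neq[symmetric] intro!: always_eventually)
  interpret torus_sampling "\<lambda>k. measure_pmf (geometric_pmf (p k))" "count_space UNIV" "\<lambda>n::nat. cyclic_flow \<theta> (int n)"
    by (intro torus_sampling.intro cyclic_flow_torus measure_pmf.prob_space_axioms) auto
  have sum_F: "summable (\<lambda>n. norm (((1 - p k) ^ n * p k) *\<^sub>R F n))" for k
  proof -
    have "summable (\<lambda>n. cmod (F n) * (1 - p k) ^ n)" using F p[of k] by (simp add: sequence_error_def)
    then have "summable (\<lambda>n. p k * (cmod (F n) * (1 - p k) ^ n))" by (rule summable_mult)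
    then show ?thesis using p[of k] by (simp add: mult_ac)
  qed
  have int_F: "integrable (geometric_pmf (p k)) F" for k
    using sum_F by (simp add: geometric_pmf_integral(1)[OF p(1,2)])
  show ?thesis
  proof (rule norm_cdot_le_of_means[OF int_F _ _ _ A])
    fix j
    have "(LINT n|geometric_pmf (p k). F n * cnj (cyclic_flow \<theta> (int n) $ j)) =
       of_real (1 - (1 - p k)) * (\<Sum>n. F n * of_real ((1 - p k) ^ n) * cis (- real n * \<theta> j))" for k
    proof -
      let ?f = "\<lambda>n. F n * cnj (cyclic_flow \<theta> (int n) $ j)"
      have sum: "summable (\<lambda>n. norm (((1 - p k) ^ n * p k) *\<^sub>R ?f n))"
        using sum_F[of k] by (simp add: norm_mult cyclic_flow_def)
      have "(LINT n|geometric_pmf (p k). ?f n) = (\<Sum>n. ((1 - p k) ^ n * p k) *\<^sub>R ?f n)"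
        by (rule geometric_pmf_integral(2)[OF p(1,2) sum])
      also have "\<dots> = (\<Sum>n. of_real (p k) * (F n * of_real ((1 - p k) ^ n) * cis (- real n * \<theta> j)))"
        by (simp add: scaleR_conv_of_real cyclic_flow_def cis_cnj mult_ac)
      also have "\<dots> = of_real (p k) * (\<Sum>n. F n * of_real ((1 - p k) ^ n) * cis (- real n * \<theta> j))"
      proof (rule suminf_mult)
        have cm: "cmod (of_real (1 - p k)) = 1 - p k" using p[of k] by (subst norm_of_real) simp
        have "summable (\<lambda>n. cmod (F n) * (1 - p k) ^ n)" using F p[of k] by (simp add: sequence_error_def)
        then have "summable (\<lambda>n. norm (F n * of_real ((1 - p k) ^ n) * cis (- real n * \<theta> j)))"
          using cm by (simp add: norm_mult norm_power del: of_real_diff)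
        then show "summable (\<lambda>n. F n * of_real ((1 - p k) ^ n) * cis (- real n * \<theta> j))"
          by (rule summable_norm_cancel)
      qed
      finally show ?thesis by simp
    qed
    moreover have "(\<lambda>k. of_real (1 - (1 - p k)) * (\<Sum>n. F n * of_real ((1 - p k) ^ n) * cis (- real n * \<theta> j))) \<longlonglongrightarrow> a $ j"
      using filterlim_compose[OF coeff[of j, unfolded has_disc_abel_coeff_def] rho_at] .
    ultimately show "(\<lambda>k. LINT n|geometric_pmf (p k). F n * cnj (cyclic_flow \<theta> (int n) $ j)) \<longlonglongrightarrow> a $ j" by simp
  next
    show "(\<lambda>n. mean n c) \<longlonglongrightarrow> l1_dual \<mu> (\<lambda>j z. z $ j) c"
    proof (rule mean_tendsto_l1_dual[OF torus_subgroup_cyclic disc_orbit_eq _ haar])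
      have step: "(\<lambda>k. mean k (c * cyclic_flow \<theta> 1) - mean k c) \<longlonglongrightarrow> 0" for c
      proof (rule Lim_null_comparison)
        let ?B = "real CARD('n) * norm c"
        have "\<bar>mean k (c * cyclic_flow \<theta> 1) - mean k c\<bar> \<le> 2 * ?B * p k" for k
        proof -
          have "mean k (c * cyclic_flow \<theta> 1) = (LINT n|geometric_pmf (p k). cmod (bdot c (cyclic_flow \<theta> (int (Suc n)))))"
            unfolding mean_def bdot_mult by (simp add: cyclic_flow_add)
          then show ?thesis
            unfolding mean_def[of k c]
            using geometric_pmf_translate[OF p(1,2), of "\<lambda>n. cmod (bdot c (cyclic_flow \<theta> (int n)))" ?B k]
              norm_bdot_le[OF cyclic_flow_torus, of c] by simp
        qed
        then show "\<forall>\<^sub>F k in sequentially. norm (mean k (c * cyclic_flow \<theta> 1) - mean k c) \<le> 2 * ?B * p k" by simp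
        show "(\<lambda>k. 2 * ?B * p k) \<longlonglongrightarrow> 0" by (rule tendsto_mult_right_zero[OF p_lim])
      qed
      have fwd: "(\<lambda>k. mean k (c * cyclic_flow \<theta> (int s)) - mean k c) \<longlonglongrightarrow> 0" for s :: nat and c
      proof (induction s)
        case (Suc s)
        have "c * cyclic_flow \<theta> (int (Suc s)) = (c * cyclic_flow \<theta> (int s)) * cyclic_flow \<theta> 1"
          using cyclic_flow_add[of \<theta> "int s" 1] by (simp add: mult.assoc add.commute)
        then have "(\<lambda>k. (mean k (c * cyclic_flow \<theta> (int (Suc s))) - mean k (c * cyclic_flow \<theta> (int s)))
            + (mean k (c * cyclic_flow \<theta> (int s)) - mean k c)) \<longlonglongrightarrow> 0 + 0"
          using step[of "c * cyclic_flow \<theta> (int s)"] Suc by (intro tendsto_add) simp_all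
        then show ?case by simp
      qed (simp add: cyclic_flow_0)
      fix z assume "z \<in> range (cyclic_flow \<theta>)"
      then obtain s where z: "z = cyclic_flow \<theta> s" by blast
      show "(\<lambda>n. mean n (c * z) - mean n c) \<longlonglongrightarrow> 0"
      proof (cases "0 \<le> s")
        case True
        then show ?thesis using fwd[of c "nat s"] z by simp
      next
        case False
        have "c * cyclic_flow \<theta> s * cyclic_flow \<theta> (- s) = c"
          unfolding mult.assoc by (simp flip: cyclic_flow_add add: cyclic_flow_0)
        then have "(\<lambda>n. - (mean n c - mean n (c * cyclic_flow \<theta> s))) \<longlonglongrightarrow> - 0"
          using fwd[of "c * cyclic_flow \<theta> s" "nat (- s)"] False by (intro tendsto_minus) simp
        then show ?thesis using z by simp
      qed
    qed auto
  next
    fix M assume M: "A < M"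
    then have "disc_tail_amplitude F < ennreal M"
      using tail A by (auto intro: le_less_trans simp: ennreal_less_iff)
    then obtain N where N: "\<forall>n\<ge>N. ennreal (cmod (F n)) \<le> ennreal M" using sequence_tail by blast
    show "\<exists>S\<in>sets (count_space UNIV). (\<forall>k. AE n in geometric_pmf (p k). n \<notin> S \<longrightarrow> cmod (F n) \<le> M) \<and>
        (\<lambda>k. LINT n|geometric_pmf (p k). indicator S n * cmod (F n)) \<longlonglongrightarrow> 0"
    proof (intro bexI[of _ "{..<N}"] conjI allI)
      show "AE n in geometric_pmf (p k). n \<notin> {..<N} \<longrightarrow> cmod (F n) \<le> M" for k
        using N M A by (auto simp: ennreal_le_iff intro!: AE_I2)
      show "(\<lambda>k. LINT n|geometric_pmf (p k). indicator {..<N} n * cmod (F n)) \<longlonglongrightarrow> 0"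
      proof (rule Lim_null_comparison)
        let ?K = "\<Sum>n<N. cmod (F n)"
        have "(LINT n|geometric_pmf (p k). indicator {..<N} n * cmod (F n)) \<le> p k * ?K" for k
        proof -
          have "(LINT n|geometric_pmf (p k). indicator {..<N} n * cmod (F n)) =
             (\<Sum>n. ((1 - p k) ^ n * p k) *\<^sub>R (indicator {..<N} n * cmod (F n)))"
            by (rule geometric_pmf_integral(2)[OF p(1,2)], rule summable_finite[of "{..<N}"]) auto
          also have "\<dots> = (\<Sum>n<N. ((1 - p k) ^ n * p k) *\<^sub>R (indicator {..<N} n * cmod (F n)))"
            by (rule suminf_finite) auto
          also have "\<dots> \<le> (\<Sum>n<N. p k * cmod (F n))"
            using p[of k] by (intro sum_mono) (auto simp: mult_left_le_one_le power_le_one intro!: mult_right_mono)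
          finally show ?thesis by (simp add: sum_distrib_left)
        qed
        then show "\<forall>\<^sub>F k in sequentially. norm (LINT n|geometric_pmf (p k). indicator {..<N} n * cmod (F n)) \<le> p k * ?K"
          by (simp add: abs_of_nonneg)
        show "(\<lambda>k. p k * ?K) \<longlonglongrightarrow> 0" by (rule tendsto_mult_left_zero[OF p_lim])
      qed
    qed simp
  qed
qed

section \<open>The powers on the circle\<close>

lemma comm_group_circle: "comm_group (mult_group_on circle)"
proof (rule comm_groupI)
  fix z assume "z \<in> carrier (mult_group_on circle)"
  then show "\<exists>w\<in>carrier (mult_group_on circle). w \<otimes>\<^bsub>mult_group_on circle\<^esub> z = \<one>\<^bsub>mult_group_on circle\<^esub>"
    by (intro bexI[of _ "inverse z"]) (auto simp: mult_group_on_def circle_def norm_inverse intro!: left_inverse)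
qed (auto simp: mult_group_on_def circle_def norm_mult)

lemma inv_circle:
  assumes "z \<in> circle"
  shows "inv\<^bsub>mult_group_on circle\<^esub> z = inverse z"
proof -
  interpret comm_group "mult_group_on circle" by (rule comm_group_circle)
  show ?thesis
    by (rule inv_equality) (use assms in \<open>auto simp: mult_group_on_def circle_def norm_inverse intro!: left_inverse\<close>)
qed

lemma compact_group_circle:
  "compact_metrizable_ab_group (mult_group_on circle) (top_of_set circle)"
proof -
  let ?G = "mult_group_on circle" and ?X = "top_of_set circle"
  interpret comm_group ?G by (rule comm_group_circle)
  show ?thesis
  proof
    show "topspace ?X = carrier ?G" by (simp add: mult_group_on_def)
    have "continuous_map (top_of_set (circle \<times> circle)) ?X (\<lambda>(x, y). x \<otimes>\<^bsub>?G\<^esub> y)"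
      unfolding continuous_map_subtopology_eu
      by (auto simp: mult_group_on_def circle_def norm_mult case_prod_beta intro!: continuous_intros)
    then show "continuous_map (prod_topology ?X ?X) ?X (\<lambda>(x, y). x \<otimes>\<^bsub>?G\<^esub> y)"
      by (simp flip: subtopology_Times)
    have "continuous_map ?X ?X inverse"
      unfolding continuous_map_subtopology_eu
      by (auto simp: circle_def norm_inverse intro!: continuous_intros)
    then show "continuous_map ?X ?X (\<lambda>x. inv\<^bsub>?G\<^esub> x)"
      by (rule continuous_map_eq) (simp add: inv_circle)
    have "circle = sphere 0 1" by (auto simp: circle_def)
    then have "compact circle" using compact_sphere[of "0 :: complex" 1] by simp
    then show "compact_space ?X" by (simp add: compact_space_subtopology)
    show "metrizable_space ?X" by (simp add: metrizable_space_euclidean metrizable_space_subtopology)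
  qed
qed

lemma integral_periodic_shift:
  fixes f :: "real \<Rightarrow> real"
  assumes cont: "continuous_on UNIV f" and per: "\<And>t. f (t + 2 * pi) = f t" and s: "0 \<le> s" "s \<le> 2 * pi"
  shows "integral {- pi..pi} (\<lambda>t. f (s + t)) = integral {- pi..pi} f"
proof -
  have int: "f integrable_on {a..b}" for a b
    by (intro integrable_continuous_interval continuous_on_subset[OF cont]) simp
  have shift: "integral {a..b} (\<lambda>t. f (c + t)) = integral {a + c..b + c} f" for a b c
    using integral_shift_Icc_real[of a b f c] by (simp add: o_def)
  have "integral {- pi..pi} (\<lambda>t. f (s + t)) = integral {- pi + s..pi} f + integral {pi..pi + s} f"
    unfolding shift by (rule Henstock_Kurzweil_Integration.integral_combine[symmetric, OF _ _ int]) (use s in auto)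
  also have "integral {pi..pi + s} f = integral {- pi..- pi + s} (\<lambda>t. f (2 * pi + t))"
    unfolding shift by (simp add: algebra_simps)
  also have "\<dots> = integral {- pi..- pi + s} f" using per by (simp add: add.commute)
  also have "integral {- pi + s..pi} f + integral {- pi..- pi + s} f = integral {- pi..pi} f"
    using Henstock_Kurzweil_Integration.integral_combine[of "- pi" "- pi + s" pi f] int s by simp
  finally show ?thesis .
qed

definition angle_law :: "real measure" where
  "angle_law = density lborel (\<lambda>t. ennreal (indicator {- pi..pi} t / (2 * pi)))"

lemma angle_law_integral:
  fixes f :: "real \<Rightarrow> real"
  assumes cont: "continuous_on UNIV f"
  shows "(LINT t|angle_law. f t) = integral {- pi..pi} f / (2 * pi)"
proof -
  have meas [measurable]: "f \<in> borel_measurable borel" using cont by (rule borel_measurable_continuous_onI)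
  have set_int: "set_integrable lborel {- pi..pi} f"
    by (intro borel_integrable_atLeastAtMost' continuous_on_subset[OF cont]) simp
  have "(LINT t|angle_law. f t) = (LINT t|lborel. (indicator {- pi..pi} t / (2 * pi)) *\<^sub>R f t)"
    unfolding angle_law_def by (rule integral_density) auto
  also have "\<dots> = (LINT t|lborel. (indicator {- pi..pi} t *\<^sub>R f t) / (2 * pi))" by simp
  also have "\<dots> = (LINT t:{- pi..pi}|lborel. f t) / (2 * pi)"
    unfolding integral_divide_zero set_lebesgue_integral_def ..
  finally show ?thesis using set_borel_integral_eq_integral(2)[OF set_int] by simp
qed

lemma prob_space_angle_law: "prob_space angle_law"
proof
  have "emeasure angle_law (space angle_law) = (\<integral>\<^sup>+ t. ennreal (1 / (2 * pi)) * indicator {- pi..pi} t \<partial>lborel)"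
    by (auto simp: angle_law_def emeasure_density indicator_def intro!: nn_integral_cong)
  also have "\<dots> = ennreal (1 / (2 * pi)) * ennreal (2 * pi)"
    by (subst nn_integral_cmult_indicator) (auto simp: emeasure_lborel_Icc_eq)
  also have "\<dots> = 1" by (simp flip: ennreal_mult)
  finally show "emeasure angle_law (space angle_law) = 1" .
qed

text \<open>
  The uniform law of the angle is exactly invariant under rotation, so the averaging argument, applied
  to a constant sequence, identifies Haar measure on the circle.
\<close>

lemma haar_integral_circle:
  fixes f :: "complex \<Rightarrow> real"
  assumes haar: "haar_prob (mult_group_on circle) (top_of_set circle) \<nu>" and cont: "continuous_on UNIV f"
  shows "(LINT z|\<nu>. f z) = integral {- pi..pi} (\<lambda>t. f (cis t)) / (2 * pi)"
proof -
  interpret haar_group "mult_group_on circle" "top_of_set circle" \<nu>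
    unfolding haar_group_def haar_group_axioms_def using compact_group_circle haar by blast
  have sp: "space \<nu> = circle" by (simp add: space_haar mult_group_on_def)
  have [measurable]: "f \<in> borel_measurable borel" using cont by (rule borel_measurable_continuous_onI)
  have id_meas [measurable]: "(\<lambda>z. z) \<in> borel_measurable \<nu>"
    by (rule continuous_imp_measurable) (simp add: continuous_map_id_subt)
  have [measurable]: "cis \<in> borel_measurable borel"
    by (intro borel_measurable_continuous_onI continuous_intros)
  have "compact (f ` sphere 0 1)"
    by (intro compact_continuous_image continuous_on_subset[OF cont]) auto
  then have "bounded (f ` sphere 0 1)" by (rule compact_imp_bounded)
  then obtain B where "\<forall>y\<in>f ` sphere 0 1. norm y \<le> B" unfolding bounded_iff by (rule exE)
  then have B: "\<bar>f z\<bar> \<le> B" if "cmod z = 1" for z using that by simp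
  have cont_cis: "continuous_on UNIV (\<lambda>t. f (g * cis t))" for g
    by (intro continuous_on_compose2[OF cont] continuous_intros) simp
  let ?m = "LINT t|angle_law. f (cis t)"
  interpret A: prob_space angle_law by (rule prob_space_angle_law)
  have "(\<lambda>n::nat. ?m) \<longlonglongrightarrow> (LINT z|\<nu>. f z)"
  proof (rule tendsto_average_of_approx_invariant[where P = "\<lambda>_. angle_law" and T = borel and \<mu> = \<nu> and
        h = "\<lambda>t g. f (g * cis t)" and B = B])
    show "\<bar>f (g * cis t)\<bar> \<le> B" if "g \<in> space \<nu>" for t g
      using that by (intro B) (simp add: sp circle_def norm_mult)
    show "(LINT g|\<nu>. f (g * cis t)) = (LINT z|\<nu>. f z)" for t
      using integral_translation[of "cis t" f] by (simp add: mult_group_on_def circle_def mult.commute)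
    show "(\<lambda>n::nat. (LINT t|angle_law. f (g * cis t)) - ?m) \<longlonglongrightarrow> 0" if "g \<in> space \<nu>" for g
    proof -
      have g: "cis (Arg2pi g) = g"
        using that Arg2pi_eq[of g] by (simp add: sp circle_def cis_conv_exp)
      have "(LINT t|angle_law. f (g * cis t)) = integral {- pi..pi} (\<lambda>t. f (cis (Arg2pi g + t))) / (2 * pi)"
        using angle_law_integral[OF cont_cis[of g]] g by (simp flip: cis_mult)
      also have "\<dots> = integral {- pi..pi} (\<lambda>t. f (cis t)) / (2 * pi)"
        using integral_periodic_shift[of "\<lambda>t. f (cis t)" "Arg2pi g"] cont_cis[of 1] Arg2pi_ge_0[of g] Arg2pi_lt_2pi[of g]
        by (simp flip: cis_mult)
      also have "\<dots> = ?m" using angle_law_integral[OF cont_cis[of 1]] by simp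
      finally show ?thesis by simp
    qed
    have AE: "AE t in angle_law. f (cis t) \<le> B" "AE t in angle_law. - B \<le> f (cis t)"
      using B[of "cis _"] by (auto simp: abs_le_iff intro!: AE_I2) (smt (verit))
    have "integrable angle_law (\<lambda>t. f (cis t))"
      by (rule A.integrable_of_AE_bounded[of _ B]) (use B in \<open>auto simp: angle_law_def\<close>)
    then show "\<bar>?m\<bar> \<le> B" using A.integral_le_const[OF _ AE(1)] A.integral_ge_const[OF _ AE(2)] by (simp add: abs_le_iff)
    show "sets angle_law = sets borel" by (simp add: angle_law_def)
  qed (simp_all add: prob_space_axioms A.prob_space_axioms)
  then have "?m = (LINT z|\<nu>. f z)" by (simp add: LIMSEQ_const_iff)
  then show ?thesis using angle_law_integral[OF cont_cis[of 1]] by simp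
qed

lemma jordan_sin: "0 \<le> t \<Longrightarrow> t \<le> pi \<Longrightarrow> t / pi \<le> sin (t / 2)"
proof -
  assume t: "0 \<le> t" "t \<le> pi"
  have "concave_on {0..pi} sin"
    by (rule f''_le0_imp_concave[where f' = cos and f'' = "\<lambda>x. - sin x"])
       (auto intro!: derivative_eq_intros sin_ge_zero)
  from concave_onD[OF this, of "t / pi" 0 "pi / 2"] t show ?thesis by simp
qed

lemma norm_one_minus_cis: "cmod (1 - cis t) = 2 * \<bar>sin (t / 2)\<bar>"
proof -
  have "(cmod (1 - cis t))\<^sup>2 = 2 - 2 * cos t"
    using sin_cos_squared_add[of t] unfolding cmod_power2 by (simp add: power2_eq_square algebra_simps)
  also have "\<dots> = (2 * \<bar>sin (t / 2)\<bar>)\<^sup>2"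
    using cos_double_sin[of "t / 2"] by (simp add: power_mult_distrib)
  finally show ?thesis by (rule power2_eq_imp_eq) auto
qed

text \<open>
  The second bound is that of the closed form \<open>|z - z\<^bsup>m+1\<^esup>| / |1 - z|\<close>, with \<open>|1 - cis t| \<ge> 2 t / \<pi>\<close>.
\<close>

lemma dirichlet_bounds:
  shows "cmod (\<Sum>j\<in>{1..m}. cis t ^ j) \<le> real m"
    and "0 < t \<Longrightarrow> t \<le> pi \<Longrightarrow> cmod (\<Sum>j\<in>{1..m}. cis t ^ j) \<le> pi / t"
proof -
  show "cmod (\<Sum>j\<in>{1..m}. cis t ^ j) \<le> real m"
    using sum_norm_le[of "{1..m}" "\<lambda>j. cis t ^ j" "\<lambda>_. 1"] by (simp add: norm_power)
  assume t: "0 < t" "t \<le> pi"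
  let ?D = "\<Sum>j\<in>{1..m}. cis t ^ j"
  have "cmod ((1 - cis t) * ?D) \<le> 2"
  proof (cases "1 \<le> m")
    case True
    have "(1 - cis t) * ?D = cis t ^ 1 - cis t ^ Suc m" using True by (rule sum_gp_multiplied)
    then show ?thesis using norm_triangle_ineq4[of "cis t ^ 1" "cis t ^ Suc m"] by (simp add: norm_mult norm_power)
  qed simp
  moreover have "2 * (t / pi) \<le> cmod (1 - cis t)"
    using jordan_sin[of t] t unfolding norm_one_minus_cis by simp
  ultimately have "2 * (t / pi) * cmod ?D \<le> 2"
    unfolding norm_mult by (meson mult_right_mono norm_ge_zero order_trans)
  then show "cmod ?D \<le> pi / t" using t by (simp add: field_simps)
qed

text \<open>
  The bounds \<open>m\<close> and \<open>\<pi> / t\<close> cross at \<open>t = \<pi> / m\<close>. Cutting there, the two pieces of \<open>[0, \<pi>]\<close> contribute at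
  most \<open>\<pi>\<close> and \<open>\<pi> ln m\<close>.
\<close>

lemma dirichlet_integral_le:
  assumes m: "1 \<le> m"
  shows "integral {- pi..pi} (\<lambda>t. cmod (\<Sum>j\<in>{1..m}. cis t ^ j)) \<le> 2 * pi * (1 + ln (real m))"
proof -
  define D where "D t = cmod (\<Sum>j\<in>{1..m}. cis t ^ j)" for t
  have cont: "continuous_on S D" for S unfolding D_def by (intro continuous_intros)
  have int: "D integrable_on {a..b}" for a b by (intro integrable_continuous_interval cont)
  have even: "D (- t) = D t" for t
  proof -
    have "(\<Sum>j\<in>{1..m}. cis (- t) ^ j) = cnj (\<Sum>j\<in>{1..m}. cis t ^ j)" by (simp add: cis_cnj)
    then show ?thesis unfolding D_def by (simp only: complex_mod_cnj)
  qed
  have cut: "0 \<le> pi / m" "pi / m \<le> pi" "0 < pi / m" using m by (auto simp: field_simps)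
  have near: "integral {0..pi / m} D \<le> pi"
  proof -
    have "integral {0..pi / m} D \<le> integral {0..pi / m} (\<lambda>_. real m)"
    proof (rule integral_le[OF int])
      show "D t \<le> real m" for t unfolding D_def by (rule dirichlet_bounds(1))
    qed (intro integrable_continuous_interval continuous_on_const)
    then show ?thesis using cut m by simp
  qed
  have far: "integral {pi / m..pi} D \<le> pi * ln m"
  proof -
    have "((\<lambda>t. pi / t) has_integral (pi * ln pi - pi * ln (pi / m))) {pi / m..pi}"
    proof (rule fundamental_theorem_of_calculus[OF cut(2)])
      fix t assume "t \<in> {pi / m..pi}"
      then have "t > 0" using cut(3) by (simp add: order_less_le_trans)
      then show "((\<lambda>t. pi * ln t) has_vector_derivative pi / t) (at t within {pi / m..pi})"
        unfolding has_real_derivative_iff_has_vector_derivative[symmetric]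
        by (auto intro!: derivative_eq_intros)
    qed
    moreover have "pi * ln pi - pi * ln (pi / m) = pi * ln m"
      using m by (simp add: ln_div right_diff_distrib)
    ultimately have hi: "((\<lambda>t. pi / t) has_integral pi * ln m) {pi / m..pi}" by simp
    have "D t \<le> pi / t" if "t \<in> {pi / m..pi}" for t
      unfolding D_def by (rule dirichlet_bounds(2)) (use that cut(3) in auto)
    then show ?thesis
      using has_integral_le[OF integrable_integral[OF int] hi] by auto
  qed
  have half: "integral {0..pi} D \<le> pi + pi * ln m"
    using Henstock_Kurzweil_Integration.integral_combine[OF cut(1,2) int] near far by simp
  have "integral {- pi..0} D = integral {0..pi} D"
    using Henstock_Kurzweil_Integration.integral_reflect_real[where a = 0 and b = pi and f = D] by (simp add: even)
  then have "integral {- pi..pi} D \<le> 2 * (pi + pi * ln m)"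
    using Henstock_Kurzweil_Integration.integral_combine[of "- pi" 0 pi D] int half by simp
  then show ?thesis unfolding D_def by (simp add: algebra_simps)
qed

theorem interp_norm_circle_ge:
  assumes haar: "haar_prob (mult_group_on circle) (top_of_set circle) \<nu>" and m: "1 \<le> m"
  shows "ennreal (real m / (1 + ln (real m))) \<le> interp_norm \<nu> {1..m} (\<lambda>j z. z ^ j) (\<lambda>_. 1)"
proof -
  interpret haar_group "mult_group_on circle" "top_of_set circle" \<nu>
    unfolding haar_group_def haar_group_axioms_def using compact_group_circle haar by blast
  interpret unimodular_family \<nu> "{1..m}" "\<lambda>j z. z ^ j"
  proof
    show "(\<lambda>z. z ^ j) \<in> borel_measurable \<nu>" for j :: nat
      by (rule continuous_imp_measurable) (auto intro!: continuous_intros simp: continuous_map_iff_continuous)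
    show "cmod (z ^ j) = 1" if "z \<in> space \<nu>" for j z
      using that by (simp add: space_haar mult_group_on_def circle_def norm_power)
  qed
  have pos: "0 < 1 + ln (real m)" using m by (simp add: add_pos_nonneg)
  have "(LINT z|\<nu>. cmod (\<Sum>j\<in>{1..m}. 1 * z ^ j)) = integral {- pi..pi} (\<lambda>t. cmod (\<Sum>j\<in>{1..m}. cis t ^ j)) / (2 * pi)"
    using haar_integral_circle[OF haar, of "\<lambda>z. cmod (\<Sum>j\<in>{1..m}. z ^ j)"] by (simp add: continuous_intros)
  also have "\<dots> \<le> 1 + ln (real m)"
    using dirichlet_integral_le[OF m] by (simp add: field_simps)
  finally have "ennreal (cmod (\<Sum>j\<in>{1..m}. 1 * cnj 1) / (1 + ln (real m))) \<le> interp_norm \<nu> {1..m} (\<lambda>j z. z ^ j) (\<lambda>_. 1)"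
    by (rule interp_norm_ge[OF pos])
  then show ?thesis by simp
qed

section \<open>The certified lower endpoint\<close>

lemma orbit_case_lower_bound:
  fixes a :: "complex ^ 'n"
  assumes orbit: "orbit_case e Amp a G" and haar: "haar_prob (mult_group_on G) (top_of_set G) \<mu>"
  shows "compact_metrizable_ab_group (mult_group_on G) (top_of_set G)"
    and "distinct_characters (mult_group_on G) (top_of_set G) UNIV (\<lambda>j z. z $ j)"
    and "interp_norm \<mu> UNIV (\<lambda>j z. z $ j) (($) a) \<le> Amp"
proof -
  consider
    (line) F \<gamma> where "half_line_error F" "inj \<gamma>" "\<And>j. has_cont_abel_coeff F (\<gamma> j) (a $ j)"
      "cont_tail_amplitude F \<le> Amp" "G = cont_orbit \<gamma>"
  | (seq) F \<theta> where "sequence_error F" "\<And>i j. i \<noteq> j \<Longrightarrow> \<not> [\<theta> i = \<theta> j] (rmod 2 * pi)"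
      "\<And>j. has_disc_abel_coeff F (\<theta> j) (a $ j)" "disc_tail_amplitude F \<le> Amp" "G = disc_orbit \<theta>"
    using orbit unfolding orbit_case_def by blast
  then have *: "compact_metrizable_ab_group (mult_group_on G) (top_of_set G) \<and>
      distinct_characters (mult_group_on G) (top_of_set G) UNIV (\<lambda>j (z :: complex ^ 'n). z $ j) \<and>
      (\<forall>A\<ge>0. Amp = ennreal A \<longrightarrow> (\<forall>c. cmod (cdot a c) \<le> A * l1_dual \<mu> (\<lambda>j z. z $ j) c))"
  proof cases
    case line
    interpret torus_subgroup "range (line_flow \<gamma>)" by (rule torus_subgroup_line)
    show ?thesis
      using compact_group_closure distinct_characters_closure[OF line_flow_separates[OF line(2)]]
        half_line_bound[OF line(1,3)] line(4,5) haar
      by (auto simp: cont_orbit_eq)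
  next
    case seq
    interpret torus_subgroup "range (cyclic_flow \<theta>)" by (rule torus_subgroup_cyclic)
    show ?thesis
      using compact_group_closure distinct_characters_closure[OF cyclic_flow_separates[OF seq(2)]]
        sequence_bound[OF seq(1,3)] seq(4,5) haar
      by (auto simp: disc_orbit_eq)
  qed
  then show group: "compact_metrizable_ab_group (mult_group_on G) (top_of_set G)"
    and dist: "distinct_characters (mult_group_on G) (top_of_set G) UNIV (\<lambda>j z. z $ j)" by auto
  interpret haar_group "mult_group_on G" "top_of_set G" \<mu>
    unfolding haar_group_def haar_group_axioms_def using group haar by blast
  interpret orthonormal_family \<mu> "\<lambda>j z. z $ j" by (rule orthonormal_family_characters[OF dist])
  show "interp_norm \<mu> UNIV (\<lambda>j z. z $ j) (($) a) \<le> Amp"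
  proof (cases Amp)
    case (real A)
    then show ?thesis using * interp_norm_le_dual by auto
  qed simp
qed

theorem theorem38p1:
  fixes Err :: "'r \<Rightarrow> error_object"
    and A :: "error_object \<Rightarrow> ennreal"
    and U :: "'r \<Rightarrow> ennreal"
  shows
    \<comment> \<open>lower endpoint for the orbit group of an extracted error, also under uncertainty\<close>
    "(\<forall>(r :: 'r) (a :: complex ^ 'n) G \<mu>.
        A (Err r) \<le> U r \<and>
        orbit_case (Err r) (A (Err r)) a G \<and>
        haar_prob (mult_group_on G) (top_of_set G) \<mu>
        \<longrightarrow>
        compact_metrizable_ab_group (mult_group_on G) (top_of_set G) \<and>
        distinct_characters (mult_group_on G) (top_of_set G) UNIV (\<lambda>j z. z $ j) \<and>
        interp_norm \<mu> UNIV (\<lambda>j z. z $ j) (($) a) \<le> A (Err r) \<and> A (Err r) \<le> U r \<and>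
        (\<forall>b K. K \<noteq> {} \<and> compact K \<and> convex K \<and> a \<in> (\<lambda>u. b + u) ` K \<longrightarrow>
           (INF u\<in>K. interp_norm \<mu> UNIV (\<lambda>j z. z $ j) (($) (b + u))) \<le> A (Err r)))
   \<and> \<comment> \<open>(1), (2), (4): finite families of distinct characters\<close>
     (\<forall>(G :: 'g monoid) X \<mu> (chi :: 'n \<Rightarrow> 'g \<Rightarrow> complex).
        compact_metrizable_ab_group G X \<and> haar_prob G X \<mu> \<and> distinct_characters G X UNIV chi
        \<longrightarrow>
        (\<forall>a. interp_norm \<mu> UNIV chi (($) a) =
               (SUP c\<in>{c. c \<noteq> 0}. ennreal (cmod (cdot a c)) / ennreal (l1_dual \<mu> chi c))) \<and>
        (\<forall>b K. K \<noteq> {} \<and> compact K \<and> convex K \<longrightarrow>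
           enn2ereal (INF u\<in>K. interp_norm \<mu> UNIV chi (($) (b + u))) =
             (SUP c\<in>{c. l1_dual \<mu> chi c \<le> 1}. ereal (Re (cdot b c) - support_fun K (- c)))) \<and>
        (joint_map chi \<in> iso G (mult_group_on torus) \<and>
         homeomorphic_map X (top_of_set torus) (joint_map chi) \<longrightarrow>
           (\<forall>a. ennreal (norm a) \<le> interp_norm \<mu> UNIV chi (($) a) \<and>
                interp_norm \<mu> UNIV chi (($) a) \<le> ennreal (sqrt 2 * norm a))))
   \<and> \<comment> \<open>(3): countable families; the least norm is attained when it is finite\<close>
     (\<forall>(G :: 'g monoid) X \<mu> (chi :: nat \<Rightarrow> 'g \<Rightarrow> complex) (a :: nat \<Rightarrow> complex).
        compact_metrizable_ab_group G X \<and> haar_prob G X \<mu> \<and> distinct_characters G X {1..} chi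
        \<longrightarrow>
        interp_norm \<mu> {1..} chi a = (SUP m\<in>{1..}. interp_norm \<mu> {1..m} chi a) \<and>
        (interpolants \<mu> {1..} chi a \<noteq> {} \<longrightarrow>
           (\<exists>f\<in>interpolants \<mu> {1..} chi a. linf_norm \<mu> f = interp_norm \<mu> {1..} chi a)))
   \<and> \<comment> \<open>(4): the characters of the circle given by the first m powers\<close>
     (\<forall>\<nu> m. haar_prob (mult_group_on circle) (top_of_set circle) \<nu> \<and> 1 \<le> m \<longrightarrow>
        ennreal (real m / (1 + ln (real m))) \<le> interp_norm \<nu> {1..m} (\<lambda>j z. z ^ j) (\<lambda>_. 1))"
proof (intro conjI allI impI; (elim conjE)?)
  fix r and a :: "complex ^ 'n" and G \<mu>
  assume U: "A (Err r) \<le> U r" and orbit: "orbit_case (Err r) (A (Err r)) a G"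
    and haar: "haar_prob (mult_group_on G) (top_of_set G) \<mu>"
  note bound = orbit_case_lower_bound[OF orbit haar]
  show "compact_metrizable_ab_group (mult_group_on G) (top_of_set G)" by (rule bound(1))
  show "distinct_characters (mult_group_on G) (top_of_set G) UNIV (\<lambda>j z. z $ j)" by (rule bound(2))
  show "interp_norm \<mu> UNIV (\<lambda>j z. z $ j) (($) a) \<le> A (Err r)" by (rule bound(3))
  show "A (Err r) \<le> U r" by (rule U)
  fix b K assume "a \<in> (\<lambda>u. b + u) ` K"
  then obtain u where "u \<in> K" "a = b + u" by blast
  then show "(INF u\<in>K. interp_norm \<mu> UNIV (\<lambda>j z. z $ j) (($) (b + u))) \<le> A (Err r)"
    using bound(3) by (intro INF_lower2[of u]) auto
next
  fix G :: "'g monoid" and X \<mu> and chi :: "'n \<Rightarrow> 'g \<Rightarrow> complex"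
  assume group: "compact_metrizable_ab_group G X" and haar: "haar_prob G X \<mu>"
    and dist: "distinct_characters G X UNIV chi"
  interpret haar_group G X \<mu>
    unfolding haar_group_def haar_group_axioms_def using group haar by blast
  interpret orthonormal_family \<mu> chi by (rule orthonormal_family_characters[OF dist])
  show "interp_norm \<mu> UNIV chi (($) a) =
      (SUP c\<in>{c. c \<noteq> 0}. ennreal (cmod (cdot a c)) / ennreal (l1_dual \<mu> chi c))" for a
    by (rule interp_norm_eq_SUP)
  show "enn2ereal (INF u\<in>K. interp_norm \<mu> UNIV chi (($) (b + u))) =
      (SUP c\<in>{c. l1_dual \<mu> chi c \<le> 1}. ereal (Re (cdot b c) - support_fun K (- c)))"
    if "K \<noteq> {}" "compact K" "convex K" for b K
    using that by (rule INF_interp_norm_eq_SUP)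
  show "ennreal (norm a) \<le> interp_norm \<mu> UNIV chi (($) a)" for a by (rule norm_le_interp_norm)
  assume "joint_map chi \<in> iso G (mult_group_on torus)"
  then have "torus \<subseteq> joint_map chi ` carrier G"
    by (auto simp: iso_def bij_betw_def mult_group_on_def)
  then interpret orthonormal_pairs_family \<mu> chi
    by (rule orthonormal_pairs_family_full_torus[OF dist])
  show "interp_norm \<mu> UNIV chi (($) a) \<le> ennreal (sqrt 2 * norm a)" for a
    by (rule interp_norm_le_sqrt2_norm)
next
  fix G :: "'g monoid" and X \<mu> and chi :: "nat \<Rightarrow> 'g \<Rightarrow> complex" and a :: "nat \<Rightarrow> complex"
  assume group: "compact_metrizable_ab_group G X" and haar: "haar_prob G X \<mu>"
    and dist: "distinct_characters G X {1..} chi"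
  interpret haar_group G X \<mu>
    unfolding haar_group_def haar_group_axioms_def using group haar by blast
  interpret unimodular_family \<mu> "{1..}" chi by (rule unimodular_family_characters[OF dist])
  have trunc: "({1..} :: nat set) = (\<Union>m\<in>{1..}. {1..m})" "mono (\<lambda>m :: nat. {1..m})"
    by (auto simp: mono_def)
  show "interp_norm \<mu> {1..} chi a = (SUP m\<in>{1..}. interp_norm \<mu> {1..m} chi a)"
    by (rule interp_norm_eq_SUP_attained(1)[OF trunc])
  show "\<exists>f\<in>interpolants \<mu> {1..} chi a. linf_norm \<mu> f = interp_norm \<mu> {1..} chi a"
    if "interpolants \<mu> {1..} chi a \<noteq> {}"
    using that by (rule interp_norm_eq_SUP_attained(2)[OF trunc])
next
  fix \<nu> :: "complex measure" and m :: nat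
  assume "haar_prob (mult_group_on circle) (top_of_set circle) \<nu>" "1 \<le> m"
  then show "ennreal (real m / (1 + ln (real m))) \<le> interp_norm \<nu> {1..m} (\<lambda>j z. z ^ j) (\<lambda>_. 1)"
    by (rule interp_norm_circle_ge)
qed

end
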